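(* Let $d\ge 2$ and $\tilde m\ge 1$ be integers, let $\Phi:\mathbb{S}^d\times\mathbb{S}^d\to\mathbb{R}$ be a zonal kernel with expansion coefficients $(c_\ell)_{\ell\ge0}$ that is conditionally positive definite of order $\tilde m$, and let $\mathcal{L}=p(\Delta)$ with $p:\sigma(\Delta)\to\mathbb{R}$ such that $\lambda_\ell=p(\nu_\ell)$ grows at most algebraically in $\ell$ and $\sum_{\ell=0}^\infty c_\ell|\lambda_\ell|\ell^{d-1}$ converges absolutely. Suppose the separation $$\gamma:=\inf_{\ell\ge\tilde m}\lambda_\ell-\max_{\ell<\tilde m}\lambda_\ell$$ is positive. Then for any finite $\Pi_{\tilde m-1}$-unisolvent set $X\subset\mathbb{S}^d$ with $N$ points, the differentiation matrix $\mathbf{M}_X$ is diagonalizable, and for every matrix $\mathbf{M}^\epsilon\in\mathbb{R}^{N\times N}$ and every eigenvalue $\mu\in\sigma(\mathbf{M}^\epsilon)$, $$\mathrm{dist}(\mu,\sigma(\mathbf{M}_X))\le\Bigl(1+\frac{\|\mathbf{R}\|}{\gamma}\Bigr)^2\|\mathbf{V}\|\,\|\mathbf{V}^{-1}\|\,\|\mathbf{M}_X-\mathbf{M}^\epsilon\|,$$ where $\mathbf{R}$ and $\mathbf{V}$ are the matrices of the block decomposition of $\mathbf{M}_X$ described in the context.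
   Context: $\mathbb{S}^d\subset\mathbb{R}^{d+1}$ is the unit sphere and $\Delta$ its Laplace-Beltrami operator, with eigenvalues $\nu_\ell=-\ell(\ell+d-1)$, $\ell=0,1,2,\dots$; $\{Y_\ell^\mu\}_{\mu=1}^{N_\ell}$ is an $L_2(\mathbb{S}^d)$-orthonormal basis of real spherical harmonics of degree $\ell$. $\Pi_{k}=\mathrm{span}\{Y_\ell^\mu:\ell\le k,\ \mu\le N_\ell\}$. The operator $\mathcal{L}=p(\Delta)$ acts by $\mathcal{L}Y_\ell^\mu=\lambda_\ell Y_\ell^\mu$ with $\lambda_\ell=p(\nu_\ell)$. A zonal kernel is one with an absolutely and uniformly convergent expansion $\Phi(x,y)=\sum_{\ell=0}^\infty\sum_{\mu\le N_\ell}c_\ell Y_\ell^\mu(x)Y_\ell^\mu(y)$. It is conditionally positive definite of order $\tilde m$ if for every finite set $X=\{x_1,\dots,x_N\}\subset\mathbb{S}^d$ of distinct points, $\mathbf{\Phi}_X=(\Phi(x_j,x_k))_{j,k}$ is strictly positive definite on $\{\alpha\in\mathbb{R}^N:\sum_j\alpha_jp(x_j)=0\ \forall p\in\Pi_{\tilde m-1}\}$. $X$ is $\Pi_{\tilde m-1}$-unisolvent if the only element of $\Pi_{\tilde m-1}$ vanishing on $X$ is $0$. The trial space is $S_X(\Phi)=\{\sum_ja_j\Phi(\cdot,x_j):\sum_ja_jp(x_j)=0\ \forall p\in\Pi_{\tilde m-1}\}+\Pi_{\tilde m-1}$, and $\mathbf{M}_X\in\mathbb{R}^{N\times N}$ is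 the unique matrix with $\mathbf{M}_X(u|_X)=(\mathcal{L}u)|_X$ for all $u\in S_X(\Phi)$. Block decomposition. Let $M=\dim\Pi_{\tilde m-1}$, let $(p_j)_{j\le M}$ enumerate $\{Y_\ell^\mu:\ell<\tilde m\}$, let $\mathbf{P}\in\mathbb{R}^{N\times M}$ have entries $\mathbf{P}_{k,j}=p_j(x_k)$, let $\mathbf{P}^\dagger=(\mathbf{P}^T\mathbf{P})^{-1}\mathbf{P}^T$, and let $\boldsymbol{\Lambda}$ be the $M\times M$ diagonal matrix with $\boldsymbol{\Lambda}_{j,j}=\lambda_\ell$ when $p_j=Y_\ell^\mu$. Let $\mathbf{K}_X=(\mathcal{L}\Phi(x_j,x_k))_{j,k}$ with $\mathcal{L}\Phi(x,y)=\sum_\ell\sum_\mu c_\ell\lambda_\ell Y_\ell^\mu(x)Y_\ell^\mu(y)$. Let $\mathbf{W}\in\mathbb{R}^{N\times(N-M)}$ have orthonormal columns spanning $(\mathrm{range}\,\mathbf{P})^\perp$, let $\mathbf{A}=\mathbf{W}(\mathbf{W}^T\mathbf{\Phi}_X\mathbf{W})^{-1}\mathbf{W}^T$, let $\mathbf{S}=(\mathbf{W}^T\mathbf{\Phi}_X\mathbf{W})^{-1/2}$ (symmetric positive definite), and let $\mathbf{S}\mathbf{W}^T\mathbf{K}_X\mathbf{W}\mathbf{S}=\mathbf{U}\boldsymbol{\Theta}\mathbf{U}^T$ with $\mathbf{U}$ orthogonal and $\boldsymbol{\Theta}$ diagonal. Put $\mathbf{Z}=\mathbf{W}\mathbf{S}^{-1}\mathbf{U}$,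 $\mathbf{V}=(\mathbf{P}\ \ \mathbf{Z})$, and $\mathbf{R}=(\mathbf{P}^\dagger\mathbf{K}_X-\boldsymbol{\Lambda}\mathbf{P}^\dagger\mathbf{\Phi}_X)\mathbf{A}\mathbf{Z}$. Then $\mathbf{V}$ is invertible and $\mathbf{M}_X=\mathbf{V}\begin{pmatrix}\boldsymbol{\Lambda}&\mathbf{R}\\ \mathbf{0}&\boldsymbol{\Theta}\end{pmatrix}\mathbf{V}^{-1}$. $\|\cdot\|$ is the matrix norm induced by the Euclidean vector norm; $\sigma(\cdot)$ denotes the (complex) spectrum and $\mathrm{dist}(\mu,\sigma)=\min_{\lambda\in\sigma}|\mu-\lambda|$. *)

theory Defs
  imports
    "HOL-Analysis.Analysis"
    "HOL-Library.Landau_Symbols"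
    "Jordan_Normal_Form.Gauss_Jordan_Elimination"
    "Jordan_Normal_Form.Spectral_Radius"
begin

section \<open>Spherical harmonics\<close>

text \<open>
  The ambient space R^(d+1) is a Euclidean space \<open>'a\<close> with \<open>DIM('a) = d + 1\<close>, and the unit sphere
  is \<open>sphere 0 1\<close>. Functions on the sphere are total functions on \<open>'a\<close>; only their values on
  \<open>sphere 0 1\<close> are ever used.
\<close>

definition laplacian :: "('a::euclidean_space \<Rightarrow> real) \<Rightarrow> 'a \<Rightarrow> real" where
  "laplacian f x = (\<Sum>b\<in>Basis. (deriv ^^ 2) (\<lambda>t. f (x + t *\<^sub>R b)) 0)"

text \<open>
  The Laplace-Beltrami operator of the unit sphere is the Euclidean Laplacian of the extension that
  is constant along rays (\<open>sgn y = y /\<^sub>R norm y\<close>).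
\<close>

definition laplace_beltrami :: "('a::euclidean_space \<Rightarrow> real) \<Rightarrow> 'a \<Rightarrow> real" where
  "laplace_beltrami f x = laplacian (\<lambda>y. f (sgn y)) x"

definition spherical_harmonics :: "nat \<Rightarrow> ('a::euclidean_space \<Rightarrow> real) set" where
  "spherical_harmonics l = {f. \<exists>h. real_polynomial_function h \<and>
     (\<forall>t x. h (t *\<^sub>R x) = t ^ l * h x) \<and> (\<forall>x. laplacian h x = 0) \<and>
     (\<forall>x\<in>sphere 0 1. f x = h x)}"

definition beltrami_eigenvalue :: "nat \<Rightarrow> nat \<Rightarrow> real" where
  "beltrami_eigenvalue d l = - (real l * (real l + real d - 1))"

lemma laplace_beltrami_harmonic:
  fixes f :: "'a::euclidean_space \<Rightarrow> real"
  assumes f: "f \<in> spherical_harmonics l" and x: "x \<in> sphere 0 1" and dim: "DIM('a) = d + 1"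
  shows "laplace_beltrami f x = beltrami_eigenvalue d l * f x"
proof -
  obtain h where h: "real_polynomial_function h" and hom: "\<And>t y. h (t *\<^sub>R y) = t ^ l * h y"
    and harm: "\<And>y. laplacian h y = 0" and fh: "\<And>y. y \<in> sphere 0 1 \<Longrightarrow> f y = h y"
    using f unfolding spherical_harmonics_def by blast
  have nx: "norm x = 1" "x \<noteq> 0" using x by auto
  obtain D where D: "(h has_derivative D) (at x)"
    using differentiable_at_real_polynomial_function[OF h] unfolding differentiable_def by blast
  have lin: "bounded_linear D" using D by (rule has_derivative_bounded_linear)
  have dir: "((\<lambda>t. h (x + t *\<^sub>R v)) has_real_derivative D v) (at 0)" for v
  proof -
    have "((\<lambda>t. h (x + t *\<^sub>R v)) has_derivative (\<lambda>t. D (t *\<^sub>R v))) (at 0)"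
      by (rule has_derivative_compose[of "\<lambda>t. x + t *\<^sub>R v" "\<lambda>t. t *\<^sub>R v" 0 UNIV h D])
         (auto intro!: derivative_eq_intros simp: D)
    then show ?thesis
      by (rule has_derivative_imp_has_field_derivative)
         (use linear_scale[OF bounded_linear.linear[OF lin]] in auto)
  qed
  have euler: "D x = real l * h x"
  proof -
    have "((\<lambda>t. (1 + t) ^ l * h x) has_real_derivative real l * h x) (at 0)"
      by (auto intro!: derivative_eq_intros)
    moreover have "(\<lambda>t. h (x + t *\<^sub>R x)) = (\<lambda>t. (1 + t) ^ l * h x)"
      by (rule ext) (metis hom scaleR_add_left scaleR_one)
    ultimately show ?thesis using dir[of x] DERIV_unique by metis
  qed
  have Dsum: "(\<Sum>b\<in>Basis. (inner x b) * D b) = D x"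
    using linear_sum[OF bounded_linear.linear[OF lin], of "\<lambda>b. (inner x b) *\<^sub>R b" Basis]
      linear_scale[OF bounded_linear.linear[OF lin]]
    by (simp add: euclidean_representation)
  have second: "(deriv ^^ 2) (\<lambda>t. f (sgn (x + t *\<^sub>R b))) 0 =
      (real l * (real l + 2) * (inner x b)\<^sup>2 - real l) * h x - 2 * real l * (inner x b) * D b
      + (deriv ^^ 2) (\<lambda>t. h (x + t *\<^sub>R b)) 0" if b: "b \<in> Basis" for b
  proof -
    define s where "s = inner x b"
    define P where "P = (\<lambda>t. h (x + t *\<^sub>R b))"
    define q where "q = (\<lambda>t::real. 1 + 2 * t * s + t\<^sup>2)"
    define r where "r = - real l / 2"
    have "polynomial_function (\<lambda>t::real. x + t *\<^sub>R b)"
      by (intro polynomial_function_add polynomial_function_const polynomial_function_bounded_linear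
            bounded_linear_scaleR_left)
    then have "real_polynomial_function P"
      unfolding P_def using real_polynomial_function_compose[OF _ h, of "\<lambda>t. x + t *\<^sub>R b"]
      by (simp add: o_def)
    then obtain a k where P: "P = (\<lambda>t. \<Sum>i\<le>k. a i * t ^ i)"
      using real_polynomial_function_iff_sum[of P] by auto
    define P' where "P' = (\<lambda>t. \<Sum>i\<le>k. a i * (real i * t ^ (i - 1)))"
    define P'' where "P'' = (\<lambda>t. \<Sum>i\<le>k. a i * (real i * (real (i - 1) * t ^ (i - 1 - 1))))"
    have dP: "(P has_real_derivative P' t) (at t)" for t
      unfolding P P'_def by (auto intro!: derivative_eq_intros sum.cong)
    have dP': "(P' has_real_derivative P'' t) (at t)" for t
      unfolding P'_def P''_def by (auto intro!: derivative_eq_intros sum.cong)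
    have derP: "deriv P = P'" "deriv P' = P''" using dP dP' by (auto intro!: DERIV_imp_deriv)
    have nq: "(norm (x + t *\<^sub>R b))\<^sup>2 = q t" for t
      using nx(1) b unfolding q_def s_def power2_norm_eq_inner
      by (simp add: norm_eq_1 inner_add_left inner_add_right inner_commute algebra_simps power2_eq_square)
    have q0: "q 0 = 1" by (simp add: q_def)
    have dq: "(q has_real_derivative 2 * s + 2 * t) (at t)" for t
      unfolding q_def by (auto intro!: derivative_eq_intros)
    have "isCont q 0" using dq DERIV_isCont by blast
    then have ev: "eventually (\<lambda>t. q t > 0) (nhds 0)"
      unfolding isCont_def using order_tendstoD(1)[of q "q 0" "at 0" 0] q0
      by (auto simp: eventually_at_filter elim: eventually_mono)
    have g: "f (sgn (x + t *\<^sub>R b)) = q t powr r * P t" if "q t > 0" for t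
    proof -
      let ?y = "x + t *\<^sub>R b"
      have ny: "norm ?y > 0" using nq[of t] that by (metis norm_ge_zero less_eq_real_def zero_power2 less_irrefl)
      then have "f (sgn ?y) = h (sgn ?y)" by (intro fh) (auto simp: norm_sgn)
      also have "\<dots> = (inverse (norm ?y)) ^ l * h ?y" by (simp add: sgn_div_norm hom)
      also have "(inverse (norm ?y)) ^ l = norm ?y powr (- real l)"
        using ny by (simp add: powr_minus powr_realpow power_inverse)
      also have "\<dots> = ((norm ?y)\<^sup>2) powr r"
        using ny by (simp add: r_def powr_powr flip: powr_numeral)
      finally show ?thesis by (simp add: nq P_def)
    qed
    define G where "G = (\<lambda>t. f (sgn (x + t *\<^sub>R b)))"
    define G' where "G' = (\<lambda>t. r * q t powr (r - 1) * (2 * s + 2 * t) * P t + q t powr r * P' t)"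
    have evG: "eventually (\<lambda>t. G t = q t powr r * P t) (nhds 0)"
      using ev by eventually_elim (simp add: G_def g)
    have evG': "eventually (\<lambda>t. deriv G t = G' t) (nhds 0)"
    proof -
      have "eventually (\<lambda>t. eventually (\<lambda>t. G t = q t powr r * P t) (nhds t)) (nhds 0)"
        using evG by (simp add: eventually_eventually)
      then show ?thesis using ev
      proof eventually_elim
        case (elim t)
        have "((\<lambda>t. q t powr r * P t) has_real_derivative G' t) (at t)"
          unfolding G'_def using elim(2)
          by (auto intro!: derivative_eq_intros dq dP simp: powr_diff field_simps)
        then show ?case using deriv_cong_ev[OF elim(1) refl] DERIV_imp_deriv by metis
      qed
    qed
    have "deriv (deriv G) 0 = deriv G' 0" by (rule deriv_cong_ev[OF evG' refl])
    also have "\<dots> = (r * (r - 1) * (2 * s)\<^sup>2 + 2 * r) * P 0 + 2 * (2 * r * s) * P' 0 + P'' 0"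
      by (rule DERIV_imp_deriv, unfold G'_def)
         (auto intro!: derivative_eq_intros dq dP dP' simp: q0 power2_eq_square algebra_simps)
    also have "P' 0 = D b" using DERIV_unique[OF dP[of 0]] dir[of b] unfolding P_def by blast
    also have "P 0 = h x" by (simp add: P_def)
    finally have "deriv (deriv G) 0 = (r * (r - 1) * (2 * s)\<^sup>2 + 2 * r) * h x + 2 * (2 * r * s) * D b + P'' 0" .
    then show ?thesis
      using derP unfolding G_def[symmetric] P_def[symmetric] s_def[symmetric]
      by (simp add: numeral_2_eq_2 r_def) (simp add: power2_eq_square field_simps)
  qed
  have "(\<Sum>b\<in>Basis. (inner x b)\<^sup>2) = 1"
    using nx(1) euclidean_inner[of x x] by (simp add: power2_eq_square norm_eq_1)
  then have "laplace_beltrami f x = (real l * (real l + 2) - real l * real DIM('a)) * h x - 2 * real l * D x + laplacian h x"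
    unfolding laplace_beltrami_def laplacian_def Dsum[symmetric]
    by (simp add: second sum.distrib sum_subtractf flip: sum_distrib_left sum_distrib_right)
       (simp add: sum_distrib_left mult.assoc)
  then show ?thesis
    unfolding harm euler dim using fh[OF x] by (simp add: beltrami_eigenvalue_def algebra_simps)
qed

text \<open>
  Surface measure, by polar coordinates: a Borel set \<open>A\<close> of the sphere gets \<open>DIM('a)\<close> times the
  Lebesgue measure of the cone {t x | x in A, 0 < t <= 1}.
\<close>

definition surface_measure :: "'a::euclidean_space measure" where
  "surface_measure = scale_measure (ennreal (real DIM('a)))
     (distr (restrict_space lborel (cball 0 1 - {0})) (restrict_space borel (sphere 0 1)) sgn)"

definition sphere_inner :: "('a::euclidean_space \<Rightarrow> real) \<Rightarrow> ('a \<Rightarrow> real) \<Rightarrow> real" where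
  "sphere_inner f g = (LINT x|surface_measure. f x * g x)"

text \<open>\<open>Y l \<mu>\<close> with \<open>1 \<le> \<mu> \<le> n l\<close> is an orthonormal family, for each \<open>l\<close> a basis of the harmonics of degree \<open>l\<close>.\<close>

definition harmonic_basis :: "(nat \<Rightarrow> nat) \<Rightarrow> (nat \<Rightarrow> nat \<Rightarrow> 'a::euclidean_space \<Rightarrow> real) \<Rightarrow> bool" where
  "harmonic_basis n Y \<longleftrightarrow>
     (\<forall>l. \<forall>\<mu>\<in>{1..n l}. Y l \<mu> \<in> spherical_harmonics l) \<and>
     (\<forall>l l'. \<forall>\<mu>\<in>{1..n l}. \<forall>\<mu>'\<in>{1..n l'}.
        sphere_inner (Y l \<mu>) (Y l' \<mu>') = (if l = l' \<and> \<mu> = \<mu>' then 1 else 0)) \<and>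
     (\<forall>l. \<forall>f\<in>spherical_harmonics l. \<exists>a. \<forall>x\<in>sphere 0 1. f x = (\<Sum>\<mu>=1..n l. a \<mu> * Y l \<mu> x))"

definition harmonic_space ::
  "(nat \<Rightarrow> nat) \<Rightarrow> (nat \<Rightarrow> nat \<Rightarrow> 'a::euclidean_space \<Rightarrow> real) \<Rightarrow> nat \<Rightarrow> ('a \<Rightarrow> real) set" where
  "harmonic_space n Y k = {(\<lambda>x. \<Sum>l\<le>k. \<Sum>\<mu>=1..n l. b l \<mu> * Y l \<mu> x) | b. True}"

definition unisolvent ::
  "(nat \<Rightarrow> nat) \<Rightarrow> (nat \<Rightarrow> nat \<Rightarrow> 'a::euclidean_space \<Rightarrow> real) \<Rightarrow> nat \<Rightarrow> 'a set \<Rightarrow> bool" where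
  "unisolvent n Y k X \<longleftrightarrow>
     (\<forall>q\<in>harmonic_space n Y k. (\<forall>x\<in>X. q x = 0) \<longrightarrow> (\<forall>x\<in>sphere 0 1. q x = 0))"


section \<open>Kernels and the operator \<open>p(\<Delta>)\<close>\<close>

definition zonal_kernel ::
  "(nat \<Rightarrow> nat) \<Rightarrow> (nat \<Rightarrow> nat \<Rightarrow> 'a::euclidean_space \<Rightarrow> real) \<Rightarrow> (nat \<Rightarrow> real) \<Rightarrow> ('a \<Rightarrow> 'a \<Rightarrow> real) \<Rightarrow> bool" where
  "zonal_kernel n Y c \<Phi> \<longleftrightarrow>
     (\<forall>x\<in>sphere 0 1. \<forall>y\<in>sphere 0 1.
        summable (\<lambda>l. \<Sum>\<mu>=1..n l. \<bar>c l * Y l \<mu> x * Y l \<mu> y\<bar>)) \<and>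
     uniform_limit (sphere 0 1 \<times> sphere 0 1)
       (\<lambda>L (x, y). \<Sum>l<L. \<Sum>\<mu>=1..n l. c l * Y l \<mu> x * Y l \<mu> y) (\<lambda>(x, y). \<Phi> x y) sequentially"

text \<open>In the following two definitions the parameter is the order \<open>m \<ge> 1\<close>; the side conditions use degrees \<open>\<le> m - 1\<close>.\<close>

definition cond_pos_def ::
  "(nat \<Rightarrow> nat) \<Rightarrow> (nat \<Rightarrow> nat \<Rightarrow> 'a::euclidean_space \<Rightarrow> real) \<Rightarrow> nat \<Rightarrow> ('a \<Rightarrow> 'a \<Rightarrow> real) \<Rightarrow> bool" where
  "cond_pos_def n Y m \<Phi> \<longleftrightarrow>
     (\<forall>X \<alpha>. finite X \<and> X \<subseteq> sphere 0 1 \<and>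
        (\<forall>q\<in>harmonic_space n Y (m - 1). (\<Sum>x\<in>X. \<alpha> x * q x) = 0) \<and> (\<exists>x\<in>X. \<alpha> x \<noteq> 0) \<longrightarrow>
        (\<Sum>x\<in>X. \<Sum>y\<in>X. \<alpha> x * \<alpha> y * \<Phi> x y) > 0)"

definition trial_space ::
  "(nat \<Rightarrow> nat) \<Rightarrow> (nat \<Rightarrow> nat \<Rightarrow> 'a::euclidean_space \<Rightarrow> real) \<Rightarrow> nat \<Rightarrow> ('a \<Rightarrow> 'a \<Rightarrow> real) \<Rightarrow>
   nat \<Rightarrow> (nat \<Rightarrow> 'a) \<Rightarrow> ('a \<Rightarrow> real) set" where
  "trial_space n Y m \<Phi> N x =
     {(\<lambda>z. (\<Sum>j<N. a j * \<Phi> z (x j)) + q z) | a q.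
        (\<forall>r\<in>harmonic_space n Y (m - 1). (\<Sum>j<N. a j * r (x j)) = 0) \<and> q \<in> harmonic_space n Y (m - 1)}"

text \<open>
  The operator that multiplies \<open>Y l \<mu>\<close> by \<open>lam l\<close>, acting on a general function through its
  expansion in the orthonormal system \<open>Y\<close>.
\<close>

definition spectral_op ::
  "(nat \<Rightarrow> nat) \<Rightarrow> (nat \<Rightarrow> nat \<Rightarrow> 'a::euclidean_space \<Rightarrow> real) \<Rightarrow> (nat \<Rightarrow> real) \<Rightarrow> ('a \<Rightarrow> real) \<Rightarrow> 'a \<Rightarrow> real" where
  "spectral_op n Y lam u x = (\<Sum>l. \<Sum>\<mu>=1..n l. lam l * sphere_inner u (Y l \<mu>) * Y l \<mu> x)"

definition op_kernel ::
  "(nat \<Rightarrow> nat) \<Rightarrow> (nat \<Rightarrow> nat \<Rightarrow> 'a::euclidean_space \<Rightarrow> real) \<Rightarrow> (nat \<Rightarrow> real) \<Rightarrow> (nat \<Rightarrow> real) \<Rightarrow> 'a \<Rightarrow> 'a \<Rightarrow> real" where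
  "op_kernel n Y lam c x y = (\<Sum>l. \<Sum>\<mu>=1..n l. c l * lam l * Y l \<mu> x * Y l \<mu> y)"


section \<open>Matrices\<close>

definition inv_mat :: "real mat \<Rightarrow> real mat" where
  "inv_mat A = the (mat_inverse A)"

definition eucl_norm :: "real vec \<Rightarrow> real" where
  "eucl_norm v = sqrt (scalar_prod v v)"

definition op_norm :: "real mat \<Rightarrow> real" where
  "op_norm A = (SUP v\<in>{v \<in> carrier_vec (dim_col A). eucl_norm v \<le> 1}. eucl_norm (A *\<^sub>v v))"

definition diagonalizable :: "'a::field mat \<Rightarrow> bool" where
  "diagonalizable A \<longleftrightarrow> (\<exists>D. diagonal_mat D \<and> similar_mat A D)"

definition complex_spectrum :: "real mat \<Rightarrow> complex set" where
  "complex_spectrum A = spectrum (map_mat complex_of_real A)"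

definition spectral_dist :: "complex \<Rightarrow> complex set \<Rightarrow> real" where
  "spectral_dist z \<sigma> = Min ((\<lambda>w. cmod (z - w)) ` \<sigma>)"

definition sym_pos_def_mat :: "real mat \<Rightarrow> bool" where
  "sym_pos_def_mat A \<longleftrightarrow> dim_row A = dim_col A \<and> transpose_mat A = A \<and>
     (\<forall>v \<in> carrier_vec (dim_col A). v \<noteq> 0\<^sub>v (dim_col A) \<longrightarrow> scalar_prod v (A *\<^sub>v v) > 0)"

definition mat_range :: "real mat \<Rightarrow> real vec set" where
  "mat_range A = (\<lambda>v. A *\<^sub>v v) ` carrier_vec (dim_col A)"

definition orth_compl :: "nat \<Rightarrow> real vec set \<Rightarrow> real vec set" where
  "orth_compl N E = {v \<in> carrier_vec N. \<forall>w\<in>E. scalar_prod v w = 0}"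


section \<open>The differentiation matrix and its block decomposition\<close>

text \<open>The nodes are \<open>x 0, \<dots>, x (N - 1)\<close>; all matrix indices start at 0.\<close>

definition kernel_mat :: "nat \<Rightarrow> (nat \<Rightarrow> 'a) \<Rightarrow> ('a \<Rightarrow> 'a \<Rightarrow> real) \<Rightarrow> real mat" where
  "kernel_mat N x \<Phi> = mat N N (\<lambda>(j, k). \<Phi> (x j) (x k))"

definition is_diff_mat ::
  "(nat \<Rightarrow> nat) \<Rightarrow> (nat \<Rightarrow> nat \<Rightarrow> 'a::euclidean_space \<Rightarrow> real) \<Rightarrow> nat \<Rightarrow> ('a \<Rightarrow> 'a \<Rightarrow> real) \<Rightarrow>
   (nat \<Rightarrow> real) \<Rightarrow> nat \<Rightarrow> (nat \<Rightarrow> 'a) \<Rightarrow> real mat \<Rightarrow> bool" where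
  "is_diff_mat n Y m \<Phi> lam N x A \<longleftrightarrow> A \<in> carrier_mat N N \<and>
     (\<forall>u\<in>trial_space n Y m \<Phi> N x.
        A *\<^sub>v vec N (\<lambda>j. u (x j)) = vec N (\<lambda>j. spectral_op n Y lam u (x j)))"

definition diff_mat ::
  "(nat \<Rightarrow> nat) \<Rightarrow> (nat \<Rightarrow> nat \<Rightarrow> 'a::euclidean_space \<Rightarrow> real) \<Rightarrow> nat \<Rightarrow> ('a \<Rightarrow> 'a \<Rightarrow> real) \<Rightarrow>
   (nat \<Rightarrow> real) \<Rightarrow> nat \<Rightarrow> (nat \<Rightarrow> 'a) \<Rightarrow> real mat" where
  "diff_mat n Y m \<Phi> lam N x = (THE A. is_diff_mat n Y m \<Phi> lam N x A)"

text \<open>\<open>e\<close> enumerates the index pairs \<open>(l, \<mu>)\<close> of the harmonics of degree \<open>l < m\<close>.\<close>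

definition low_degree_enum :: "(nat \<Rightarrow> nat) \<Rightarrow> nat \<Rightarrow> nat \<Rightarrow> (nat \<Rightarrow> nat \<times> nat) \<Rightarrow> bool" where
  "low_degree_enum n m M e \<longleftrightarrow> bij_betw e {..<M} (SIGMA l:{..<m}. {1..n l})"

definition harmonic_mat ::
  "(nat \<Rightarrow> nat \<Rightarrow> 'a \<Rightarrow> real) \<Rightarrow> nat \<Rightarrow> (nat \<Rightarrow> nat \<times> nat) \<Rightarrow> nat \<Rightarrow> (nat \<Rightarrow> 'a) \<Rightarrow> real mat" where
  "harmonic_mat Y M e N x = mat N M (\<lambda>(k, j). Y (fst (e j)) (snd (e j)) (x k))"

definition low_degree_diag :: "(nat \<Rightarrow> real) \<Rightarrow> nat \<Rightarrow> (nat \<Rightarrow> nat \<times> nat) \<Rightarrow> real mat" where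
  "low_degree_diag lam M e = mat M M (\<lambda>(i, j). if i = j then lam (fst (e j)) else 0)"

definition pseudo_inv :: "real mat \<Rightarrow> real mat" where
  "pseudo_inv P = inv_mat (transpose_mat P * P) * transpose_mat P"

text \<open>
  The admissible choices in the block decomposition, with \<open>P\<close> of size \<open>N \<times> M\<close>, \<open>F\<close> the kernel
  matrix of \<open>\<Phi>\<close> and \<open>K\<close> that of \<open>L \<Phi>\<close>. The condition on \<open>S\<close> says that it is the inverse square root
  of \<open>W\<^sup>T F W\<close>.
\<close>

definition block_choice ::
  "nat \<Rightarrow> nat \<Rightarrow> real mat \<Rightarrow> real mat \<Rightarrow> real mat \<Rightarrow> real mat \<Rightarrow> real mat \<Rightarrow> real mat \<Rightarrow> real mat \<Rightarrow> bool" where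
  "block_choice N M P F K W S U \<Theta> \<longleftrightarrow>
     W \<in> carrier_mat N (N - M) \<and> transpose_mat W * W = 1\<^sub>m (N - M) \<and>
     mat_range W = orth_compl N (mat_range P) \<and>
     S \<in> carrier_mat (N - M) (N - M) \<and> sym_pos_def_mat S \<and>
     S * S = inv_mat (transpose_mat W * F * W) \<and>
     U \<in> carrier_mat (N - M) (N - M) \<and> transpose_mat U * U = 1\<^sub>m (N - M) \<and>
     \<Theta> \<in> carrier_mat (N - M) (N - M) \<and> diagonal_mat \<Theta> \<and>
     S * transpose_mat W * K * W * S = U * \<Theta> * transpose_mat U"

definition block_Z :: "real mat \<Rightarrow> real mat \<Rightarrow> real mat \<Rightarrow> real mat" where
  "block_Z W S U = W * inv_mat S * U"

definition block_V :: "real mat \<Rightarrow> real mat \<Rightarrow> real mat" where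
  "block_V P Z = four_block_mat P Z (0\<^sub>m 0 (dim_col P)) (0\<^sub>m 0 (dim_col Z))"

definition block_R :: "real mat \<Rightarrow> real mat \<Rightarrow> real mat \<Rightarrow> real mat \<Rightarrow> real mat \<Rightarrow> real mat \<Rightarrow> real mat" where
  "block_R P \<Lambda> F K W Z =
     (pseudo_inv P * K - \<Lambda> * pseudo_inv P * F) *
     (W * inv_mat (transpose_mat W * F * W) * transpose_mat W) * Z"

end

theory Submission
  imports Defs "Jordan_Normal_Form.Jordan_Normal_Form_Uniqueness"
begin

text \<open>
  For a node functional that annihilates the harmonics of degree less than \<open>m\<close>, the quadratic forms of
  \<open>\<Phi>\<close> and \<open>L \<Phi>\<close> are \<open>\<Sum> c_l q_l\<close> and \<open>\<Sum> c_l \<lambda>_l q_l\<close> over \<open>l \<ge> m\<close> with \<open>q_l \<ge> 0\<close>. Conditional positive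
  definiteness forces \<open>c_l \<ge> 0\<close> there, so the second form dominates the first one times
  \<open>inf \<lambda>_l\<close>, and all entries of \<open>\<Theta>\<close> exceed those of \<open>\<Lambda>\<close> by at least \<open>\<gamma>\<close>. Therefore the Sylvester
  equation \<open>X \<Theta> - \<Lambda> X = R\<close> has a solution of norm at most \<open>\<parallel>R\<parallel> / \<gamma>\<close>; conjugating with the
  unipotent block matrix of \<open>X\<close>, whose norm and inverse norm are at most \<open>1 + \<parallel>R\<parallel> / \<gamma>\<close>, diagonalizes the
  block triangular matrix, and the estimate is the Bauer-Fike theorem. The series of \<open>L \<Phi>\<close> converges because
  the sum of the squares of the harmonics of degree \<open>l\<close> is constant on the sphere by rotation invariance and
  their number is of order \<open>l ^ (d - 1)\<close>.
\<close>

text \<open>Diagonalizability is claimed without reference to \<open>W\<close>, \<open>S\<close>,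
  \<open>U\<close>, so it is not read off the block form. The relation defining the matrix is paired
  with annihilating coefficient vectors: symmetry of both kernel matrices excludes non-real
  eigenvalues, and the gap excludes Jordan chains that join a low degree eigenvalue to the kernel
  part.

  The factor \<open>1 / \<gamma>\<close> for the Sylvester equation depends on the position of the
  spectra. For two real sets at distance \<open>\<gamma>\<close> the best general constant is larger
  than 1; here one set lies to the left of a gap and the other to its right, and a shift turns the
  equation into a contraction.

  The sign of \<open>c_l\<close> is the main analytic obstacle. Conditional positive definiteness
  speaks of finite point sets, whereas \<open>c_l\<close> is the value of the quadratic form at a
  density, namely a harmonic. A quadrature rule replaces the density but annihilates the low degrees
  only approximately; small weights on the unisolvent nodes restore the moment conditions exactly,
  at a cost that tends to 0 with the mesh.\<close>

unbundle no vec_syntax and no inner_syntax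

section \<open>Real matrices\<close>

text \<open>This and the following rules trade \<open>carrier_mat\<close> premises for equations
  between dimensions, which the simplifier can discharge by itself; long products are then
  reassociated by rewriting.\<close>

lemma mat_assoc:
  fixes A B C :: "'a::semiring_0 mat"
  shows "dim_col A = dim_row B \<Longrightarrow> dim_col B = dim_row C \<Longrightarrow> A * B * C = A * (B * C)"
  by (rule assoc_mult_mat[of A "dim_row A" "dim_col A" B "dim_col B" C "dim_col C"]) (rule carrier_matI; simp)+

lemma mat_vec_assoc:
  fixes A B :: "'a::semiring_0 mat"
  shows "dim_col A = dim_row B \<Longrightarrow> dim_col B = dim_vec v \<Longrightarrow> (A * B) *\<^sub>v v = A *\<^sub>v (B *\<^sub>v v)"
  by (rule assoc_mult_mat_vec[of A "dim_row A" "dim_col A" B "dim_col B"])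
     (rule carrier_matI carrier_vecI; simp)+

lemma mat_vec_add:
  fixes A :: "'a::semiring_0 mat"
  shows "dim_col A = dim_vec v \<Longrightarrow> dim_vec w = dim_vec v \<Longrightarrow> A *\<^sub>v (v + w) = A *\<^sub>v v + A *\<^sub>v w"
  by (rule mult_add_distrib_mat_vec[of A "dim_row A" "dim_col A"]) (rule carrier_matI carrier_vecI; simp)+

lemma mat_vec_minus:
  fixes A :: "'a::ring mat"
  shows "dim_col A = dim_vec v \<Longrightarrow> dim_vec w = dim_vec v \<Longrightarrow> A *\<^sub>v (v - w) = A *\<^sub>v v - A *\<^sub>v w"
  by (rule mult_minus_distrib_mat_vec[of A "dim_row A" "dim_col A"]) (rule carrier_matI carrier_vecI; simp)+

lemma add_mat_vec:
  fixes A :: "'a::semiring_0 mat"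
  shows "dim_row A = dim_row B \<Longrightarrow> dim_col A = dim_vec v \<Longrightarrow> dim_col B = dim_vec v \<Longrightarrow>
    (A + B) *\<^sub>v v = A *\<^sub>v v + B *\<^sub>v v"
  by (rule add_mult_distrib_mat_vec[of A "dim_row A" "dim_col A"]) (rule carrier_matI carrier_vecI; simp)+

lemma minus_mat_vec:
  fixes A :: "'a::ring mat"
  shows "dim_row A = dim_row B \<Longrightarrow> dim_col A = dim_vec v \<Longrightarrow> dim_col B = dim_vec v \<Longrightarrow>
    (A - B) *\<^sub>v v = A *\<^sub>v v - B *\<^sub>v v"
  by (rule minus_mult_distrib_mat_vec[of A "dim_row A" "dim_col A"]) (rule carrier_matI carrier_vecI; simp)+

lemma mat_vec_smult:
  fixes A :: "'a::field mat"
  shows "dim_col A = dim_vec v \<Longrightarrow> A *\<^sub>v (k \<cdot>\<^sub>v v) = k \<cdot>\<^sub>v (A *\<^sub>v v)"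
  by (rule mult_mat_vec[of A "dim_row A" "dim_col A"]) (rule carrier_matI carrier_vecI; simp)+

lemma scalar_prod_mat_vec:
  fixes A :: "'a::comm_semiring_0 mat"
  shows "dim_vec v = dim_row A \<Longrightarrow> dim_vec w = dim_col A \<Longrightarrow>
    scalar_prod v (A *\<^sub>v w) = scalar_prod (A\<^sup>T *\<^sub>v v) w"
  using transpose_vec_mult_scalar[of A "dim_row A" "dim_col A" w v]
  by (metis carrier_matI carrier_vecI)

text \<open>Unit vectors read off the columns. Identities such as the block form can then be checked
  by following one arbitrary vector through both sides.\<close>

lemma mat_eq_by_vec:
  fixes A B :: "'a::semiring_1 mat"
  assumes "dim_row A = dim_row B" "dim_col A = n" "dim_col B = n"
    and "\<And>v. v \<in> carrier_vec n \<Longrightarrow> A *\<^sub>v v = B *\<^sub>v v"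
  shows "A = B"
proof (rule eq_matI)
  fix i j assume ij: "i < dim_row B" "j < dim_col B"
  have col: "(C *\<^sub>v unit_vec n j) $ i = C $$ (i, j)" if "dim_row C = dim_row B" "dim_col C = n" for C :: "'a mat"
  proof -
    have "row C i \<in> carrier_vec n" using that by auto
    then show ?thesis using ij assms(3) that by simp
  qed
  have "A *\<^sub>v unit_vec n j = B *\<^sub>v unit_vec n j" by (rule assms) simp
  then show "A $$ (i, j) = B $$ (i, j)" using col[of A] col[of B] assms(1-3) by simp
qed (use assms in auto)

text \<open>Zero rows pad \<open>A\<close> to a square matrix, whose determinant is 0 because the
  transpose kills the last unit vector. Used twice: to bound the number of low degree harmonics by
  the number of nodes, and to produce the combination of harmonics that contradicts a too large
  dimension.\<close>

lemma underdetermined_solution: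
  fixes A :: "'a::field mat"
  assumes A: "A \<in> carrier_mat k n" and "k < n"
  obtains v where "v \<in> carrier_vec n" "v \<noteq> 0\<^sub>v n" "A *\<^sub>v v = 0\<^sub>v k"
proof -
  define B where "B = mat n n (\<lambda>(i, j). if i < k then A $$ (i, j) else 0)"
  have B: "B \<in> carrier_mat n n" by (simp add: B_def)
  have "Determinant.det (B\<^sup>T) = 0"
  proof -
    have "B\<^sup>T *\<^sub>v unit_vec n (n - 1) = 0\<^sub>v n"
      by (rule eq_vecI) (use assms in \<open>auto simp: B_def\<close>)
    moreover have "unit_vec n (n - 1) \<noteq> (0\<^sub>v n :: 'a Matrix.vec)"
      using \<open>k < n\<close> by (auto dest!: arg_cong[of _ _ "\<lambda>v. v $ (n - 1)"])
    moreover have "B\<^sup>T \<in> carrier_mat n n" using B by simp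
    ultimately show ?thesis using det_0_iff_vec_prod_zero by (metis unit_vec_carrier)
  qed
  then have "Determinant.det B = 0" using Determinant.det_transpose[OF B] by simp
  then obtain v where v: "v \<in> carrier_vec n" "v \<noteq> 0\<^sub>v n" "B *\<^sub>v v = 0\<^sub>v n"
    using det_0_iff_vec_prod_zero[OF B] by auto
  have "(A *\<^sub>v v) $ i = 0" if "i < k" for i
  proof -
    have "(B *\<^sub>v v) $ i = 0" using v(3) that \<open>k < n\<close> by simp
    moreover have "row B i = row A i" by (rule eq_vecI) (use that A \<open>k < n\<close> in \<open>auto simp: B_def\<close>)
    ultimately show ?thesis using that A B \<open>k < n\<close> by simp
  qed
  then have "A *\<^sub>v v = 0\<^sub>v k" by (intro eq_vecI) (use A in auto)
  then show ?thesis using v that by blast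
qed

text \<open>\<open>inv_mat\<close> unwraps an option, so it means nothing until invertibility is
  known; a trivial kernel is the form in which invertibility is available throughout.\<close>

lemma inv_mat:
  assumes A: "A \<in> carrier_mat n n"
    and inj: "\<And>v. v \<in> carrier_vec n \<Longrightarrow> A *\<^sub>v v = 0\<^sub>v n \<Longrightarrow> v = 0\<^sub>v n"
  shows "inv_mat A \<in> carrier_mat n n" "A * inv_mat A = 1\<^sub>m n" "inv_mat A * A = 1\<^sub>m n"
proof -
  have "Determinant.det A \<noteq> 0" using inj det_0_iff_vec_prod_zero[OF A] by blast
  then have "A \<in> Units (ring_mat TYPE(real) n ())" by (rule det_non_zero_imp_unit[OF A])
  then obtain C where C: "mat_inverse A = Some C"
    using mat_inverse(1)[OF A, where b="()"] by fastforce
  then have "inv_mat A = C" by (simp add: inv_mat_def)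
  then show "inv_mat A \<in> carrier_mat n n" "A * inv_mat A = 1\<^sub>m n" "inv_mat A * A = 1\<^sub>m n"
    using mat_inverse(2)[OF A C] by auto
qed

section \<open>Diagonalizability of real matrices by way of the complex spectrum\<close>

lemma diagonal_jordan_matrix:
  assumes "\<And>n a. (n, a) \<in> set n_as \<Longrightarrow> n \<le> 1"
  shows "diagonal_mat (jordan_matrix n_as)"
  using assms
proof (induction n_as)
  case Nil
  then show ?case by (simp add: diagonal_mat_def jordan_matrix_def)
next
  case (Cons na n_as)
  obtain n a where na: "na = (n, a)" by force
  have n: "n \<le> 1" using Cons.prems[of n a] by (simp add: na)
  have IH: "diagonal_mat (jordan_matrix n_as)" using Cons by auto
  have "jordan_matrix n_as $$ (i, j) = 0"
    if "i \<noteq> j" "i < sum_list (map fst n_as)" "j < sum_list (map fst n_as)" for i j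
    using IH that by (auto simp: diagonal_mat_def)
  then show ?case unfolding na jordan_matrix_Cons diagonal_mat_def
    using n by (auto simp: jordan_matrix_Cons)
qed

text \<open>Real and imaginary part of \<open>A (v + i w) = (s + i t) (v + i w)\<close>. Everything
  later can stay with real vectors and real scalar products although the spectrum is
  complex.\<close>

lemma complex_eigenvector_parts:
  assumes A: "A \<in> carrier_mat n n" and ev: "eigenvalue (map_mat complex_of_real A) a"
  obtains v w where "v \<in> carrier_vec n" "w \<in> carrier_vec n" "v \<noteq> 0\<^sub>v n \<or> w \<noteq> 0\<^sub>v n"
    "A *\<^sub>v v = Re a \<cdot>\<^sub>v v - Im a \<cdot>\<^sub>v w" "A *\<^sub>v w = Im a \<cdot>\<^sub>v v + Re a \<cdot>\<^sub>v w"
proof -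
  let ?C = "map_mat complex_of_real A"
  have C: "?C \<in> carrier_mat n n" using A by simp
  from ev obtain z where z: "z \<in> carrier_vec n" "z \<noteq> 0\<^sub>v n" "?C *\<^sub>v z = a \<cdot>\<^sub>v z"
    using C unfolding eigenvalue_def eigenvector_def by auto
  define v w where "v = map_vec Re z" and "w = map_vec Im z"
  have vw: "v \<in> carrier_vec n" "w \<in> carrier_vec n" using z by (auto simp: v_def w_def)
  have entry: "(\<Sum>j<n. complex_of_real (A $$ (i, j)) * z $ j) = a * z $ i" if "i < n" for i
  proof -
    have "(?C *\<^sub>v z) $ i = (a \<cdot>\<^sub>v z) $ i" by (simp add: z)
    then show ?thesis using that A z(1) by (simp add: scalar_prod_def atLeast0LessThan)
  qed
  have "A *\<^sub>v v = Re a \<cdot>\<^sub>v v - Im a \<cdot>\<^sub>v w"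
  proof (rule eq_vecI)
    fix i assume "i < dim_vec (Re a \<cdot>\<^sub>v v - Im a \<cdot>\<^sub>v w)"
    then have i: "i < n" using vw by simp
    show "(A *\<^sub>v v) $ i = (Re a \<cdot>\<^sub>v v - Im a \<cdot>\<^sub>v w) $ i"
      using arg_cong[OF entry[OF i], of Re] i A z(1) vw
      by (simp add: scalar_prod_def atLeast0LessThan v_def w_def)
  qed (use A vw in auto)
  moreover have "A *\<^sub>v w = Im a \<cdot>\<^sub>v v + Re a \<cdot>\<^sub>v w"
  proof (rule eq_vecI)
    fix i assume "i < dim_vec (Im a \<cdot>\<^sub>v v + Re a \<cdot>\<^sub>v w)"
    then have i: "i < n" using vw by simp
    show "(A *\<^sub>v w) $ i = (Im a \<cdot>\<^sub>v v + Re a \<cdot>\<^sub>v w) $ i"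
      using arg_cong[OF entry[OF i], of Im] i A z(1) vw
      by (simp add: scalar_prod_def atLeast0LessThan v_def w_def)
  qed (use A vw in auto)
  moreover have "v \<noteq> 0\<^sub>v n \<or> w \<noteq> 0\<^sub>v n"
  proof (rule ccontr)
    assume "\<not> ?thesis"
    then have "v = 0\<^sub>v n" "w = 0\<^sub>v n" by auto
    then have "v $ i = 0" "w $ i = 0" if "i < n" for i using that by auto
    then have "z $ i = 0" if "i < n" for i using that z(1)
      by (simp add: v_def w_def complex_eq_iff)
    then show False using z by (metis eq_vecI carrier_vecD index_zero_vec)
  qed
  ultimately show ?thesis using vw that by blast
qed

text \<open>The Jordan form over the reals exists once the characteristic polynomial splits there.
  It splits over the complex numbers; the premise makes every root real, and the embedding of real
  polynomials into complex ones is injective.\<close>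

lemma char_poly_real_splits:
  assumes A: "A \<in> carrier_mat n n"
    and real: "\<And>s t v w. v \<in> carrier_vec n \<Longrightarrow> w \<in> carrier_vec n \<Longrightarrow> v \<noteq> 0\<^sub>v n \<or> w \<noteq> 0\<^sub>v n \<Longrightarrow>
      A *\<^sub>v v = s \<cdot>\<^sub>v v - t \<cdot>\<^sub>v w \<Longrightarrow> A *\<^sub>v w = t \<cdot>\<^sub>v v + s \<cdot>\<^sub>v w \<Longrightarrow> t = 0"
  shows "\<exists>as. char_poly A = (\<Prod>a\<leftarrow>as. [:- a, 1::real:])"
proof -
  let ?C = "map_mat complex_of_real A"
  have C: "?C \<in> carrier_mat n n" using A by simp
  obtain as where as: "char_poly ?C = (\<Prod>a\<leftarrow>as. [:- a, 1:])" using char_poly_factorized[OF C] by blast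
  have re: "Im a = 0" if "a \<in> set as" for a
  proof -
    have "poly (char_poly ?C) a = 0" using that unfolding as
      by (induction as) auto
    then have "eigenvalue ?C a" using eigenvalue_root_char_poly[OF C] by blast
    then obtain v w where "v \<in> carrier_vec n" "w \<in> carrier_vec n" "v \<noteq> 0\<^sub>v n \<or> w \<noteq> 0\<^sub>v n"
      "A *\<^sub>v v = Re a \<cdot>\<^sub>v v - Im a \<cdot>\<^sub>v w" "A *\<^sub>v w = Im a \<cdot>\<^sub>v v + Re a \<cdot>\<^sub>v w"
      using complex_eigenvector_parts[OF A] by metis
    then show ?thesis using real by blast
  qed
  interpret h: map_poly_inj_idom_hom complex_of_real ..
  have "map_poly complex_of_real (char_poly A) = map_poly complex_of_real (\<Prod>a\<leftarrow>map Re as. [:- a, 1:])"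
  proof -
    have "map_poly complex_of_real (char_poly A) = (\<Prod>a\<leftarrow>as. [:- a, 1:])"
      using of_real_hom.char_poly_hom[OF A] as by metis
    also have "\<dots> = (\<Prod>a\<leftarrow>as. map_poly complex_of_real [:- Re a, 1:])"
      using re by (intro arg_cong[of _ _ prod_list] map_cong refl) (auto simp: complex_eq_iff)
    also have "\<dots> = map_poly complex_of_real (\<Prod>a\<leftarrow>map Re as. [:- a, 1:])"
      by (simp add: h.hom_prod_list o_def)
    finally show ?thesis .
  qed
  then show ?thesis by (metis h.eq_iff)
qed

text \<open>The two premises exclude a non-real eigenvalue and a Jordan chain of length two. Both
  can be refuted by scalar products, so that no eigenbasis has to be constructed.\<close>

lemma diagonalizable_real_criterion:
  assumes A: "A \<in> carrier_mat n n"
    and real: "\<And>s t v w. v \<in> carrier_vec n \<Longrightarrow> w \<in> carrier_vec n \<Longrightarrow> v \<noteq> 0\<^sub>v n \<or> w \<noteq> 0\<^sub>v n \<Longrightarrow>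
      A *\<^sub>v v = s \<cdot>\<^sub>v v - t \<cdot>\<^sub>v w \<Longrightarrow> A *\<^sub>v w = t \<cdot>\<^sub>v v + s \<cdot>\<^sub>v w \<Longrightarrow> t = 0"
    and semisimple: "\<And>(s::real) v w. v \<in> carrier_vec n \<Longrightarrow> w \<in> carrier_vec n \<Longrightarrow>
      A *\<^sub>v v = s \<cdot>\<^sub>v v + w \<Longrightarrow> A *\<^sub>v w = s \<cdot>\<^sub>v w \<Longrightarrow> w = 0\<^sub>v n"
  shows "diagonalizable A"
proof -
  obtain n_as where jnf: "jordan_nf A n_as"
    using char_poly_real_splits[OF A] real jordan_nf_exists[OF A] by metis
  have size: "k \<le> 1" if mem: "(k, a) \<in> set n_as" for k a
  proof -
    let ?C = "char_matrix A a"
    have C: "?C \<in> carrier_mat n n" using A by (simp add: char_matrix_def)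
    have Cv: "?C *\<^sub>v v = A *\<^sub>v v - a \<cdot>\<^sub>v v" if "v \<in> carrier_vec n" for v
      unfolding char_matrix_def using that A
      by (subst add_mat_vec) (auto intro!: eq_vecI)
    have "v \<in> mat_kernel ?C" if "v \<in> mat_kernel (?C * ?C)" for v :: "real Matrix.vec"
    proof -
      have v: "v \<in> carrier_vec n" "?C *\<^sub>v (?C *\<^sub>v v) = 0\<^sub>v n"
        using that C unfolding mat_kernel_def by (auto simp: mat_vec_assoc)
      define w where "w = ?C *\<^sub>v v"
      have w: "w \<in> carrier_vec n" using C v by (simp add: w_def)
      have "A *\<^sub>v v = a \<cdot>\<^sub>v v + w"
        unfolding w_def Cv[OF v(1)] using v(1) A by (intro eq_vecI) auto
      moreover have "A *\<^sub>v w = a \<cdot>\<^sub>v w"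
      proof -
        have 0: "A *\<^sub>v w - a \<cdot>\<^sub>v w = 0\<^sub>v n" using v(2) Cv[OF w] by (simp add: w_def)
        show ?thesis
        proof (rule eq_vecI)
          fix i assume "i < dim_vec (a \<cdot>\<^sub>v w)"
          then have "i < n" using w by simp
          then show "(A *\<^sub>v w) $ i = (a \<cdot>\<^sub>v w) $ i"
            using arg_cong[OF 0, of "\<lambda>u. u $ i"] w A by simp
        qed (use w A in auto)
      qed
      ultimately have "w = 0\<^sub>v n" using semisimple v w by blast
      then show ?thesis using v C by (simp add: mat_kernel_def w_def)
    qed
    moreover have "v \<in> mat_kernel (?C * ?C)" if "v \<in> mat_kernel ?C" for v :: "real Matrix.vec"
      using that C by (auto simp: mat_kernel_def mat_vec_assoc)
    ultimately have ker: "mat_kernel (?C * ?C) = mat_kernel ?C" by blast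
    have "dim_gen_eigenspace A a 2 = dim_gen_eigenspace A a 1"
    proof -
      have "?C ^\<^sub>m 2 = ?C * ?C" "?C ^\<^sub>m 1 = ?C" using C by (auto simp: numeral_2_eq_2)
      then show ?thesis using C by (simp add: dim_gen_eigenspace_def kernel_dim_def ker)
    qed
    \<comment> \<open>Both dimensions are sums over the blocks for \<open>a\<close>, of
      \<open>min 2 n\<close> and of \<open>min 1 n\<close>; equality of the sums leaves no block of
      size two or more.\<close>
    then have eq: "(\<Sum>n\<leftarrow>map fst [(n, e)\<leftarrow>n_as. e = a]. min 2 n) = (\<Sum>n\<leftarrow>map fst [(n, e)\<leftarrow>n_as. e = a]. min 1 n)"
      by (simp only: dim_gen_eigenspace[OF jnf])
    have all: "\<forall>k\<in>set ks. k \<le> 1" if "(\<Sum>n\<leftarrow>ks. min 2 n) = (\<Sum>n\<leftarrow>ks. min 1 n)" for ks :: "nat list"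
      using that
    proof (induction ks)
      case (Cons k ks)
      have "(\<Sum>n\<leftarrow>ks. min 1 n) \<le> (\<Sum>n\<leftarrow>ks. min 2 n)" by (rule sum_list_mono) auto
      then show ?case using Cons by (auto simp: min_def split: if_splits)
    qed simp
    show ?thesis using all[OF eq] mem by force
  qed
  then have "diagonal_mat (jordan_matrix n_as)" by (intro diagonal_jordan_matrix) auto
  then show ?thesis using jnf by (auto simp: diagonalizable_def jordan_nf_def)
qed

subsection \<open>The operator norm\<close>

lemma diagonal_mat_vec_index:
  fixes D :: "'a::comm_semiring_0 mat"
  assumes "D \<in> carrier_mat n n" "diagonal_mat D" "v \<in> carrier_vec n" "i < n"
  shows "(D *\<^sub>v v) $ i = D $$ (i, i) * v $ i"
proof -
  have "(D *\<^sub>v v) $ i = (\<Sum>j<n. D $$ (i, j) * v $ j)"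
    using assms by (simp add: scalar_prod_def atLeast0LessThan)
  also have "\<dots> = (\<Sum>j<n. if j = i then D $$ (i, i) * v $ i else 0)"
    using assms by (intro sum.cong) (auto simp: diagonal_mat_def)
  finally show ?thesis using assms by simp
qed

lemma mult_diagonal_mat_index:
  fixes D :: "'a::comm_semiring_0 mat"
  assumes "D \<in> carrier_mat n n" "diagonal_mat D" "A \<in> carrier_mat m n" "i < m" "j < n"
  shows "(A * D) $$ (i, j) = A $$ (i, j) * D $$ (j, j)"
proof -
  have "(A * D) $$ (i, j) = (\<Sum>k<n. A $$ (i, k) * D $$ (k, j))"
    using assms by (simp add: scalar_prod_def atLeast0LessThan)
  also have "\<dots> = (\<Sum>k<n. if k = j then A $$ (i, j) * D $$ (j, j) else 0)"
    using assms by (intro sum.cong) (auto simp: diagonal_mat_def)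
  finally show ?thesis using assms by simp
qed

lemma eucl_norm_L2_set: "eucl_norm v = L2_set (\<lambda>i. v $ i) {..<dim_vec v}"
  by (simp add: eucl_norm_def L2_set_def scalar_prod_def power2_eq_square atLeast0LessThan)

lemma eucl_norm_nonneg [simp]: "eucl_norm v \<ge> 0"
  by (simp add: eucl_norm_L2_set L2_set_nonneg)

lemma eucl_norm_power2: "(eucl_norm v)\<^sup>2 = (\<Sum>i<dim_vec v. (v $ i)\<^sup>2)"
  by (simp add: eucl_norm_L2_set L2_set_def sum_nonneg)

lemma eucl_norm_power2_scalar: "(eucl_norm v)\<^sup>2 = scalar_prod v v"
  unfolding eucl_norm_power2 by (simp add: scalar_prod_def power2_eq_square atLeast0LessThan)

lemma eucl_norm_zero [simp]: "eucl_norm (0\<^sub>v n) = 0"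
  by (simp add: eucl_norm_L2_set L2_set_def)

lemma eucl_norm_eq_0: "eucl_norm v = 0 \<longleftrightarrow> v = 0\<^sub>v (dim_vec v)"
proof
  assume "eucl_norm v = 0"
  then have "\<forall>i<dim_vec v. v $ i = 0" by (simp add: eucl_norm_L2_set L2_set_eq_0_iff)
  then show "v = 0\<^sub>v (dim_vec v)" by (intro eq_vecI) auto
next
  assume "v = 0\<^sub>v (dim_vec v)"
  then show "eucl_norm v = 0" by (metis eucl_norm_zero)
qed

lemma eucl_norm_smult [simp]: "eucl_norm (c \<cdot>\<^sub>v v) = \<bar>c\<bar> * eucl_norm v"
proof -
  have "eucl_norm (c \<cdot>\<^sub>v v) = sqrt (c\<^sup>2 * (\<Sum>i<dim_vec v. (v $ i)\<^sup>2))"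
    by (simp add: eucl_norm_L2_set L2_set_def power_mult_distrib sum_distrib_left)
  then show ?thesis by (simp add: eucl_norm_L2_set L2_set_def real_sqrt_mult)
qed

lemma eucl_norm_triangle: "dim_vec v = dim_vec w \<Longrightarrow> eucl_norm (v + w) \<le> eucl_norm v + eucl_norm w"
proof -
  assume "dim_vec v = dim_vec w"
  then have "eucl_norm (v + w) = L2_set (\<lambda>i. v $ i + w $ i) {..<dim_vec w}"
    unfolding eucl_norm_L2_set by (intro L2_set_cong) auto
  with \<open>dim_vec v = dim_vec w\<close> show ?thesis
    unfolding eucl_norm_L2_set by (simp add: L2_set_triangle_ineq)
qed

lemma eucl_norm_diagonal_le:
  assumes "D \<in> carrier_mat n n" "diagonal_mat D" "v \<in> carrier_vec n" "c \<ge> 0"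
    and "\<And>i. i < n \<Longrightarrow> \<bar>D $$ (i, i)\<bar> \<le> c"
  shows "eucl_norm (D *\<^sub>v v) \<le> c * eucl_norm v"
proof (rule power2_le_imp_le)
  have "(eucl_norm (D *\<^sub>v v))\<^sup>2 = (\<Sum>i<n. (D $$ (i, i))\<^sup>2 * (v $ i)\<^sup>2)"
    unfolding eucl_norm_power2 using assms diagonal_mat_vec_index[OF assms(1,2,3)]
    by (auto simp: power_mult_distrib intro!: sum.cong)
  also have "\<dots> \<le> (\<Sum>i<n. c\<^sup>2 * (v $ i)\<^sup>2)"
    using assms by (intro sum_mono mult_right_mono) (auto simp: abs_le_square_iff[symmetric])
  also have "\<dots> = (c * eucl_norm v)\<^sup>2"
    using assms by (simp add: power_mult_distrib eucl_norm_power2 sum_distrib_left)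
  finally show "(eucl_norm (D *\<^sub>v v))\<^sup>2 \<le> (c * eucl_norm v)\<^sup>2" .
qed (use assms in auto)

text \<open>\<open>op_norm\<close> is a supremum of reals, usable only for a bounded set; the sum of
  all absolute entries is a crude but sufficient bound.\<close>

lemma op_norm_bdd_above:
  "bdd_above ((\<lambda>v. eucl_norm (A *\<^sub>v v)) ` {v \<in> carrier_vec (dim_col A). eucl_norm v \<le> 1})"
proof (rule bdd_aboveI2)
  fix v :: "real Matrix.vec" assume v: "v \<in> {v \<in> carrier_vec (dim_col A). eucl_norm v \<le> 1}"
  have v1: "\<bar>v $ j\<bar> \<le> 1" if "j < dim_col A" for j
  proof -
    have "\<bar>v $ j\<bar> \<le> eucl_norm v"
      using member_le_L2_set[of "{..<dim_vec v}" j "\<lambda>i. \<bar>v $ i\<bar>"] that v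
      by (auto simp: eucl_norm_L2_set L2_set_def)
    then show ?thesis using v by simp
  qed
  have "eucl_norm (A *\<^sub>v v) \<le> (\<Sum>i<dim_row A. \<bar>(A *\<^sub>v v) $ i\<bar>)"
    using L2_set_le_sum_abs[of "\<lambda>i. (A *\<^sub>v v) $ i" "{..<dim_row A}"] by (simp add: eucl_norm_L2_set)
  also have "\<dots> \<le> (\<Sum>i<dim_row A. \<Sum>j<dim_col A. \<bar>A $$ (i, j)\<bar>)"
  proof (rule sum_mono)
    fix i assume i: "i \<in> {..<dim_row A}"
    have "\<bar>(A *\<^sub>v v) $ i\<bar> \<le> (\<Sum>j<dim_col A. \<bar>A $$ (i, j) * v $ j\<bar>)"
      using i v by (auto simp: scalar_prod_def atLeast0LessThan intro!: sum_abs)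
    also have "\<dots> \<le> (\<Sum>j<dim_col A. \<bar>A $$ (i, j)\<bar>)"
      using v1 by (intro sum_mono) (auto simp: abs_mult mult_left_le)
    finally show "\<bar>(A *\<^sub>v v) $ i\<bar> \<le> (\<Sum>j<dim_col A. \<bar>A $$ (i, j)\<bar>)" .
  qed
  finally show "eucl_norm (A *\<^sub>v v) \<le> (\<Sum>i<dim_row A. \<Sum>j<dim_col A. \<bar>A $$ (i, j)\<bar>)" .
qed

lemma op_norm_nonneg [simp]: "op_norm A \<ge> 0"
proof -
  have "eucl_norm (A *\<^sub>v 0\<^sub>v (dim_col A)) \<le> op_norm A"
    unfolding op_norm_def by (rule cSUP_upper[OF _ op_norm_bdd_above]) auto
  then show ?thesis using eucl_norm_nonneg order_trans by blast
qed

lemma op_norm_bound: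
  assumes "v \<in> carrier_vec (dim_col A)"
  shows "eucl_norm (A *\<^sub>v v) \<le> op_norm A * eucl_norm v"
proof (cases "eucl_norm v = 0")
  case True
  then have "v = 0\<^sub>v (dim_col A)" using assms by (simp add: eucl_norm_eq_0)
  moreover have "A *\<^sub>v 0\<^sub>v (dim_col A) = 0\<^sub>v (dim_row A)" by (intro eq_vecI) auto
  ultimately show ?thesis by simp
next
  case False
  then have pos: "eucl_norm v > 0" by (simp add: less_le)
  have "eucl_norm (A *\<^sub>v (inverse (eucl_norm v) \<cdot>\<^sub>v v)) \<le> op_norm A"
    unfolding op_norm_def by (rule cSUP_upper[OF _ op_norm_bdd_above]) (use assms pos in auto)
  moreover have "A *\<^sub>v (inverse (eucl_norm v) \<cdot>\<^sub>v v) = inverse (eucl_norm v) \<cdot>\<^sub>v (A *\<^sub>v v)"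
    using assms by (intro mat_vec_smult) auto
  ultimately show ?thesis using pos by (simp add: field_simps)
qed

lemma op_norm_le:
  assumes "\<And>v. v \<in> carrier_vec (dim_col A) \<Longrightarrow> eucl_norm (A *\<^sub>v v) \<le> c * eucl_norm v" and "c \<ge> 0"
  shows "op_norm A \<le> c"
  unfolding op_norm_def
proof (rule cSUP_least)
  show "{v \<in> carrier_vec (dim_col A). eucl_norm v \<le> 1} \<noteq> {}"
    by (auto intro!: exI[of _ "0\<^sub>v (dim_col A)"])
  fix v :: "real Matrix.vec" assume "v \<in> {v \<in> carrier_vec (dim_col A). eucl_norm v \<le> 1}"
  then show "eucl_norm (A *\<^sub>v v) \<le> c"
    using assms(1)[of v] mult_left_mono[OF _ assms(2), of "eucl_norm v" 1] by auto
qed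

lemma op_norm_mult:
  assumes "dim_col A = dim_row B"
  shows "op_norm (A * B) \<le> op_norm A * op_norm B"
proof (rule op_norm_le)
  fix v :: "real Matrix.vec" assume "v \<in> carrier_vec (dim_col (A * B))"
  then have v: "v \<in> carrier_vec (dim_col B)" by simp
  have "(A * B) *\<^sub>v v = A *\<^sub>v (B *\<^sub>v v)" using assms v by (intro mat_vec_assoc) auto
  also have "eucl_norm \<dots> \<le> op_norm A * eucl_norm (B *\<^sub>v v)"
    using assms by (intro op_norm_bound) (auto intro: carrier_vecI)
  also have "\<dots> \<le> op_norm A * (op_norm B * eucl_norm v)"
    using op_norm_bound[OF v] by (intro mult_left_mono) auto
  finally show "eucl_norm ((A * B) *\<^sub>v v) \<le> op_norm A * op_norm B * eucl_norm v" by simp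
qed simp

lemma eucl_norm_append_power2:
  "(eucl_norm (v @\<^sub>v w))\<^sup>2 = (eucl_norm v)\<^sup>2 + (eucl_norm w)\<^sup>2"
  unfolding eucl_norm_power2_scalar by (rule scalar_prod_append) (rule carrier_vecI, rule refl)+

text \<open>The matrix is the identity plus the map sending \<open>(a, b)\<close> to
  \<open>(X b, 0)\<close>, and that map has norm at most that of \<open>X\<close> because
  \<open>b\<close> is no longer than \<open>(a, b)\<close>.\<close>

lemma op_norm_unipotent:
  fixes X :: "real mat"
  assumes X: "X \<in> carrier_mat m k"
  shows "op_norm (four_block_mat (1\<^sub>m m) X (0\<^sub>m k m) (1\<^sub>m k)) \<le> 1 + op_norm X"
proof (rule op_norm_le)
  fix v :: "real Matrix.vec" assume v: "v \<in> carrier_vec (dim_col (four_block_mat (1\<^sub>m m) X (0\<^sub>m k m) (1\<^sub>m k)))"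
  define a b where "a = vec_first v m" and "b = vec_last v k"
  have ab: "a \<in> carrier_vec m" "b \<in> carrier_vec k" "v = a @\<^sub>v b"
    using v X by (auto simp: a_def b_def vec_first_last_append)
  have "four_block_mat (1\<^sub>m m) X (0\<^sub>m k m) (1\<^sub>m k) *\<^sub>v v = (1\<^sub>m m *\<^sub>v a + X *\<^sub>v b) @\<^sub>v (0\<^sub>m k m *\<^sub>v a + 1\<^sub>m k *\<^sub>v b)"
    unfolding ab(3) by (rule four_block_mat_mult_vec[OF _ X]) (use ab in auto)
  also have "\<dots> = (a @\<^sub>v b) + (X *\<^sub>v b @\<^sub>v 0\<^sub>v k)"
    using ab X by (intro eq_vecI) (auto simp: append_vec_def Let_def)
  finally have "eucl_norm (four_block_mat (1\<^sub>m m) X (0\<^sub>m k m) (1\<^sub>m k) *\<^sub>v v)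
      \<le> eucl_norm v + eucl_norm (X *\<^sub>v b @\<^sub>v 0\<^sub>v k)"
    using ab X eucl_norm_triangle by (simp add: append_vec_def)
  moreover have "eucl_norm (X *\<^sub>v b @\<^sub>v 0\<^sub>v k) = eucl_norm (X *\<^sub>v b)"
    using eucl_norm_append_power2[of "X *\<^sub>v b" "0\<^sub>v k"] by (simp add: power2_eq_iff_nonneg)
  moreover have "eucl_norm (X *\<^sub>v b) \<le> op_norm X * eucl_norm b" using ab X by (intro op_norm_bound) auto
  moreover have "eucl_norm b \<le> eucl_norm v"
    by (rule power2_le_imp_le) (use eucl_norm_append_power2[of a b] in \<open>auto simp: ab(3)\<close>)
  then have "op_norm X * eucl_norm b \<le> op_norm X * eucl_norm v" by (intro mult_left_mono) auto
  ultimately show "eucl_norm (four_block_mat (1\<^sub>m m) X (0\<^sub>m k m) (1\<^sub>m k) *\<^sub>v v) \<le> (1 + op_norm X) * eucl_norm v"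
    by (simp add: algebra_simps)
qed simp

text \<open>Shifting by a lower bound of \<open>\<Lambda>\<close> makes \<open>\<Lambda>\<close> a matrix of norm at most \<open>\<rho>\<close> and
  \<open>\<Theta>\<close> one whose inverse has norm at most \<open>1 / (\<rho> + \<gamma>)\<close>.\<close>

lemma sylvester_bound:
  assumes X: "X \<in> carrier_mat m k" and L: "\<Lambda> \<in> carrier_mat m m" "diagonal_mat \<Lambda>"
    and T: "\<Theta> \<in> carrier_mat k k" "diagonal_mat \<Theta>" and "\<gamma> > 0"
    and Lle: "\<And>i. i < m \<Longrightarrow> \<Lambda> $$ (i, i) \<le> \<kappa> - \<gamma>" and Tge: "\<And>j. j < k \<Longrightarrow> \<Theta> $$ (j, j) \<ge> \<kappa>"
  shows "\<gamma> * op_norm X \<le> op_norm (X * \<Theta> - \<Lambda> * X)"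
proof -
  \<comment> \<open>Including \<open>\<kappa> - \<gamma>\<close> keeps the set nonempty for
    \<open>m = 0\<close> and yields \<open>\<rho> \<ge> 0\<close> directly.\<close>
  define \<sigma> where "\<sigma> = Min (insert (\<kappa> - \<gamma>) ((\<lambda>i. \<Lambda> $$ (i, i)) ` {..<m}))"
  define \<rho> where "\<rho> = \<kappa> - \<gamma> - \<sigma>"
  define R where "R = X * \<Theta> - \<Lambda> * X"
  have R: "R \<in> carrier_mat m k" using X L T unfolding R_def by (intro minus_carrier_mat mult_carrier_mat)
  have \<rho>: "\<rho> \<ge> 0" by (simp add: \<rho>_def \<sigma>_def)
  have L\<sigma>: "\<sigma> \<le> \<Lambda> $$ (i, i)" if "i < m" for i unfolding \<sigma>_def using that by (intro Min_le) auto
  have T\<sigma>: "\<Theta> $$ (j, j) - \<sigma> \<ge> \<rho> + \<gamma>" if "j < k" for j using Tge[OF that] by (simp add: \<rho>_def)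
  define D where "D = mat k k (\<lambda>(i, j). if i = j then 1 / (\<Theta> $$ (j, j) - \<sigma>) else 0)"
  have D: "D \<in> carrier_mat k k" "diagonal_mat D" by (auto simp: D_def diagonal_mat_def)
  have main: "eucl_norm (X *\<^sub>v v) \<le> (op_norm R + \<rho> * op_norm X) / (\<rho> + \<gamma>) * eucl_norm v"
    if v: "v \<in> carrier_vec k" for v
  proof -
    define w where "w = D *\<^sub>v v"
    have w: "w \<in> carrier_vec k" using D v by (simp add: w_def)
    have "eucl_norm w \<le> 1 / (\<rho> + \<gamma>) * eucl_norm v"
      unfolding w_def
    proof (rule eucl_norm_diagonal_le[OF D v])
      fix i assume i: "i < k"
      then show "\<bar>D $$ (i, i)\<bar> \<le> 1 / (\<rho> + \<gamma>)"
        using T\<sigma>[OF i] \<rho> \<open>\<gamma> > 0\<close> by (auto simp: D_def intro!: divide_left_mono mult_pos_pos)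
    qed (use \<rho> \<open>\<gamma> > 0\<close> in auto)
    have "v = \<Theta> *\<^sub>v w - \<sigma> \<cdot>\<^sub>v w"
    proof (rule eq_vecI)
      fix i assume "i < dim_vec (\<Theta> *\<^sub>v w - \<sigma> \<cdot>\<^sub>v w)"
      then have i: "i < k" using w by simp
      have "(\<Theta> *\<^sub>v w) $ i = \<Theta> $$ (i, i) * w $ i" "w $ i = 1 / (\<Theta> $$ (i, i) - \<sigma>) * v $ i"
        using diagonal_mat_vec_index[OF T w i] diagonal_mat_vec_index[OF D v i] i
        by (simp_all add: w_def D_def)
      moreover have "\<Theta> $$ (i, i) - \<sigma> > 0" using T\<sigma>[OF i] \<rho> \<open>\<gamma> > 0\<close> by simp
      ultimately have "v $ i = (\<Theta> $$ (i, i) - \<sigma>) * w $ i" by simp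
      then show "v $ i = (\<Theta> *\<^sub>v w - \<sigma> \<cdot>\<^sub>v w) $ i"
        using i w \<open>(\<Theta> *\<^sub>v w) $ i = _\<close> by (simp add: left_diff_distrib)
    qed (use v w in auto)
    \<comment> \<open>With \<open>w = (\<Theta> - \<sigma>)^-1 v\<close> and
      \<open>S = \<Lambda> - \<sigma>\<close>, the equation
      \<open>X \<Theta> - \<Lambda> X = R\<close> reads \<open>X v = R w + S (X w)\<close>.\<close>
    define S where "S = \<Lambda> - \<sigma> \<cdot>\<^sub>m 1\<^sub>m m"
    have S: "S \<in> carrier_mat m m" "diagonal_mat S" using L by (auto simp: S_def diagonal_mat_def)
    have "X *\<^sub>v v = R *\<^sub>v w + S *\<^sub>v (X *\<^sub>v w)"
    proof -
      have "X *\<^sub>v v = X *\<^sub>v (\<Theta> *\<^sub>v w) - \<sigma> \<cdot>\<^sub>v (X *\<^sub>v w)"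
        unfolding \<open>v = _\<close> using X T w by (simp add: mat_vec_minus mat_vec_smult)
      moreover have "R *\<^sub>v w = X *\<^sub>v (\<Theta> *\<^sub>v w) - \<Lambda> *\<^sub>v (X *\<^sub>v w)"
        unfolding R_def using X T L w by (simp add: minus_mat_vec mat_vec_assoc)
      moreover have "S *\<^sub>v (X *\<^sub>v w) = \<Lambda> *\<^sub>v (X *\<^sub>v w) - \<sigma> \<cdot>\<^sub>v (X *\<^sub>v w)"
      proof (rule eq_vecI)
        fix i assume "i < dim_vec (\<Lambda> *\<^sub>v (X *\<^sub>v w) - \<sigma> \<cdot>\<^sub>v (X *\<^sub>v w))"
        then have i: "i < m" using X by simp
        have "X *\<^sub>v w \<in> carrier_vec m" using X w by simp
        then show "(S *\<^sub>v (X *\<^sub>v w)) $ i = (\<Lambda> *\<^sub>v (X *\<^sub>v w) - \<sigma> \<cdot>\<^sub>v (X *\<^sub>v w)) $ i"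
          using diagonal_mat_vec_index[OF S _ i] diagonal_mat_vec_index[OF L _ i] i L X
          by (simp add: S_def left_diff_distrib del: index_mult_mat_vec)
      qed (use X S in auto)
      ultimately show ?thesis using X T L R w by (intro eq_vecI) auto
    qed
    then have "eucl_norm (X *\<^sub>v v) \<le> eucl_norm (R *\<^sub>v w) + eucl_norm (S *\<^sub>v (X *\<^sub>v w))"
      using eucl_norm_triangle R S by simp
    also have "\<dots> \<le> op_norm R * eucl_norm w + \<rho> * (op_norm X * eucl_norm w)"
    proof (rule add_mono)
      show "eucl_norm (R *\<^sub>v w) \<le> op_norm R * eucl_norm w" using R w by (intro op_norm_bound) auto
      have "eucl_norm (S *\<^sub>v (X *\<^sub>v w)) \<le> \<rho> * eucl_norm (X *\<^sub>v w)"
      proof (rule eucl_norm_diagonal_le[OF S _ \<rho>])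
        fix i assume i: "i < m"
        then show "\<bar>S $$ (i, i)\<bar> \<le> \<rho>"
          using L\<sigma>[OF i] Lle[OF i] L by (simp add: S_def \<rho>_def)
      qed (use X w in auto)
      also have "\<dots> \<le> \<rho> * (op_norm X * eucl_norm w)"
        using \<rho> X w by (intro mult_left_mono op_norm_bound) auto
      finally show "eucl_norm (S *\<^sub>v (X *\<^sub>v w)) \<le> \<rho> * (op_norm X * eucl_norm w)" .
    qed
    also have "\<dots> = (op_norm R + \<rho> * op_norm X) * eucl_norm w" by (simp add: algebra_simps)
    also have "\<dots> \<le> (op_norm R + \<rho> * op_norm X) * (1 / (\<rho> + \<gamma>) * eucl_norm v)"
      using \<open>eucl_norm w \<le> _\<close> \<rho> by (intro mult_left_mono) auto
    finally show ?thesis by simp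
  qed
  \<comment> \<open>\<open>X\<close> also occurs on the right, with the factor
    \<open>\<rho> / (\<rho> + \<gamma>) < 1\<close>; absorbing it leaves \<open>\<gamma>\<close>,
    and the shift disappears from the bound.\<close>
  have "op_norm X \<le> (op_norm R + \<rho> * op_norm X) / (\<rho> + \<gamma>)"
    using main X \<rho> \<open>\<gamma> > 0\<close> by (intro op_norm_le) auto
  then show ?thesis using \<rho> \<open>\<gamma> > 0\<close> by (simp add: R_def field_simps)
qed

text \<open>In the eigenbasis \<open>Q\<close> the perturbation \<open>A - E\<close> acts on an eigenvector of \<open>E\<close> as \<open>D - \<mu>\<close>;
  the complex eigenvector is handled through its real and imaginary part.\<close>

lemma bauer_fike:
  assumes A: "A \<in> carrier_mat n n" and Q: "Q \<in> carrier_mat n n" "Q' \<in> carrier_mat n n"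
    and inv: "Q * Q' = 1\<^sub>m n" and D: "D \<in> carrier_mat n n" "diagonal_mat D" and AQ: "A * Q = Q * D"
    and E: "E \<in> carrier_mat n n" and ev: "\<mu> \<in> complex_spectrum E"
  shows "spectral_dist \<mu> (complex_spectrum A) \<le> op_norm Q * op_norm Q' * op_norm (A - E)"
proof -
  have inv': "Q' * Q = 1\<^sub>m n" using mat_mult_left_right_inverse[OF Q inv] .
  define s t where "s = Re \<mu>" and "t = Im \<mu>"
  obtain v w where vw: "v \<in> carrier_vec n" "w \<in> carrier_vec n" "v \<noteq> 0\<^sub>v n \<or> w \<noteq> 0\<^sub>v n"
    and Ev: "E *\<^sub>v v = s \<cdot>\<^sub>v v - t \<cdot>\<^sub>v w" and Ew: "E *\<^sub>v w = t \<cdot>\<^sub>v v + s \<cdot>\<^sub>v w"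
    using complex_eigenvector_parts[OF E, of \<mu>] ev unfolding complex_spectrum_def spectrum_def s_def t_def
    by blast
  define x y where "x = Q' *\<^sub>v v" and "y = Q' *\<^sub>v w"
  have xy: "x \<in> carrier_vec n" "y \<in> carrier_vec n" using Q vw by (auto simp: x_def y_def)
  have QQ: "Q *\<^sub>v (Q' *\<^sub>v u) = u" "Q' *\<^sub>v (Q *\<^sub>v u) = u" if "u \<in> carrier_vec n" for u
    using Q that inv inv' by (metis assoc_mult_mat_vec one_mult_mat_vec)+
  have Qx: "Q *\<^sub>v x = v" "Q *\<^sub>v y = w" using QQ vw by (simp_all add: x_def y_def)
  define G where "G = Q' * ((A - E) * Q)"
  have G: "G \<in> carrier_mat n n" using Q A E by (auto simp: G_def)
  have Gu: "G *\<^sub>v u = D *\<^sub>v u - Q' *\<^sub>v (E *\<^sub>v (Q *\<^sub>v u))" if u: "u \<in> carrier_vec n" for u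
  proof -
    have "A *\<^sub>v (Q *\<^sub>v u) = Q *\<^sub>v (D *\<^sub>v u)"
      using AQ A Q D u by (metis assoc_mult_mat_vec)
    moreover have "Q' *\<^sub>v (Q *\<^sub>v (D *\<^sub>v u)) = D *\<^sub>v u"
      using QQ(2) D u by simp
    ultimately show ?thesis unfolding G_def
      using Q A E D u by (simp add: mat_vec_assoc minus_mat_vec mat_vec_minus)
  qed
  have Dent: "(D *\<^sub>v u) $ i = D $$ (i, i) * u $ i" if "i < n" "u \<in> carrier_vec n" for i u
    using diagonal_mat_vec_index[OF D] that by blast
  have "Q' *\<^sub>v (E *\<^sub>v (Q *\<^sub>v x)) = s \<cdot>\<^sub>v x - t \<cdot>\<^sub>v y"
    unfolding Qx Ev unfolding x_def y_def using Q vw by (simp add: mat_vec_minus mat_vec_smult)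
  then have Gx: "(G *\<^sub>v x) $ i = (D $$ (i, i) - s) * x $ i + t * y $ i" if "i < n" for i
    using Gu[OF xy(1)] Dent[OF that xy(1)] xy D that by (simp add: algebra_simps)
  have "Q' *\<^sub>v (E *\<^sub>v (Q *\<^sub>v y)) = t \<cdot>\<^sub>v x + s \<cdot>\<^sub>v y"
    unfolding Qx Ew unfolding x_def y_def using Q vw by (simp add: mat_vec_add mat_vec_smult)
  then have Gy: "(G *\<^sub>v y) $ i = (D $$ (i, i) - s) * y $ i - t * x $ i" if "i < n" for i
    using Gu[OF xy(2)] Dent[OF that xy(2)] xy D that by (simp add: algebra_simps)
  define \<delta> where "\<delta> = spectral_dist \<mu> (complex_spectrum A)"
  have fin: "finite (complex_spectrum A)"
    unfolding complex_spectrum_def by (rule card_finite_spectrum[of _ n]) (use A in auto)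
  \<comment> \<open>The columns of \<open>Q\<close> are eigenvectors of \<open>A\<close>, nonzero
    since \<open>Q'\<close> inverts \<open>Q\<close>; so each diagonal entry of \<open>D\<close>
    competes in the minimum that defines \<open>\<delta>\<close>.\<close>
  have \<delta>: "\<delta> \<le> cmod (\<mu> - complex_of_real (D $$ (i, i)))" if i: "i < n" for i
  proof -
    let ?u = "col Q i"
    have u: "?u \<in> carrier_vec n" using Q i by auto
    have "A *\<^sub>v ?u = D $$ (i, i) \<cdot>\<^sub>v ?u"
    proof (rule eq_vecI)
      fix j assume "j < dim_vec (D $$ (i, i) \<cdot>\<^sub>v ?u)"
      then have j: "j < n" using Q by simp
      have "(A *\<^sub>v ?u) $ j = (A * Q) $$ (j, i)" using A Q i j by simp
      also have "\<dots> = Q $$ (j, i) * D $$ (i, i)"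
        unfolding AQ by (rule mult_diagonal_mat_index[OF D Q(1) j i])
      finally show "(A *\<^sub>v ?u) $ j = (D $$ (i, i) \<cdot>\<^sub>v ?u) $ j" using i j Q by simp
    qed (use A Q in auto)
    moreover have "?u \<noteq> 0\<^sub>v n"
    proof
      assume "?u = 0\<^sub>v n"
      moreover have "(Q' * Q) $$ (i, i) = row Q' i \<bullet> ?u" using Q i by simp
      ultimately show False using inv' i Q by simp
    qed
    ultimately have "eigenvector A ?u (D $$ (i, i))" using A u by (simp add: eigenvector_def)
    then have "eigenvector (map_mat complex_of_real A) (map_vec complex_of_real ?u) (complex_of_real (D $$ (i, i)))"
      using of_real_hom.eigenvector_hom[OF A] by blast
    then have "complex_of_real (D $$ (i, i)) \<in> complex_spectrum A"
      by (auto simp: complex_spectrum_def spectrum_def eigenvalue_def)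
    then show ?thesis unfolding \<delta>_def spectral_dist_def using fin by (intro Min_le) auto
  qed
  \<comment> \<open>\<open>\<delta> * \<bar>\<delta>\<bar>\<close> in place of a square allows the
    lower bounds to be squared before \<open>\<delta>\<close> is known to be nonnegative: for
    negative \<open>\<delta>\<close> it is at most 0.\<close>
  have "\<delta> * \<bar>\<delta>\<bar> * ((eucl_norm x)\<^sup>2 + (eucl_norm y)\<^sup>2) \<le> (eucl_norm (G *\<^sub>v x))\<^sup>2 + (eucl_norm (G *\<^sub>v y))\<^sup>2"
  proof -
    have "\<delta> * \<bar>\<delta>\<bar> * ((x $ i)\<^sup>2 + (y $ i)\<^sup>2) \<le> ((G *\<^sub>v x) $ i)\<^sup>2 + ((G *\<^sub>v y) $ i)\<^sup>2" if "i < n" for i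
    proof -
      have "\<delta> * \<bar>\<delta>\<bar> \<le> (cmod (\<mu> - complex_of_real (D $$ (i, i))))\<^sup>2"
      proof (cases "\<delta> \<ge> 0")
        case True
        then show ?thesis using power_mono[OF \<delta>[OF that] True, of 2] by (simp add: power2_eq_square)
      next
        case False
        then have "\<delta> * \<bar>\<delta>\<bar> \<le> 0" by (simp add: mult_le_0_iff)
        then show ?thesis using zero_le_power2 order_trans by blast
      qed
      also have "\<dots> = (D $$ (i, i) - s)\<^sup>2 + t\<^sup>2"
        by (simp add: cmod_power2 s_def t_def power2_commute)
      finally have "\<delta> * \<bar>\<delta>\<bar> * ((x $ i)\<^sup>2 + (y $ i)\<^sup>2) \<le> ((D $$ (i, i) - s)\<^sup>2 + t\<^sup>2) * ((x $ i)\<^sup>2 + (y $ i)\<^sup>2)"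
        by (intro mult_right_mono) auto
      \<comment> \<open>The mixed terms with factor \<open>t\<close> cancel between the two squares,
        as for the modulus of a product of complex numbers.\<close>
      also have "\<dots> = ((G *\<^sub>v x) $ i)\<^sup>2 + ((G *\<^sub>v y) $ i)\<^sup>2"
        unfolding Gx[OF that] Gy[OF that] by (simp add: power2_eq_square algebra_simps)
      finally show ?thesis .
    qed
    then have "(\<Sum>i<n. \<delta> * \<bar>\<delta>\<bar> * ((x $ i)\<^sup>2 + (y $ i)\<^sup>2)) \<le> (\<Sum>i<n. ((G *\<^sub>v x) $ i)\<^sup>2 + ((G *\<^sub>v y) $ i)\<^sup>2)"
      by (intro sum_mono) auto
    then show ?thesis using xy G
      by (simp add: eucl_norm_power2 sum.distrib sum_distrib_left[symmetric])
  qed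
  also have "\<dots> \<le> (op_norm G * eucl_norm x)\<^sup>2 + (op_norm G * eucl_norm y)\<^sup>2"
    using xy G by (intro add_mono power_mono op_norm_bound) auto
  also have "\<dots> = (op_norm G)\<^sup>2 * ((eucl_norm x)\<^sup>2 + (eucl_norm y)\<^sup>2)"
    by (simp add: power_mult_distrib algebra_simps)
  finally have le: "\<delta> * \<bar>\<delta>\<bar> * ((eucl_norm x)\<^sup>2 + (eucl_norm y)\<^sup>2) \<le> (op_norm G)\<^sup>2 * ((eucl_norm x)\<^sup>2 + (eucl_norm y)\<^sup>2)" .
  have "x \<noteq> 0\<^sub>v n \<or> y \<noteq> 0\<^sub>v n"
  proof (rule ccontr)
    assume "\<not> ?thesis"
    then have "v = Q *\<^sub>v 0\<^sub>v n" "w = Q *\<^sub>v 0\<^sub>v n" using Qx by auto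
    moreover have "Q *\<^sub>v 0\<^sub>v n = 0\<^sub>v n" using Q by (intro eq_vecI) auto
    ultimately show False using vw by simp
  qed
  then have "eucl_norm x \<noteq> 0 \<or> eucl_norm y \<noteq> 0" using xy by (simp add: eucl_norm_eq_0)
  then have "(eucl_norm x)\<^sup>2 + (eucl_norm y)\<^sup>2 > 0" by (simp add: sum_power2_gt_zero_iff)
  then have "\<delta> * \<bar>\<delta>\<bar> \<le> (op_norm G)\<^sup>2" using le by simp
  then have "\<delta> \<le> op_norm G"
    using power2_le_imp_le[of \<delta> "op_norm G"] op_norm_nonneg[of G]
    by (cases "\<delta> \<ge> 0") (simp add: power2_eq_square, linarith)
  also have "\<dots> \<le> op_norm Q' * (op_norm (A - E) * op_norm Q)"
    unfolding G_def using Q A E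
    by (intro order_trans[OF op_norm_mult] mult_left_mono op_norm_mult) auto
  finally show ?thesis by (simp add: \<delta>_def mult_ac)
qed

subsection \<open>Block triangularization of the differentiation matrix\<close>

text \<open>Horizontal concatenation is encoded, as in \<open>block_V\<close>, by a four-block
  matrix whose lower blocks have no rows.\<close>

lemma hcat_mult_vec:
  assumes "A \<in> carrier_mat n m" "B \<in> carrier_mat n k" "a \<in> carrier_vec m" "b \<in> carrier_vec k"
  shows "four_block_mat A B (0\<^sub>m 0 m) (0\<^sub>m 0 k) *\<^sub>v (a @\<^sub>v b) = A *\<^sub>v a + B *\<^sub>v b"
proof -
  have "four_block_mat A B (0\<^sub>m 0 m) (0\<^sub>m 0 k) *\<^sub>v (a @\<^sub>v b)
      = (A *\<^sub>v a + B *\<^sub>v b) @\<^sub>v (0\<^sub>m 0 m *\<^sub>v a + 0\<^sub>m 0 k *\<^sub>v b)"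
    by (rule four_block_mat_mult_vec) (use assms in auto)
  also have "\<dots> = A *\<^sub>v a + B *\<^sub>v b"
    using assms by (intro eq_vecI) (auto simp: append_vec_def Let_def)
  finally show ?thesis .
qed

lemma eq_0_if_scalar_prods_0:
  fixes v :: "real Matrix.vec"
  assumes "v \<in> carrier_vec n" "\<And>w. w \<in> carrier_vec n \<Longrightarrow> scalar_prod v w = 0"
  shows "v = 0\<^sub>v n"
  using assms(2)[OF assms(1)] assms(1) eucl_norm_eq_0[of v] by (simp add: eucl_norm_def)

lemma vec_minus_eq_0:
  fixes v w :: "real Matrix.vec"
  assumes "v \<in> carrier_vec n" "w \<in> carrier_vec n" "v - w = 0\<^sub>v n"
  shows "v = w"
proof (rule eq_vecI)
  fix i assume "i < dim_vec w"
  then have "v $ i - w $ i = 0"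
    using arg_cong[OF assms(3), of "\<lambda>u. u $ i"] assms(1,2) by simp
  then show "v $ i = w $ i" by simp
qed (use assms in auto)

text \<open>\<open>P\<^sup>T * P\<close> has the same kernel as \<open>P\<close>, since pairing
  \<open>P\<^sup>T P b\<close> with \<open>b\<close> gives the squared norm of
  \<open>P b\<close>.\<close>

lemma gram_inv:
  fixes P :: "real mat"
  assumes P: "P \<in> carrier_mat N M"
    and inj: "\<And>b. b \<in> carrier_vec M \<Longrightarrow> P *\<^sub>v b = 0\<^sub>v N \<Longrightarrow> b = 0\<^sub>v M"
  shows "inv_mat (P\<^sup>T * P) \<in> carrier_mat M M"
    "P\<^sup>T * P * inv_mat (P\<^sup>T * P) = 1\<^sub>m M"
    "inv_mat (P\<^sup>T * P) * (P\<^sup>T * P) = 1\<^sub>m M"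
proof -
  have PP: "P\<^sup>T * P \<in> carrier_mat M M" using P by simp
  have "b = 0\<^sub>v M" if b: "b \<in> carrier_vec M" "(P\<^sup>T * P) *\<^sub>v b = 0\<^sub>v M" for b
  proof -
    have "scalar_prod (P *\<^sub>v b) (P *\<^sub>v b) = scalar_prod (P\<^sup>T *\<^sub>v (P *\<^sub>v b)) b"
      using P b by (intro scalar_prod_mat_vec) auto
    also have "P\<^sup>T *\<^sub>v (P *\<^sub>v b) = 0\<^sub>v M" using P b by (simp add: mat_vec_assoc)
    finally have "eucl_norm (P *\<^sub>v b) = 0" using b by (simp add: eucl_norm_def)
    then have "P *\<^sub>v b = 0\<^sub>v N" using P by (simp add: eucl_norm_eq_0)
    then show ?thesis using inj b by blast
  qed
  then show "inv_mat (P\<^sup>T * P) \<in> carrier_mat M M"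
    "P\<^sup>T * P * inv_mat (P\<^sup>T * P) = 1\<^sub>m M"
    "inv_mat (P\<^sup>T * P) * (P\<^sup>T * P) = 1\<^sub>m M"
    using inv_mat[OF PP] by blast+
qed

lemma append_0_vec: "0\<^sub>v n @\<^sub>v 0\<^sub>v m = (0\<^sub>v (n + m) :: 'a::zero Matrix.vec)"
  by (intro eq_vecI) (auto simp: append_vec_def)

text \<open>The analysis enters the matrix argument only through these assumptions.
  \<open>P\<^sup>T \<alpha> = 0\<close> are the moment conditions; \<open>\<kappa>\<close> stands
  for the infimum of the eigenvalues of degree at least \<open>m\<close>, and
  \<open>\<kappa> - \<gamma>\<close> for the maximum of those below.\<close>

locale diff_system =
  fixes N M :: nat and F K P L :: "real mat" and \<kappa> \<gamma> :: real
  assumes F: "F \<in> carrier_mat N N" and K: "K \<in> carrier_mat N N"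
    and P: "P \<in> carrier_mat N M" and L: "L \<in> carrier_mat M M" "diagonal_mat L"
    and F_sym: "F\<^sup>T = F" and K_sym: "K\<^sup>T = K"
    and P_inj: "\<And>b. b \<in> carrier_vec M \<Longrightarrow> P *\<^sub>v b = 0\<^sub>v N \<Longrightarrow> b = 0\<^sub>v M"
    and F_pos: "\<And>\<alpha>. \<alpha> \<in> carrier_vec N \<Longrightarrow> P\<^sup>T *\<^sub>v \<alpha> = 0\<^sub>v M \<Longrightarrow> \<alpha> \<noteq> 0\<^sub>v N \<Longrightarrow>
      scalar_prod \<alpha> (F *\<^sub>v \<alpha>) > 0"
    and K_ge: "\<And>\<alpha>. \<alpha> \<in> carrier_vec N \<Longrightarrow> P\<^sup>T *\<^sub>v \<alpha> = 0\<^sub>v M \<Longrightarrow>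
      scalar_prod \<alpha> (K *\<^sub>v \<alpha>) \<ge> \<kappa> * scalar_prod \<alpha> (F *\<^sub>v \<alpha>)"
    and L_le: "\<And>i. i < M \<Longrightarrow> L $$ (i, i) \<le> \<kappa> - \<gamma>" and gap: "\<gamma> > 0"
begin

text \<open>\<open>F \<alpha> + P b\<close> are the node values of the trial function with
  coefficients \<open>\<alpha>\<close> and \<open>b\<close>; the right-hand side consists of the
  node values of its image under the operator.\<close>

definition is_diff :: "real mat \<Rightarrow> bool" where
  "is_diff A \<longleftrightarrow> A \<in> carrier_mat N N \<and> (\<forall>\<alpha>\<in>carrier_vec N. \<forall>b\<in>carrier_vec M.
     P\<^sup>T *\<^sub>v \<alpha> = 0\<^sub>v M \<longrightarrow> A *\<^sub>v (F *\<^sub>v \<alpha> + P *\<^sub>v b) = K *\<^sub>v \<alpha> + P *\<^sub>v (L *\<^sub>v b))"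

lemma orth:
  assumes "\<alpha> \<in> carrier_vec N" "P\<^sup>T *\<^sub>v \<alpha> = 0\<^sub>v M" "b \<in> carrier_vec M"
  shows "scalar_prod \<alpha> (P *\<^sub>v b) = 0"
  using assms P by (simp add: scalar_prod_mat_vec)

text \<open>Pairing with an annihilating vector removes the low degree part. Applied to an
  eigenvalue equation it leaves a relation between the forms of \<open>F\<close> and
  \<open>K\<close> alone.\<close>

lemma orth_add:
  assumes "\<beta> \<in> carrier_vec N" "P\<^sup>T *\<^sub>v \<beta> = 0\<^sub>v M" "v \<in> carrier_vec N" "b \<in> carrier_vec M"
  shows "scalar_prod \<beta> (v + P *\<^sub>v b) = scalar_prod \<beta> v"
  using assms P orth by (subst scalar_prod_add_distrib[of _ N]) auto

lemma sym_swap: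
  fixes B :: "real mat"
  assumes "B \<in> carrier_mat N N" "B\<^sup>T = B" "v \<in> carrier_vec N" "w \<in> carrier_vec N"
  shows "scalar_prod v (B *\<^sub>v w) = scalar_prod w (B *\<^sub>v v)"
proof -
  have "scalar_prod v (B *\<^sub>v w) = scalar_prod (B\<^sup>T *\<^sub>v v) w"
    using assms scalar_prod_mat_vec[of v B w] by simp
  also have "\<dots> = scalar_prod w (B *\<^sub>v v)"
    using assms comm_scalar_prod[of "B *\<^sub>v v" N w] by simp
  finally show ?thesis .
qed

lemma decomp_unique:
  assumes "\<alpha> \<in> carrier_vec N" "b \<in> carrier_vec M" "P\<^sup>T *\<^sub>v \<alpha> = 0\<^sub>v M"
    and "F *\<^sub>v \<alpha> + P *\<^sub>v b = 0\<^sub>v N"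
  shows "\<alpha> = 0\<^sub>v N" "b = 0\<^sub>v M"
proof -
  have "scalar_prod \<alpha> (F *\<^sub>v \<alpha>) = scalar_prod \<alpha> (F *\<^sub>v \<alpha> + P *\<^sub>v b)"
    using assms F by (subst orth_add) auto
  then have "scalar_prod \<alpha> (F *\<^sub>v \<alpha>) = 0" using assms by simp
  then show 0: "\<alpha> = 0\<^sub>v N" using F_pos assms by (metis less_irrefl)
  have "F *\<^sub>v \<alpha> = 0\<^sub>v N" unfolding 0 using F by (intro eq_vecI) auto
  then have "P *\<^sub>v b = 0\<^sub>v N" using assms P by auto
  then show "b = 0\<^sub>v M" using P_inj assms by blast
qed

lemma P_cancel:
  assumes "y \<in> carrier_vec M" "z \<in> carrier_vec M" "P *\<^sub>v y = P *\<^sub>v z"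
  shows "y = z"
proof -
  have "P *\<^sub>v (y - z) = 0\<^sub>v N" using assms P by (auto simp: mat_vec_minus)
  then show ?thesis using P_inj[of "y - z"] assms vec_minus_eq_0 by auto
qed

text \<open>The matrix of kernel interpolation with moment conditions: the upper rows are the
  interpolation equations, the lower ones the side conditions on \<open>\<alpha>\<close>.\<close>

definition saddle :: "real mat" where
  "saddle = four_block_mat F P (P\<^sup>T) (0\<^sub>m M M)"

lemma saddle: "saddle \<in> carrier_mat (N + M) (N + M)"
  using F P by (auto simp: saddle_def)

lemma saddle_mult:
  assumes "\<alpha> \<in> carrier_vec N" "b \<in> carrier_vec M"
  shows "saddle *\<^sub>v (\<alpha> @\<^sub>v b) = (F *\<^sub>v \<alpha> + P *\<^sub>v b) @\<^sub>v (P\<^sup>T *\<^sub>v \<alpha>)"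
proof -
  have "saddle *\<^sub>v (\<alpha> @\<^sub>v b) = (F *\<^sub>v \<alpha> + P *\<^sub>v b) @\<^sub>v (P\<^sup>T *\<^sub>v \<alpha> + 0\<^sub>m M M *\<^sub>v b)"
    unfolding saddle_def by (rule four_block_mat_mult_vec) (use F P assms in auto)
  also have "P\<^sup>T *\<^sub>v \<alpha> + 0\<^sub>m M M *\<^sub>v b = P\<^sup>T *\<^sub>v \<alpha>"
    using P assms by (intro eq_vecI) auto
  finally show ?thesis .
qed

lemma append_split:
  assumes "u \<in> carrier_vec (n + m)"
  obtains a b where "a \<in> carrier_vec n" "b \<in> carrier_vec m" "u = a @\<^sub>v b"
  using assms that vec_first_last_append by (metis vec_first_carrier vec_last_carrier)

lemma saddle_inv: 
  shows "inv_mat saddle \<in> carrier_mat (N + M) (N + M)" "saddle * inv_mat saddle = 1\<^sub>m (N + M)"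
proof -
  have "u = 0\<^sub>v (N + M)" if u: "u \<in> carrier_vec (N + M)" "saddle *\<^sub>v u = 0\<^sub>v (N + M)" for u
  proof -
    obtain \<alpha> b where ab: "\<alpha> \<in> carrier_vec N" "b \<in> carrier_vec M" "u = \<alpha> @\<^sub>v b"
      using append_split[OF u(1)] .
    have "(F *\<^sub>v \<alpha> + P *\<^sub>v b) @\<^sub>v (P\<^sup>T *\<^sub>v \<alpha>) = 0\<^sub>v N @\<^sub>v 0\<^sub>v M"
      using u saddle_mult[OF ab(1,2)] ab(3) by (simp add: append_0_vec)
    then have "F *\<^sub>v \<alpha> + P *\<^sub>v b = 0\<^sub>v N" "P\<^sup>T *\<^sub>v \<alpha> = 0\<^sub>v M"
      using append_vec_eq[of "F *\<^sub>v \<alpha> + P *\<^sub>v b" N "0\<^sub>v N"] ab F P by auto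
    then show ?thesis using decomp_unique[OF ab(1,2)] ab(3) by (simp add: append_0_vec)
  qed
  then show "inv_mat saddle \<in> carrier_mat (N + M) (N + M)" "saddle * inv_mat saddle = 1\<^sub>m (N + M)"
    using inv_mat[OF saddle] by blast+
qed

lemma decomp_inv:
  assumes "v \<in> carrier_vec N" and ab: "\<alpha> \<in> carrier_vec N" "b \<in> carrier_vec M"
    and eq: "inv_mat saddle *\<^sub>v (v @\<^sub>v 0\<^sub>v M) = \<alpha> @\<^sub>v b"
  shows "P\<^sup>T *\<^sub>v \<alpha> = 0\<^sub>v M" "v = F *\<^sub>v \<alpha> + P *\<^sub>v b"
proof -
  have "v @\<^sub>v 0\<^sub>v M = saddle *\<^sub>v (inv_mat saddle *\<^sub>v (v @\<^sub>v 0\<^sub>v M))"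
    using saddle saddle_inv assms(1)
    by (metis append_carrier_vec assoc_mult_mat_vec one_mult_mat_vec zero_carrier_vec)
  also have "\<dots> = (F *\<^sub>v \<alpha> + P *\<^sub>v b) @\<^sub>v (P\<^sup>T *\<^sub>v \<alpha>)"
    unfolding eq using saddle_mult ab by blast
  finally show "P\<^sup>T *\<^sub>v \<alpha> = 0\<^sub>v M" "v = F *\<^sub>v \<alpha> + P *\<^sub>v b"
    using append_vec_eq[of v N "F *\<^sub>v \<alpha> + P *\<^sub>v b"] assms F P by auto
qed

text \<open>Every vector of node values belongs to a trial function. The saddle matrix is square, so
  uniqueness of the coefficients already gives their existence.\<close>

lemma decomp:
  assumes v: "v \<in> carrier_vec N"
  obtains \<alpha> b where "\<alpha> \<in> carrier_vec N" "b \<in> carrier_vec M" "P\<^sup>T *\<^sub>v \<alpha> = 0\<^sub>v M"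
    "v = F *\<^sub>v \<alpha> + P *\<^sub>v b"
proof -
  have "inv_mat saddle *\<^sub>v (v @\<^sub>v 0\<^sub>v M) \<in> carrier_vec (N + M)"
    using saddle_inv(1) v by auto
  then obtain \<alpha> b where "\<alpha> \<in> carrier_vec N" "b \<in> carrier_vec M"
    "inv_mat saddle *\<^sub>v (v @\<^sub>v 0\<^sub>v M) = \<alpha> @\<^sub>v b" using append_split by blast
  with decomp_inv[OF v] that show ?thesis by blast
qed

lemma is_diff_ex1: "\<exists>!A. is_diff A"
proof (rule ex_ex1I)
  \<comment> \<open>\<open>J\<close> appends \<open>M\<close> zeros to the node values, the inverse
    of \<open>saddle\<close> computes the coefficients, and \<open>E\<close> evaluates the operator
    on them.\<close>
  define E where "E = four_block_mat K (P * L) (0\<^sub>m 0 N) (0\<^sub>m 0 M)"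
  define J where "J = (1\<^sub>m N :: real mat) @\<^sub>r 0\<^sub>m M N"
  have EJ: "E \<in> carrier_mat N (N + M)" "J \<in> carrier_mat (N + M) N"
    using K P L by (auto simp: E_def J_def append_rows_def)
  define A where "A = E * (inv_mat saddle * J)"
  have A: "A \<in> carrier_mat N N" using EJ saddle_inv(1) by (auto simp: A_def)
  have "A *\<^sub>v (F *\<^sub>v \<alpha> + P *\<^sub>v b) = K *\<^sub>v \<alpha> + P *\<^sub>v (L *\<^sub>v b)"
    if ab: "\<alpha> \<in> carrier_vec N" "b \<in> carrier_vec M" "P\<^sup>T *\<^sub>v \<alpha> = 0\<^sub>v M" for \<alpha> b
  proof -
    let ?v = "F *\<^sub>v \<alpha> + P *\<^sub>v b"
    have v: "?v \<in> carrier_vec N" using F P ab by auto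
    have "J *\<^sub>v ?v = ?v @\<^sub>v 0\<^sub>v M"
      unfolding J_def using v by (subst mat_mult_append[of _ N N _ M]) (auto intro!: eq_vecI)
    also have "\<dots> = saddle *\<^sub>v (\<alpha> @\<^sub>v b)" using saddle_mult ab by simp
    finally have "inv_mat saddle *\<^sub>v (J *\<^sub>v ?v) = inv_mat saddle *\<^sub>v (saddle *\<^sub>v (\<alpha> @\<^sub>v b))" by simp
    also have "\<dots> = \<alpha> @\<^sub>v b"
      using mat_mult_left_right_inverse[OF saddle saddle_inv] saddle saddle_inv(1) ab
      by (metis append_carrier_vec assoc_mult_mat_vec one_mult_mat_vec)
    finally have "inv_mat saddle *\<^sub>v (J *\<^sub>v ?v) = \<alpha> @\<^sub>v b" .
    moreover have "A *\<^sub>v ?v = E *\<^sub>v (inv_mat saddle *\<^sub>v (J *\<^sub>v ?v))"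
      unfolding A_def using EJ saddle_inv(1) v by (metis assoc_mult_mat_vec mult_carrier_mat)
    ultimately have "A *\<^sub>v ?v = E *\<^sub>v (\<alpha> @\<^sub>v b)" by simp
    also have "\<dots> = K *\<^sub>v \<alpha> + (P * L) *\<^sub>v b"
      unfolding E_def using K P L ab by (intro hcat_mult_vec) auto
    also have "(P * L) *\<^sub>v b = P *\<^sub>v (L *\<^sub>v b)" using P L ab by auto
    finally show ?thesis .
  qed
  then show "\<exists>A. is_diff A" using A by (auto simp: is_diff_def)
next
  fix A B assume AB: "is_diff A" "is_diff B"
  show "A = B"
  proof (rule mat_eq_by_vec[of _ _ N])
    fix v :: "real Matrix.vec" assume v: "v \<in> carrier_vec N"
    obtain \<alpha> b where "\<alpha> \<in> carrier_vec N" "b \<in> carrier_vec M" "P\<^sup>T *\<^sub>v \<alpha> = 0\<^sub>v M"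
      "v = F *\<^sub>v \<alpha> + P *\<^sub>v b" using decomp[OF v] .
    then show "A *\<^sub>v v = B *\<^sub>v v" using AB by (simp add: is_diff_def)
  qed (use AB in \<open>auto simp: is_diff_def\<close>)
qed

text \<open>A diagonal matrix has no Jordan chain of length two: at an index with
  \<open>L $$ (i, i) = s\<close> the first equation gives \<open>w $ i = 0\<close>, elsewhere the
  second does.\<close>

lemma diag_eigenvec:
  assumes "b \<in> carrier_vec M" "L *\<^sub>v b = s \<cdot>\<^sub>v b + w" "w \<in> carrier_vec M" "L *\<^sub>v w = s \<cdot>\<^sub>v w"
  shows "w = 0\<^sub>v M"
proof (rule eq_vecI)
  fix i assume "i < dim_vec (0\<^sub>v M)"
  then have i: "i < M" by simp
  have "L $$ (i, i) * b $ i = s * b $ i + w $ i" "L $$ (i, i) * w $ i = s * w $ i"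
    using arg_cong[OF assms(2), of "\<lambda>v. v $ i"] arg_cong[OF assms(4), of "\<lambda>v. v $ i"] i assms
      diagonal_mat_vec_index[OF L assms(1) i] diagonal_mat_vec_index[OF L assms(3) i] by auto
  then show "w $ i = 0\<^sub>v M $ i" using i by (cases "L $$ (i, i) = s") auto
qed (use assms in auto)

text \<open>For \<open>v = F \<alpha> + P a\<close> and \<open>w = F \<beta> + P b\<close>, pair the
  first equation with \<open>\<beta>\<close> and the second with \<open>\<alpha>\<close>. Symmetry
  of \<open>F\<close> and \<open>K\<close> cancels everything but \<open>t\<close> times the sum of
  the \<open>F\<close>-forms of \<open>\<alpha>\<close> and \<open>\<beta>\<close>. If that sum
  vanishes, \<open>v\<close> and \<open>w\<close> lie in the range of \<open>P\<close>, where
  \<open>A\<close> acts as the real diagonal matrix \<open>L\<close>.\<close>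

lemma is_diff_real_eigenvalues:
  assumes A: "is_diff A" and vw: "v \<in> carrier_vec N" "w \<in> carrier_vec N" "v \<noteq> 0\<^sub>v N \<or> w \<noteq> 0\<^sub>v N"
    and Av: "A *\<^sub>v v = s \<cdot>\<^sub>v v - t \<cdot>\<^sub>v w" and Aw: "A *\<^sub>v w = t \<cdot>\<^sub>v v + s \<cdot>\<^sub>v w"
  shows "t = 0"
proof (rule ccontr)
  assume "t \<noteq> 0"
  obtain \<alpha> a where a: "\<alpha> \<in> carrier_vec N" "a \<in> carrier_vec M" "P\<^sup>T *\<^sub>v \<alpha> = 0\<^sub>v M"
    "v = F *\<^sub>v \<alpha> + P *\<^sub>v a" using decomp[OF vw(1)] .
  obtain \<beta> b where b: "\<beta> \<in> carrier_vec N" "b \<in> carrier_vec M" "P\<^sup>T *\<^sub>v \<beta> = 0\<^sub>v M"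
    "w = F *\<^sub>v \<beta> + P *\<^sub>v b" using decomp[OF vw(2)] .
  have car [simp]: "F *\<^sub>v \<alpha> \<in> carrier_vec N" "F *\<^sub>v \<beta> \<in> carrier_vec N" "K *\<^sub>v \<alpha> \<in> carrier_vec N"
    "K *\<^sub>v \<beta> \<in> carrier_vec N" "P *\<^sub>v a \<in> carrier_vec N" "P *\<^sub>v b \<in> carrier_vec N"
    "L *\<^sub>v a \<in> carrier_vec M" "L *\<^sub>v b \<in> carrier_vec M" "P *\<^sub>v (L *\<^sub>v a) \<in> carrier_vec N"
    "P *\<^sub>v (L *\<^sub>v b) \<in> carrier_vec N" using F K P L a b by auto
  have e1: "K *\<^sub>v \<alpha> + P *\<^sub>v (L *\<^sub>v a) = s \<cdot>\<^sub>v v - t \<cdot>\<^sub>v w"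
    using A a Av by (auto simp: is_diff_def)
  have e2: "K *\<^sub>v \<beta> + P *\<^sub>v (L *\<^sub>v b) = t \<cdot>\<^sub>v v + s \<cdot>\<^sub>v w"
    using A b Aw by (auto simp: is_diff_def)
  have pv: "scalar_prod \<delta> v = scalar_prod \<delta> (F *\<^sub>v \<alpha>)" "scalar_prod \<delta> w = scalar_prod \<delta> (F *\<^sub>v \<beta>)"
    if "\<delta> \<in> carrier_vec N" "P\<^sup>T *\<^sub>v \<delta> = 0\<^sub>v M" for \<delta>
    using orth_add[OF that] a b by simp_all
  have "scalar_prod \<beta> (K *\<^sub>v \<alpha>) = s * scalar_prod \<beta> v - t * scalar_prod \<beta> w"
    using arg_cong[OF e1, of "scalar_prod \<beta>"] orth[OF b(1,3), of "L *\<^sub>v a"] b(1) vw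
    by (simp add: scalar_prod_minus_distrib[of _ N] scalar_prod_add_distrib[of _ N])
  moreover have "scalar_prod \<alpha> (K *\<^sub>v \<beta>) = t * scalar_prod \<alpha> v + s * scalar_prod \<alpha> w"
    using arg_cong[OF e2, of "scalar_prod \<alpha>"] orth[OF a(1,3), of "L *\<^sub>v b"] a(1) vw
    by (simp add: scalar_prod_add_distrib[of _ N])
  moreover have "scalar_prod \<beta> (K *\<^sub>v \<alpha>) = scalar_prod \<alpha> (K *\<^sub>v \<beta>)" "scalar_prod \<beta> (F *\<^sub>v \<alpha>) = scalar_prod \<alpha> (F *\<^sub>v \<beta>)"
    using sym_swap F K F_sym K_sym a b by blast+
  ultimately have "t * (scalar_prod \<alpha> (F *\<^sub>v \<alpha>) + scalar_prod \<beta> (F *\<^sub>v \<beta>)) = 0"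
    using pv a b by (simp add: algebra_simps)
  then have sum0: "scalar_prod \<alpha> (F *\<^sub>v \<alpha>) + scalar_prod \<beta> (F *\<^sub>v \<beta>) = 0" using \<open>t \<noteq> 0\<close> by simp
  have F0: "F *\<^sub>v 0\<^sub>v N = 0\<^sub>v N" "K *\<^sub>v 0\<^sub>v N = 0\<^sub>v N" using F K by (auto intro!: eq_vecI)
  have "\<alpha> = 0\<^sub>v N"
  proof (rule ccontr)
    assume "\<alpha> \<noteq> 0\<^sub>v N"
    then have "scalar_prod \<alpha> (F *\<^sub>v \<alpha>) > 0" using F_pos a by blast
    moreover have "scalar_prod \<beta> (F *\<^sub>v \<beta>) \<ge> 0"
      using F_pos[OF b(1,3)] F0 by (cases "\<beta> = 0\<^sub>v N") auto
    ultimately show False using sum0 by simp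
  qed
  moreover from this have "\<beta> = 0\<^sub>v N"
    using sum0 F_pos[OF b(1,3)] F0 by fastforce
  ultimately have v: "v = P *\<^sub>v a" and w: "w = P *\<^sub>v b" 
    and K0: "K *\<^sub>v \<alpha> = 0\<^sub>v N" "K *\<^sub>v \<beta> = 0\<^sub>v N"
    using a b F0 by auto
  have "P *\<^sub>v (L *\<^sub>v a) = P *\<^sub>v (s \<cdot>\<^sub>v a - t \<cdot>\<^sub>v b)"
    using e1 P a b unfolding v w K0 by (simp add: mat_vec_minus mat_vec_smult)
  moreover have "P *\<^sub>v (L *\<^sub>v b) = P *\<^sub>v (t \<cdot>\<^sub>v a + s \<cdot>\<^sub>v b)"
    using e2 P a b unfolding v w K0 by (simp add: mat_vec_add mat_vec_smult)
  ultimately have La: "L *\<^sub>v a = s \<cdot>\<^sub>v a - t \<cdot>\<^sub>v b" and Lb: "L *\<^sub>v b = t \<cdot>\<^sub>v a + s \<cdot>\<^sub>v b"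
    using a b by (auto intro: P_cancel)
  have "a $ i = 0 \<and> b $ i = 0" if i: "i < M" for i
  proof -
    have "L $$ (i, i) * a $ i = s * a $ i - t * b $ i" "L $$ (i, i) * b $ i = t * a $ i + s * b $ i"
      using arg_cong[OF La, of "\<lambda>v. v $ i"] arg_cong[OF Lb, of "\<lambda>v. v $ i"] i a b
        diagonal_mat_vec_index[OF L a(2) i] diagonal_mat_vec_index[OF L b(2) i] by auto
    \<comment> \<open>Cross-multiplication of the two equations eliminates
      \<open>L $$ (i, i)\<close>.\<close>
    then have "(s * a $ i - t * b $ i) * b $ i = (t * a $ i + s * b $ i) * a $ i"
      by (metis mult.assoc mult.commute)
    then have "t * ((a $ i)\<^sup>2 + (b $ i)\<^sup>2) = 0" by (simp add: algebra_simps power2_eq_square)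
    then show ?thesis using \<open>t \<noteq> 0\<close> by simp
  qed
  then have "a = 0\<^sub>v M" "b = 0\<^sub>v M" using a b by (auto intro!: eq_vecI)
  moreover have "P *\<^sub>v 0\<^sub>v M = 0\<^sub>v N" using P by (auto intro!: eq_vecI)
  ultimately show False using v w vw(3) by simp
qed

text \<open>Symmetry first forces \<open>\<beta> = 0\<close>, so \<open>w = P b\<close> with
  \<open>L b = s b\<close>. If \<open>b\<close> is nonzero, \<open>s\<close> is an entry of
  \<open>L\<close> and hence below \<open>\<kappa>\<close>; but then the \<open>K\<close>-form of
  \<open>\<alpha>\<close> is \<open>s\<close> times its \<open>F\<close>-form, which
  \<open>K_ge\<close> permits only for \<open>\<alpha> = 0\<close>. What remains is a Jordan chain
  of a diagonal matrix.\<close>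

lemma is_diff_semisimple:
  assumes A: "is_diff A" and vw: "v \<in> carrier_vec N" "w \<in> carrier_vec N"
    and Av: "A *\<^sub>v v = s \<cdot>\<^sub>v v + w" and Aw: "A *\<^sub>v w = s \<cdot>\<^sub>v w"
  shows "w = 0\<^sub>v N"
proof -
  obtain \<alpha> a where a: "\<alpha> \<in> carrier_vec N" "a \<in> carrier_vec M" "P\<^sup>T *\<^sub>v \<alpha> = 0\<^sub>v M"
    "v = F *\<^sub>v \<alpha> + P *\<^sub>v a" using decomp[OF vw(1)] .
  obtain \<beta> b where b: "\<beta> \<in> carrier_vec N" "b \<in> carrier_vec M" "P\<^sup>T *\<^sub>v \<beta> = 0\<^sub>v M"
    "w = F *\<^sub>v \<beta> + P *\<^sub>v b" using decomp[OF vw(2)] .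
  have car [simp]: "F *\<^sub>v \<alpha> \<in> carrier_vec N" "F *\<^sub>v \<beta> \<in> carrier_vec N" "K *\<^sub>v \<alpha> \<in> carrier_vec N"
    "K *\<^sub>v \<beta> \<in> carrier_vec N" "P *\<^sub>v a \<in> carrier_vec N" "P *\<^sub>v b \<in> carrier_vec N"
    "L *\<^sub>v a \<in> carrier_vec M" "L *\<^sub>v b \<in> carrier_vec M" "P *\<^sub>v (L *\<^sub>v a) \<in> carrier_vec N"
    "P *\<^sub>v (L *\<^sub>v b) \<in> carrier_vec N" using F K P L a b by auto
  have e1: "K *\<^sub>v \<alpha> + P *\<^sub>v (L *\<^sub>v a) = s \<cdot>\<^sub>v v + w"
    using A a Av by (auto simp: is_diff_def)
  have e2: "K *\<^sub>v \<beta> + P *\<^sub>v (L *\<^sub>v b) = s \<cdot>\<^sub>v w"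
    using A b Aw by (auto simp: is_diff_def)
  have pv: "scalar_prod \<delta> v = scalar_prod \<delta> (F *\<^sub>v \<alpha>)" "scalar_prod \<delta> w = scalar_prod \<delta> (F *\<^sub>v \<beta>)"
    if "\<delta> \<in> carrier_vec N" "P\<^sup>T *\<^sub>v \<delta> = 0\<^sub>v M" for \<delta>
    using orth_add[OF that] a b by simp_all
  have k1: "scalar_prod \<delta> (K *\<^sub>v \<alpha>) = s * scalar_prod \<delta> (F *\<^sub>v \<alpha>) + scalar_prod \<delta> (F *\<^sub>v \<beta>)"
    if d: "\<delta> \<in> carrier_vec N" "P\<^sup>T *\<^sub>v \<delta> = 0\<^sub>v M" for \<delta>
    using arg_cong[OF e1, of "scalar_prod \<delta>"] orth[OF d, of "L *\<^sub>v a"] d vw pv[OF d]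
    by (simp add: scalar_prod_add_distrib[of _ N])
  have "scalar_prod \<alpha> (K *\<^sub>v \<beta>) = s * scalar_prod \<alpha> (F *\<^sub>v \<beta>)"
    using arg_cong[OF e2, of "scalar_prod \<alpha>"] orth_add[OF a(1,3)] a(1) vw b pv[OF a(1,3)] by simp
  moreover have sw: "scalar_prod \<beta> (K *\<^sub>v \<alpha>) = scalar_prod \<alpha> (K *\<^sub>v \<beta>)" "scalar_prod \<beta> (F *\<^sub>v \<alpha>) = scalar_prod \<alpha> (F *\<^sub>v \<beta>)"
    using sym_swap F K F_sym K_sym a b by blast+
  ultimately have "scalar_prod \<beta> (F *\<^sub>v \<beta>) = 0" using k1[OF b(1,3)] by simp
  then have \<beta>0: "\<beta> = 0\<^sub>v N" using F_pos[OF b(1,3)] by fastforce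
  have F0: "F *\<^sub>v 0\<^sub>v N = 0\<^sub>v N" "K *\<^sub>v 0\<^sub>v N = 0\<^sub>v N" using F K by (auto intro!: eq_vecI)
  have P0: "P *\<^sub>v 0\<^sub>v M = 0\<^sub>v N" using P by (auto intro!: eq_vecI)
  have w: "w = P *\<^sub>v b" using b F0 unfolding \<beta>0 by simp
  have "P *\<^sub>v (L *\<^sub>v b) = P *\<^sub>v (s \<cdot>\<^sub>v b)"
    using e2 P b F0 unfolding w \<beta>0 by (simp add: mat_vec_smult)
  then have Lb: "L *\<^sub>v b = s \<cdot>\<^sub>v b" using P_cancel[of "L *\<^sub>v b" "s \<cdot>\<^sub>v b"] b by simp
  show ?thesis
  proof (cases "b = 0\<^sub>v M")
    case True
    then show ?thesis using w P0 by simp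
  next
    case False
    then obtain i where i: "i < M" "b $ i \<noteq> 0" using b by (metis eq_vecI carrier_vecD index_zero_vec)
    have "L $$ (i, i) = s"
      using arg_cong[OF Lb, of "\<lambda>v. v $ i"] diagonal_mat_vec_index[OF L b(2) i(1)] i b by simp
    then have "s < \<kappa>" using L_le[OF i(1)] gap by simp
    have "scalar_prod \<alpha> (K *\<^sub>v \<alpha>) = s * scalar_prod \<alpha> (F *\<^sub>v \<alpha>)"
      using k1[OF a(1,3)] F0 a by (simp add: \<beta>0)
    then have "\<kappa> * scalar_prod \<alpha> (F *\<^sub>v \<alpha>) \<le> s * scalar_prod \<alpha> (F *\<^sub>v \<alpha>)"
      using K_ge[OF a(1,3)] by simp
    then have "\<not> scalar_prod \<alpha> (F *\<^sub>v \<alpha>) > 0"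
      using mult_strict_right_mono[OF \<open>s < \<kappa>\<close>] by (meson not_le)
    then have \<alpha>0: "\<alpha> = 0\<^sub>v N" using F_pos[OF a(1,3)] by blast
    have v: "v = P *\<^sub>v a" using a F0 unfolding \<alpha>0 by simp
    have "P *\<^sub>v (L *\<^sub>v a) = P *\<^sub>v (s \<cdot>\<^sub>v a + b)"
      using e1 P a b F0 unfolding w v \<alpha>0 by (simp add: mat_vec_smult mat_vec_add)
    then have "L *\<^sub>v a = s \<cdot>\<^sub>v a + b" using P_cancel[of "L *\<^sub>v a" "s \<cdot>\<^sub>v a + b"] a b by simp
    then have "b = 0\<^sub>v M" using diag_eigenvec[OF a(2)] Lb b by blast
    then show ?thesis using False by simp
  qed
qed

lemma is_diff_diagonalizable:
  assumes A: "is_diff A"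
  shows "diagonalizable A"
proof (rule diagonalizable_real_criterion)
  show "A \<in> carrier_mat N N" using A by (simp add: is_diff_def)
qed (use is_diff_real_eigenvalues[OF A] is_diff_semisimple[OF A] in blast)+

section \<open>Least squares with respect to the range of \<open>P\<close>\<close>

lemma M_le_N: "M \<le> N"
proof (rule ccontr)
  assume "\<not> ?thesis"
  then obtain v where "v \<in> carrier_vec M" "v \<noteq> 0\<^sub>v M" "P *\<^sub>v v = 0\<^sub>v N"
    using underdetermined_solution[OF P] by (metis not_le)
  then show False using P_inj by blast
qed

lemma normal_inv:
  shows "inv_mat (P\<^sup>T * P) \<in> carrier_mat M M"
    "P\<^sup>T * P * inv_mat (P\<^sup>T * P) = 1\<^sub>m M"
  by (rule gram_inv[OF P], erule (1) P_inj)+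

lemma pseudo_inv_carrier: "pseudo_inv P \<in> carrier_mat M N"
  using normal_inv(1) P by (auto simp: pseudo_inv_def)

text \<open>The normal equations: the residual of \<open>P (pseudo_inv P v)\<close> is orthogonal to
  the range of \<open>P\<close>.\<close>

lemma transpose_pseudo_inv:
  assumes v: "v \<in> carrier_vec N"
  shows "P\<^sup>T *\<^sub>v (P *\<^sub>v (pseudo_inv P *\<^sub>v v)) = P\<^sup>T *\<^sub>v v"
proof -
  let ?G = "P\<^sup>T * P"
  have "pseudo_inv P *\<^sub>v v = inv_mat ?G *\<^sub>v (P\<^sup>T *\<^sub>v v)"
    unfolding pseudo_inv_def using normal_inv(1) P v by (intro mat_vec_assoc) auto
  moreover have "P\<^sup>T *\<^sub>v (P *\<^sub>v u) = ?G *\<^sub>v u" if "u \<in> carrier_vec M" for u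
    using P that by (simp add: mat_vec_assoc)
  moreover have "?G *\<^sub>v (inv_mat ?G *\<^sub>v u) = u" if "u \<in> carrier_vec M" for u
    using normal_inv P that by (metis assoc_mult_mat_vec one_mult_mat_vec mult_carrier_mat transpose_carrier_mat)
  ultimately show ?thesis using normal_inv(1) P v by simp
qed

end

section \<open>Block triangular form in the basis \<open>V\<close> and the spectral bound\<close>

locale block_decomposition = diff_system +
  fixes W S U \<Theta> A :: "real mat"
  assumes bc: "block_choice N M P F K W S U \<Theta>" and A: "is_diff A"
begin

abbreviation "k \<equiv> N - M"
abbreviation "G \<equiv> W\<^sup>T * F * W"
abbreviation "Z \<equiv> block_Z W S U"
abbreviation "V \<equiv> block_V P Z"
abbreviation "R \<equiv> block_R P L F K W Z"

lemma carriers: "W \<in> carrier_mat N k" "S \<in> carrier_mat k k" "U \<in> carrier_mat k k" "\<Theta> \<in> carrier_mat k k"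
  "A \<in> carrier_mat N N" "G \<in> carrier_mat k k"
  using bc A F by (auto simp: block_choice_def is_diff_def)

lemma choice: "W\<^sup>T * W = 1\<^sub>m k" "mat_range W = orth_compl N (mat_range P)"
  "sym_pos_def_mat S" "S * S = inv_mat G" "U\<^sup>T * U = 1\<^sub>m k" "diagonal_mat \<Theta>"
  "S * W\<^sup>T * K * W * S = U * \<Theta> * U\<^sup>T"
  using bc by (auto simp: block_choice_def)

lemma W_inv: "y \<in> carrier_vec k \<Longrightarrow> W\<^sup>T *\<^sub>v (W *\<^sub>v y) = y"
  using choice(1) carriers(1) by (metis assoc_mult_mat_vec one_mult_mat_vec transpose_carrier_mat)

lemma W_orth: 
  assumes y: "y \<in> carrier_vec k"
  shows "P\<^sup>T *\<^sub>v (W *\<^sub>v y) = 0\<^sub>v M"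
proof (rule eq_0_if_scalar_prods_0)
  have "W *\<^sub>v y \<in> orth_compl N (mat_range P)"
    using choice(2) y carriers(1) by (auto simp: mat_range_def)
  then have o: "scalar_prod (W *\<^sub>v y) (P *\<^sub>v b) = 0" if "b \<in> carrier_vec M" for b
    using that P by (auto simp: orth_compl_def mat_range_def)
  fix b :: "real Matrix.vec" assume b: "b \<in> carrier_vec M"
  show "scalar_prod (P\<^sup>T *\<^sub>v (W *\<^sub>v y)) b = 0"
    using o[OF b] scalar_prod_mat_vec[of "W *\<^sub>v y" P b] P b carriers(1) y by simp
qed (use P carriers y in auto)

lemma WT_P: "b \<in> carrier_vec M \<Longrightarrow> W\<^sup>T *\<^sub>v (P *\<^sub>v b) = 0\<^sub>v k"
proof (rule eq_0_if_scalar_prods_0)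
  fix y :: "real Matrix.vec" assume b: "b \<in> carrier_vec M" and y: "y \<in> carrier_vec k"
  have "scalar_prod (W\<^sup>T *\<^sub>v (P *\<^sub>v b)) y = scalar_prod (P *\<^sub>v b) (W *\<^sub>v y)"
    using P carriers(1) b y scalar_prod_mat_vec[of "P *\<^sub>v b" W y] by simp
  also have "\<dots> = scalar_prod (W *\<^sub>v y) (P *\<^sub>v b)"
    using P carriers(1) b y comm_scalar_prod[of "P *\<^sub>v b" N "W *\<^sub>v y"] by simp
  also have "\<dots> = 0" using P b y carriers(1) W_orth by (intro orth) auto
  finally show "scalar_prod (W\<^sup>T *\<^sub>v (P *\<^sub>v b)) y = 0" .
qed (use P carriers in auto)

text \<open>The two terms are the orthogonal projections to the range of \<open>P\<close> and to its
  complement. The residual of the first lies in the range of \<open>W\<close>, and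
  \<open>W\<^sup>T * W = 1\<close> identifies its coordinates.\<close>

lemma projection:
  assumes v: "v \<in> carrier_vec N"
  shows "v = P *\<^sub>v (pseudo_inv P *\<^sub>v v) + W *\<^sub>v (W\<^sup>T *\<^sub>v v)"
proof -
  define q where "q = pseudo_inv P *\<^sub>v v"
  define r where "r = v - P *\<^sub>v q"
  have q: "q \<in> carrier_vec M" using pseudo_inv_carrier v by (simp add: q_def)
  have r: "r \<in> carrier_vec N" using v P q by (simp add: r_def)
  have "P\<^sup>T *\<^sub>v r = P\<^sup>T *\<^sub>v v - P\<^sup>T *\<^sub>v (P *\<^sub>v q)"
    unfolding r_def using v P q by (intro mat_vec_minus) auto
  also have "\<dots> = 0\<^sub>v M" unfolding q_def transpose_pseudo_inv[OF v] using P v by auto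
  finally have r0: "P\<^sup>T *\<^sub>v r = 0\<^sub>v M" .
  then have "r \<in> orth_compl N (mat_range P)"
    using r orth[OF r r0] P by (auto simp: orth_compl_def mat_range_def)
  then have "r \<in> mat_range W" using choice(2) by simp
  then obtain y where y: "y \<in> carrier_vec k" "r = W *\<^sub>v y"
    using carriers(1) by (auto simp: mat_range_def)
  have "y = W\<^sup>T *\<^sub>v r" using W_inv y by simp
  also have "\<dots> = W\<^sup>T *\<^sub>v v - W\<^sup>T *\<^sub>v (P *\<^sub>v q)"
    unfolding r_def using v P q carriers(1) by (intro mat_vec_minus) auto
  also have "\<dots> = W\<^sup>T *\<^sub>v v" unfolding WT_P[OF q] using carriers(1) by (intro eq_vecI) simp_all
  finally have r_eq: "r = W *\<^sub>v (W\<^sup>T *\<^sub>v v)" using y by simp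
  have v_eq: "v = P *\<^sub>v q + r"
  proof -
    have vm: "u = w + (u - w)" if "u \<in> carrier_vec N" "w \<in> carrier_vec N" for u w :: "real Matrix.vec"
      using that by (intro eq_vecI) auto
    show ?thesis unfolding r_def by (rule vm[OF v mult_mat_vec_carrier[OF P q]])
  qed
  show ?thesis using v_eq unfolding r_eq q_def .
qed

lemma G_vec: "y \<in> carrier_vec k \<Longrightarrow> G *\<^sub>v y = W\<^sup>T *\<^sub>v (F *\<^sub>v (W *\<^sub>v y))"
  using carriers(1) F by (simp add: mat_vec_assoc)

text \<open>\<open>W y\<close> satisfies the moment conditions, so \<open>F_pos\<close> makes
  \<open>G\<close> definite. Only with this does the equation for \<open>S * S\<close> refer to a
  true inverse.\<close>

lemma G_inv: "inv_mat G \<in> carrier_mat k k" "G * inv_mat G = 1\<^sub>m k"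
proof -
  have "y = 0\<^sub>v k" if y: "y \<in> carrier_vec k" "G *\<^sub>v y = 0\<^sub>v k" for y
  proof (rule ccontr)
    assume "y \<noteq> 0\<^sub>v k"
    moreover have "W\<^sup>T *\<^sub>v 0\<^sub>v N = 0\<^sub>v k" using carriers(1) by (intro eq_vecI) auto
    ultimately have "W *\<^sub>v y \<noteq> 0\<^sub>v N" using W_inv[OF y(1)] by metis
    then have "scalar_prod (W *\<^sub>v y) (F *\<^sub>v (W *\<^sub>v y)) > 0"
      using F_pos W_orth y carriers(1) by simp
    moreover have "scalar_prod (W *\<^sub>v y) (F *\<^sub>v (W *\<^sub>v y)) = scalar_prod (F *\<^sub>v (W *\<^sub>v y)) (W *\<^sub>v y)"
      using carriers(1) F y comm_scalar_prod[of "W *\<^sub>v y" N "F *\<^sub>v (W *\<^sub>v y)"] by simp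
    moreover have "\<dots> = scalar_prod (G *\<^sub>v y) y"
      using carriers(1) F y G_vec[OF y(1)] scalar_prod_mat_vec[of "F *\<^sub>v (W *\<^sub>v y)" W y] by simp
    ultimately show False using y by simp
  qed
  then show "inv_mat G \<in> carrier_mat k k" "G * inv_mat G = 1\<^sub>m k"
    using inv_mat[OF carriers(6)] by blast+
qed

lemma S_inv: "inv_mat S \<in> carrier_mat k k" "S * inv_mat S = 1\<^sub>m k" "inv_mat S * S = 1\<^sub>m k"
proof -
  have "y = 0\<^sub>v k" if "y \<in> carrier_vec k" "S *\<^sub>v y = 0\<^sub>v k" for y
    using choice(3) that carriers(2) unfolding sym_pos_def_mat_def by (metis carrier_matD(2) less_irrefl scalar_prod_right_zero)
  then show "inv_mat S \<in> carrier_mat k k" "S * inv_mat S = 1\<^sub>m k" "inv_mat S * S = 1\<^sub>m k"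
    using inv_mat[OF carriers(2)] by blast+
qed

lemma S_cancel:
  assumes y: "y \<in> carrier_vec k"
  shows "S *\<^sub>v (inv_mat S *\<^sub>v y) = y" "inv_mat S *\<^sub>v (S *\<^sub>v y) = y"
  using assoc_mult_mat_vec[OF carriers(2) S_inv(1) y] assoc_mult_mat_vec[OF S_inv(1) carriers(2) y]
    S_inv(2,3) y by simp_all

lemma U_cancel: "y \<in> carrier_vec k \<Longrightarrow> U\<^sup>T *\<^sub>v (U *\<^sub>v y) = y"
  using choice(5) carriers(3) by (metis assoc_mult_mat_vec one_mult_mat_vec transpose_carrier_mat)

lemma S_sym: "S\<^sup>T = S" using choice(3) by (simp add: sym_pos_def_mat_def)

text \<open>What is known of \<open>S\<close> is \<open>G (S S) = 1\<close>. Regrouped as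
  \<open>(G S) S = 1\<close> it becomes \<open>S (G S) = 1\<close>, since a one-sided inverse of a
  square matrix is two-sided.\<close>

lemma SGS: "y \<in> carrier_vec k \<Longrightarrow> S *\<^sub>v (G *\<^sub>v (S *\<^sub>v y)) = y"
proof -
  assume y: "y \<in> carrier_vec k"
  note C = carriers(2) carriers(6)
  have "G * (S * S) = 1\<^sub>m k" using G_inv(2) choice(4) by simp
  then have "(G * S) * S = 1\<^sub>m k" using assoc_mult_mat[OF C(2,1,1)] by simp
  then have "S * (G * S) = 1\<^sub>m k" by (rule mat_mult_left_right_inverse[rotated 2]) (use C in auto)
  then have "(S * (G * S)) *\<^sub>v y = y" using y by simp
  then show ?thesis
    unfolding assoc_mult_mat_vec[OF C(1) mult_carrier_mat[OF C(2,1)] y] assoc_mult_mat_vec[OF C(2,1) y] .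
qed

lemma Z_vec: "b \<in> carrier_vec k \<Longrightarrow> Z *\<^sub>v b = W *\<^sub>v (inv_mat S *\<^sub>v (U *\<^sub>v b))"
  unfolding block_Z_def using carriers S_inv(1) by (simp add: mat_vec_assoc)

lemma Z_carrier: "Z \<in> carrier_mat N k"
  using carriers S_inv(1) by (auto simp: block_Z_def)

lemma R_carrier: "R \<in> carrier_mat M k"
  using carriers G_inv(1) pseudo_inv_carrier Z_carrier K F L by (auto simp: block_R_def)

lemma V_eq: "V = four_block_mat P Z (0\<^sub>m 0 M) (0\<^sub>m 0 k)"
  using P Z_carrier by (simp add: block_V_def)

lemma V_carrier: "V \<in> carrier_mat N N"
  unfolding V_eq using four_block_carrier_mat[OF P, of "0\<^sub>m 0 k" 0 k] M_le_N by simp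

lemma V_vec: "a \<in> carrier_vec M \<Longrightarrow> b \<in> carrier_vec k \<Longrightarrow> V *\<^sub>v (a @\<^sub>v b) = P *\<^sub>v a + Z *\<^sub>v b"
  unfolding V_eq by (rule hcat_mult_vec) (use P Z_carrier in auto)

text \<open>\<open>W\<^sup>T\<close> annihilates the range of \<open>P\<close> and undoes
  \<open>W\<close>, so it isolates the \<open>Z\<close> part of a vector in the kernel; injectivity
  of \<open>P\<close> does the rest.\<close>

lemma V_inv: "inv_mat V \<in> carrier_mat N N" "V * inv_mat V = 1\<^sub>m N"
proof -
  have "u = 0\<^sub>v N" if u: "u \<in> carrier_vec N" "V *\<^sub>v u = 0\<^sub>v N" for u
  proof -
    have "u \<in> carrier_vec (M + k)" using u M_le_N by simp
    then obtain a b where ab: "a \<in> carrier_vec M" "b \<in> carrier_vec k" "u = a @\<^sub>v b"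
      using append_split by blast
    define y where "y = inv_mat S *\<^sub>v (U *\<^sub>v b)"
    have y: "y \<in> carrier_vec k" using S_inv(1) carriers ab by (simp add: y_def)
    have eq: "P *\<^sub>v a + W *\<^sub>v y = 0\<^sub>v N" using u V_vec[OF ab(1,2)] Z_vec[OF ab(2)] ab(3) by (simp add: y_def)
    have "W\<^sup>T *\<^sub>v (P *\<^sub>v a + W *\<^sub>v y) = W\<^sup>T *\<^sub>v (P *\<^sub>v a) + W\<^sup>T *\<^sub>v (W *\<^sub>v y)"
      using carriers(1) P ab y by (intro mat_vec_add) auto
    also have "\<dots> = y" using WT_P[OF ab(1)] W_inv[OF y] y by simp
    finally have y0: "y = 0\<^sub>v k" unfolding eq using carriers(1) by (auto intro!: eq_vecI)
    have "b = U\<^sup>T *\<^sub>v (S *\<^sub>v y)"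
      unfolding y_def using S_cancel(1) U_cancel carriers ab by simp
      moreover have "S *\<^sub>v 0\<^sub>v k = 0\<^sub>v k" "U\<^sup>T *\<^sub>v 0\<^sub>v k = 0\<^sub>v k"
      using carriers by (auto intro!: eq_vecI)
    ultimately have b0: "b = 0\<^sub>v k" unfolding y0 by simp
    have "W *\<^sub>v y = 0\<^sub>v N" unfolding y0 using carriers by (intro eq_vecI) auto
    then have "P *\<^sub>v a = 0\<^sub>v N" using eq P ab by auto
    then have "a = 0\<^sub>v M" using P_inj ab by blast
    then show ?thesis using b0 ab(3) M_le_N by (simp add: append_0_vec)
  qed
  then show "inv_mat V \<in> carrier_mat N N" "V * inv_mat V = 1\<^sub>m N"
    using inv_mat[OF V_carrier] by blast+
qed

lemma Theta_vec: 
  assumes b: "b \<in> carrier_vec k"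
  shows "S *\<^sub>v (W\<^sup>T *\<^sub>v (K *\<^sub>v (W *\<^sub>v (S *\<^sub>v (U *\<^sub>v b))))) = U *\<^sub>v (\<Theta> *\<^sub>v b)"
proof -
  have Ub: "U *\<^sub>v b \<in> carrier_vec k" using carriers b by simp
  have "S *\<^sub>v (W\<^sup>T *\<^sub>v (K *\<^sub>v (W *\<^sub>v (S *\<^sub>v (U *\<^sub>v b)))))
      = (S * W\<^sup>T * K * W * S) *\<^sub>v (U *\<^sub>v b)"
    using carriers K Ub by (simp add: mat_vec_assoc)
  also have "\<dots> = U *\<^sub>v (\<Theta> *\<^sub>v (U\<^sup>T *\<^sub>v (U *\<^sub>v b)))"
    unfolding choice(7) using carriers Ub by (simp add: mat_vec_assoc)
  finally show ?thesis using U_cancel[OF b] by simp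
qed

text \<open>A Rayleigh quotient: the vector \<open>W S U e\<close> satisfies the moment conditions,
  its \<open>F\<close>-form is 1 and its \<open>K\<close>-form is \<open>\<Theta> $$ (j, j)\<close>,
  so \<open>K_ge\<close> applies.\<close>

lemma Theta_ge:
  assumes j: "j < k"
  shows "\<Theta> $$ (j, j) \<ge> \<kappa>"
proof -
  define e :: "real Matrix.vec" where "e = unit_vec k j"
  define s where "s = S *\<^sub>v (U *\<^sub>v e)"
  define \<alpha> where "\<alpha> = W *\<^sub>v s"
  have e: "e \<in> carrier_vec k" by (simp add: e_def)
  have s: "s \<in> carrier_vec k" using carriers e by (simp add: s_def)
  have \<alpha>: "\<alpha> \<in> carrier_vec N" "P\<^sup>T *\<^sub>v \<alpha> = 0\<^sub>v M"
    using carriers s W_orth by (auto simp: \<alpha>_def)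
  have red: "scalar_prod \<alpha> (B *\<^sub>v \<alpha>) = scalar_prod (U *\<^sub>v e) (S *\<^sub>v (W\<^sup>T *\<^sub>v (B *\<^sub>v (W *\<^sub>v s))))"
    if B: "B \<in> carrier_mat N N" for B
  proof -
    have Ba: "B *\<^sub>v \<alpha> \<in> carrier_vec N" using B \<alpha> by simp
    have "scalar_prod \<alpha> (B *\<^sub>v \<alpha>) = scalar_prod (B *\<^sub>v \<alpha>) (W *\<^sub>v s)"
      using comm_scalar_prod[OF \<alpha>(1) Ba] by (simp add: \<alpha>_def)
    also have "\<dots> = scalar_prod (W\<^sup>T *\<^sub>v (B *\<^sub>v \<alpha>)) s"
      using Ba B carriers s by (intro scalar_prod_mat_vec) auto
    also have "\<dots> = scalar_prod (S\<^sup>T *\<^sub>v (W\<^sup>T *\<^sub>v (B *\<^sub>v \<alpha>))) (U *\<^sub>v e)"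
      unfolding s_def using Ba carriers e by (intro scalar_prod_mat_vec) auto
    also have "\<dots> = scalar_prod (U *\<^sub>v e) (S *\<^sub>v (W\<^sup>T *\<^sub>v (B *\<^sub>v \<alpha>)))"
      unfolding S_sym using Ba carriers e by (intro comm_scalar_prod[of _ k]) auto
    finally show ?thesis by (simp add: \<alpha>_def)
  qed
  have UU: "scalar_prod (U *\<^sub>v e) (U *\<^sub>v y) = scalar_prod e y" if y: "y \<in> carrier_vec k" for y
  proof -
    have "scalar_prod (U *\<^sub>v e) (U *\<^sub>v y) = scalar_prod (U\<^sup>T *\<^sub>v (U *\<^sub>v e)) y"
      using carriers e y by (intro scalar_prod_mat_vec) auto
    then show ?thesis using U_cancel[OF e] by simp
  qed
  have "scalar_prod \<alpha> (F *\<^sub>v \<alpha>) = scalar_prod (U *\<^sub>v e) (S *\<^sub>v (G *\<^sub>v s))"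
    unfolding red[OF F] G_vec[OF s] ..
  also have "\<dots> = scalar_prod (U *\<^sub>v e) (U *\<^sub>v e)"
    unfolding s_def using SGS carriers e by simp
  also have "\<dots> = 1" unfolding UU[OF e] using j by (simp add: e_def)
  finally have F1: "scalar_prod \<alpha> (F *\<^sub>v \<alpha>) = 1" .
  have "scalar_prod \<alpha> (K *\<^sub>v \<alpha>) = scalar_prod (U *\<^sub>v e) (U *\<^sub>v (\<Theta> *\<^sub>v e))"
    unfolding red[OF K] unfolding s_def Theta_vec[OF e] ..
  also have "\<dots> = scalar_prod e (\<Theta> *\<^sub>v e)" using carriers e by (intro UU) auto
  also have "\<dots> = (\<Theta> *\<^sub>v e) $ j" unfolding e_def using carriers j by (intro scalar_prod_left_unit) auto
  also have "\<dots> = \<Theta> $$ (j, j)"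
    unfolding diagonal_mat_vec_index[OF carriers(4) choice(6) e j] using j by (simp add: e_def)
  finally show ?thesis using K_ge[OF \<alpha>] F1 by simp
qed

text \<open>\<open>Z b\<close> differs from \<open>F \<alpha>\<close>, with \<open>\<alpha> = W (W\<^sup>T F W)\<^sup>-\<^sup>1 W\<^sup>T Z b\<close>, by an element of the range
  of \<open>P\<close>, which exhibits \<open>Z b\<close> as the node values of a trial function.\<close>

lemma A_V: "A * V = V * four_block_mat L R (0\<^sub>m k M) \<Theta>"
proof (rule mat_eq_by_vec[of _ _ N])
  have B: "four_block_mat L R (0\<^sub>m k M) \<Theta> \<in> carrier_mat N N"
    using four_block_carrier_mat[OF L(1) carriers(4)] M_le_N by simp
  show "dim_row (A * V) = dim_row (V * four_block_mat L R (0\<^sub>m k M) \<Theta>)"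
    "dim_col (A * V) = N" "dim_col (V * four_block_mat L R (0\<^sub>m k M) \<Theta>) = N"
    using B carriers V_carrier by auto
  fix u :: "real Matrix.vec" assume u: "u \<in> carrier_vec N"
  then have "u \<in> carrier_vec (M + k)" using M_le_N by simp
  then obtain a b where a: "a \<in> carrier_vec M" and b: "b \<in> carrier_vec k" and uab: "u = a @\<^sub>v b"
    using append_split by blast
  define y where "y = inv_mat S *\<^sub>v (U *\<^sub>v b)"
  \<comment> \<open>By \<open>S * S = inv_mat G\<close>, this is the solution of
    \<open>G g = y\<close>; thus \<open>\<alpha>\<close> are the kernel coefficients for which
    \<open>F \<alpha>\<close> has the \<open>W\<close>-coordinates \<open>y\<close>.\<close>
  define g where "g = S *\<^sub>v (U *\<^sub>v b)"
  define \<alpha> where "\<alpha> = W *\<^sub>v g"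
  have Ub: "U *\<^sub>v b \<in> carrier_vec k" using carriers b by simp
  have y: "y \<in> carrier_vec k" using S_inv(1) Ub by (simp add: y_def)
  have g: "g \<in> carrier_vec k" using carriers Ub by (simp add: g_def)
  have \<alpha>: "\<alpha> \<in> carrier_vec N" "P\<^sup>T *\<^sub>v \<alpha> = 0\<^sub>v M"
    using carriers g W_orth by (auto simp: \<alpha>_def)
  have Zb: "Z *\<^sub>v b = W *\<^sub>v y" using Z_vec[OF b] by (simp add: y_def)
  have Giy: "inv_mat G *\<^sub>v y = g"
  proof -
    have "inv_mat G *\<^sub>v y = S *\<^sub>v (S *\<^sub>v y)"
      unfolding choice(4)[symmetric] using carriers y by (intro mat_vec_assoc) auto
    then show ?thesis unfolding g_def y_def using S_cancel(1)[OF Ub] by simp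
  qed
  have AZ: "(W * inv_mat G * W\<^sup>T) *\<^sub>v (Z *\<^sub>v b) = \<alpha>"
  proof -
    have "(W * inv_mat G * W\<^sup>T) *\<^sub>v (Z *\<^sub>v b) = W *\<^sub>v (inv_mat G *\<^sub>v (W\<^sup>T *\<^sub>v (W *\<^sub>v y)))"
      unfolding Zb using carriers G_inv(1) y by (simp add: mat_vec_assoc)
    then show ?thesis unfolding W_inv[OF y] Giy \<alpha>_def .
  qed
  define q where "q = pseudo_inv P *\<^sub>v (F *\<^sub>v \<alpha>)"
  have Fa: "F *\<^sub>v \<alpha> \<in> carrier_vec N" and Ka: "K *\<^sub>v \<alpha> \<in> carrier_vec N" using F K \<alpha> by auto
  have q: "q \<in> carrier_vec M" using pseudo_inv_carrier Fa by (simp add: q_def)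
  have WF: "W\<^sup>T *\<^sub>v (F *\<^sub>v \<alpha>) = y"
  proof -
    have "W\<^sup>T *\<^sub>v (F *\<^sub>v \<alpha>) = G *\<^sub>v g" unfolding G_vec[OF g] \<alpha>_def ..
    also have "\<dots> = y" unfolding Giy[symmetric]
      using G_inv carriers(6) y by (metis assoc_mult_mat_vec one_mult_mat_vec)
    finally show ?thesis .
  qed
  have Fa_eq: "F *\<^sub>v \<alpha> = P *\<^sub>v q + W *\<^sub>v y"
    using projection[OF Fa] unfolding WF q_def .
  have Vu: "V *\<^sub>v u = F *\<^sub>v \<alpha> + P *\<^sub>v (a - q)"
  proof -
    have 1: "P *\<^sub>v (a - q) = P *\<^sub>v a - P *\<^sub>v q" using P a q by (intro mat_vec_minus) auto
    have "P *\<^sub>v a \<in> carrier_vec N" "P *\<^sub>v q \<in> carrier_vec N" "W *\<^sub>v y \<in> carrier_vec N"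
      using P a q carriers y by auto
    moreover have "u + w = (v + w) + (u - v)"
      if "u \<in> carrier_vec N" "v \<in> carrier_vec N" "w \<in> carrier_vec N" for u v w :: "real Matrix.vec"
      using that by (intro eq_vecI) auto
    ultimately show ?thesis unfolding uab V_vec[OF a b] Zb Fa_eq 1 by blast
  qed
  have WK: "W *\<^sub>v (W\<^sup>T *\<^sub>v (K *\<^sub>v \<alpha>)) = Z *\<^sub>v (\<Theta> *\<^sub>v b)"
  proof -
    have c: "W\<^sup>T *\<^sub>v (K *\<^sub>v \<alpha>) \<in> carrier_vec k" using carriers Ka by simp
    have "S *\<^sub>v (W\<^sup>T *\<^sub>v (K *\<^sub>v \<alpha>)) = U *\<^sub>v (\<Theta> *\<^sub>v b)"
      using Theta_vec[OF b] by (simp add: \<alpha>_def g_def)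
    then have "W\<^sup>T *\<^sub>v (K *\<^sub>v \<alpha>) = inv_mat S *\<^sub>v (U *\<^sub>v (\<Theta> *\<^sub>v b))"
      using S_cancel(2)[OF c] by simp
    then show ?thesis using Z_vec[of "\<Theta> *\<^sub>v b"] carriers b by simp
  qed
  \<comment> \<open>\<open>t\<close> and \<open>q\<close> are the \<open>P\<close>-coordinates of
    \<open>K \<alpha>\<close> and \<open>F \<alpha>\<close>. The operator multiplies the
    compensating term \<open>- P q\<close> by \<open>L\<close>, so \<open>t - L q\<close> is left
    over in the range of \<open>P\<close>; this is what \<open>R\<close> records.\<close>
  define t where "t = pseudo_inv P *\<^sub>v (K *\<^sub>v \<alpha>)"
  have t: "t \<in> carrier_vec M" using pseudo_inv_carrier Ka by (simp add: t_def)
  have Rb: "R *\<^sub>v b = t - L *\<^sub>v q"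
  proof -
    have "R *\<^sub>v b = (pseudo_inv P * K - L * pseudo_inv P * F) *\<^sub>v ((W * inv_mat G * W\<^sup>T) *\<^sub>v (Z *\<^sub>v b))"
      unfolding block_R_def using carriers G_inv(1) pseudo_inv_carrier Z_carrier K F L b
      by (simp add: mat_vec_assoc)
    also have "\<dots> = t - L *\<^sub>v q"
      unfolding AZ t_def q_def using pseudo_inv_carrier K F L \<alpha>
      by (simp add: minus_mat_vec mat_vec_assoc)
    finally show ?thesis .
  qed
  have "(A * V) *\<^sub>v u = A *\<^sub>v (F *\<^sub>v \<alpha> + P *\<^sub>v (a - q))"
    unfolding Vu[symmetric] using carriers V_carrier u by auto
  also have "\<dots> = K *\<^sub>v \<alpha> + P *\<^sub>v (L *\<^sub>v (a - q))"
    using A \<alpha> a q by (simp add: is_diff_def)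
  also have "\<dots> = P *\<^sub>v (L *\<^sub>v a + R *\<^sub>v b) + Z *\<^sub>v (\<Theta> *\<^sub>v b)"
  proof -
    have 1: "P *\<^sub>v (L *\<^sub>v (a - q)) = P *\<^sub>v (L *\<^sub>v a) - P *\<^sub>v (L *\<^sub>v q)"
      using P L a q by (simp add: mat_vec_minus)
    have 2: "K *\<^sub>v \<alpha> = P *\<^sub>v t + Z *\<^sub>v (\<Theta> *\<^sub>v b)"
      using projection[OF Ka] unfolding WK t_def .
    have 3: "P *\<^sub>v (L *\<^sub>v a + R *\<^sub>v b) = P *\<^sub>v (L *\<^sub>v a) + (P *\<^sub>v t - P *\<^sub>v (L *\<^sub>v q))"
      unfolding Rb using P L a q t by (simp add: mat_vec_minus mat_vec_add)
    have "P *\<^sub>v (L *\<^sub>v a) \<in> carrier_vec N" "P *\<^sub>v (L *\<^sub>v q) \<in> carrier_vec N" "P *\<^sub>v t \<in> carrier_vec N"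
      "Z *\<^sub>v (\<Theta> *\<^sub>v b) \<in> carrier_vec N" using P L a q t Z_carrier carriers b by auto
    moreover have "(c + d) + (e - f) = (e + (c - f)) + d"
      if "c \<in> carrier_vec N" "d \<in> carrier_vec N" "e \<in> carrier_vec N" "f \<in> carrier_vec N"
      for c d e f :: "real Matrix.vec"
      using that by (intro eq_vecI) auto
    ultimately show ?thesis unfolding 1 2 3 by blast
  qed
  also have "\<dots> = V *\<^sub>v ((L *\<^sub>v a + R *\<^sub>v b) @\<^sub>v (\<Theta> *\<^sub>v b))"
    by (rule V_vec[symmetric]) (use L a R_carrier b carriers in auto)
  also have "(L *\<^sub>v a + R *\<^sub>v b) @\<^sub>v (\<Theta> *\<^sub>v b) = four_block_mat L R (0\<^sub>m k M) \<Theta> *\<^sub>v u"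
  proof -
    have "four_block_mat L R (0\<^sub>m k M) \<Theta> *\<^sub>v u = (L *\<^sub>v a + R *\<^sub>v b) @\<^sub>v (0\<^sub>m k M *\<^sub>v a + \<Theta> *\<^sub>v b)"
      unfolding uab by (rule four_block_mat_mult_vec) (use L R_carrier carriers a b in auto)
    also have "0\<^sub>m k M *\<^sub>v a + \<Theta> *\<^sub>v b = \<Theta> *\<^sub>v b" using a b carriers by (intro eq_vecI) auto
    finally show ?thesis ..
  qed
  also have "V *\<^sub>v (four_block_mat L R (0\<^sub>m k M) \<Theta> *\<^sub>v u) = (V * four_block_mat L R (0\<^sub>m k M) \<Theta>) *\<^sub>v u"
    using assoc_mult_mat_vec[OF V_carrier B u] by simp
  finally show "(A * V) *\<^sub>v u = (V * four_block_mat L R (0\<^sub>m k M) \<Theta>) *\<^sub>v u" .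
qed

lemma spectral_bound:
  assumes E: "E \<in> carrier_mat N N" and \<mu>: "\<mu> \<in> complex_spectrum E"
  shows "spectral_dist \<mu> (complex_spectrum A)
    \<le> (1 + op_norm R / \<gamma>)\<^sup>2 * op_norm V * op_norm (inv_mat V) * op_norm (A - E)"
proof -
  \<comment> \<open>The entrywise solution of \<open>X \<Theta> - L X = R\<close>; by
    \<open>Theta_ge\<close> and \<open>L_le\<close> each denominator is at least
    \<open>\<gamma>\<close>.\<close>
  define X where "X = mat M k (\<lambda>(i, j). R $$ (i, j) / (\<Theta> $$ (j, j) - L $$ (i, i)))"
  have X: "X \<in> carrier_mat M k" by (simp add: X_def)
  define T where "T = four_block_mat (1\<^sub>m M) X (0\<^sub>m k M) (1\<^sub>m k)"
  define T' where "T' = four_block_mat (1\<^sub>m M) (- X) (0\<^sub>m k M) (1\<^sub>m k)"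
  define D where "D = four_block_mat L (0\<^sub>m M k) (0\<^sub>m k M) \<Theta>"
  define B where "B = four_block_mat L R (0\<^sub>m k M) \<Theta>"
  have N: "M + k = N" using M_le_N by simp
  have C: "T \<in> carrier_mat N N" "T' \<in> carrier_mat N N" "D \<in> carrier_mat N N" "B \<in> carrier_mat N N"
    using four_block_carrier_mat[of "1\<^sub>m M" M M "1\<^sub>m k" k k] four_block_carrier_mat[OF L(1) carriers(4)]
    unfolding N T_def T'_def D_def B_def by auto
  have D_diag: "diagonal_mat D"
    unfolding D_def using L(2) choice(6) L(1) carriers(4) by (auto simp: diagonal_mat_def)
  have mX: "- X \<in> carrier_mat M k" using X by simp
  have "T * T' = four_block_mat (1\<^sub>m M * 1\<^sub>m M + X * 0\<^sub>m k M) (1\<^sub>m M * (- X) + X * 1\<^sub>m k)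
      (0\<^sub>m k M * 1\<^sub>m M + 1\<^sub>m k * 0\<^sub>m k M) (0\<^sub>m k M * (- X) + 1\<^sub>m k * 1\<^sub>m k)"
    unfolding T_def T'_def by (rule mult_four_block_mat[OF _ X _ _ _ mX]) auto
  also have "\<dots> = four_block_mat (1\<^sub>m M) (0\<^sub>m M k) (0\<^sub>m k M) (1\<^sub>m k)"
    using X by (intro arg_cong4[of _ _ _ _ _ _ _ _ four_block_mat]) (auto intro!: eq_matI)
  also have "\<dots> = 1\<^sub>m N" unfolding four_block_one_mat N ..
  finally have TT': "T * T' = 1\<^sub>m N" .
  have R_eq: "R = X * \<Theta> - L * X"
  proof (rule eq_matI)
    fix i j assume "i < dim_row (X * \<Theta> - L * X)" "j < dim_col (X * \<Theta> - L * X)"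
    then have ij: "i < M" "j < k" using X L carriers by auto
    have "(X * \<Theta>) $$ (i, j) = X $$ (i, j) * \<Theta> $$ (j, j)"
      by (rule mult_diagonal_mat_index[OF carriers(4) choice(6) X ij])
    moreover have "(L * X) $$ (i, j) = L $$ (i, i) * X $$ (i, j)"
    proof -
      have c: "col X j \<in> carrier_vec M" using X by auto
      have "(L * X) $$ (i, j) = (L *\<^sub>v col X j) $ i" using ij X L by simp
      then show ?thesis using diagonal_mat_vec_index[OF L c ij(1)] ij X by simp
    qed
    moreover have "\<Theta> $$ (j, j) - L $$ (i, i) > 0" using Theta_ge[OF ij(2)] L_le[OF ij(1)] gap by simp
    then have "X $$ (i, j) * (\<Theta> $$ (j, j) - L $$ (i, i)) = R $$ (i, j)"
      using ij by (simp add: X_def)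
    then have "X $$ (i, j) * \<Theta> $$ (j, j) - L $$ (i, i) * X $$ (i, j) = R $$ (i, j)"
      by (simp add: algebra_simps)
    ultimately show "R $$ (i, j) = (X * \<Theta> - L * X) $$ (i, j)" using ij X L carriers by simp
  qed (use X L carriers R_carrier in auto)
  \<comment> \<open>Only the upper right block has content; there the identity is the Sylvester
    equation.\<close>
  have BT: "B * T = T * D"
  proof -
    have "B * T = four_block_mat (L * 1\<^sub>m M + R * 0\<^sub>m k M) (L * X + R * 1\<^sub>m k)
      (0\<^sub>m k M * 1\<^sub>m M + \<Theta> * 0\<^sub>m k M) (0\<^sub>m k M * X + \<Theta> * 1\<^sub>m k)"
      unfolding B_def T_def
      by (rule mult_four_block_mat[OF L(1) R_carrier _ carriers(4) _ X]) auto
    moreover have "T * D = four_block_mat (1\<^sub>m M * L + X * 0\<^sub>m k M) (1\<^sub>m M * 0\<^sub>m M k + X * \<Theta>)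
      (0\<^sub>m k M * L + 1\<^sub>m k * 0\<^sub>m k M) (0\<^sub>m k M * 0\<^sub>m M k + 1\<^sub>m k * \<Theta>)"
      unfolding T_def D_def
      by (rule mult_four_block_mat[OF _ X _ _ L(1) _ _ carriers(4)]) auto
    moreover have "L * X + R * 1\<^sub>m k = 1\<^sub>m M * 0\<^sub>m M k + X * \<Theta>"
    proof (rule eq_matI)
      fix i j assume "i < dim_row (1\<^sub>m M * 0\<^sub>m M k + X * \<Theta>)" "j < dim_col (1\<^sub>m M * 0\<^sub>m M k + X * \<Theta>)"
      then have ij: "i < M" "j < k" using X carriers by auto
      have "R $$ (i, j) = (X * \<Theta>) $$ (i, j) - (L * X) $$ (i, j)"
        using arg_cong[OF R_eq, of "\<lambda>B. B $$ (i, j)"] ij X L carriers by simp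
      moreover have "R * 1\<^sub>m k = R" "1\<^sub>m M * 0\<^sub>m M k = (0\<^sub>m M k :: real mat)" using R_carrier by auto
      ultimately show "(L * X + R * 1\<^sub>m k) $$ (i, j) = (1\<^sub>m M * 0\<^sub>m M k + X * \<Theta>) $$ (i, j)"
        using ij X L carriers R_carrier by (simp del: index_mult_mat(1))
    qed (use X L carriers R_carrier in auto)
    moreover have "L * 1\<^sub>m M + R * 0\<^sub>m k M = 1\<^sub>m M * L + X * 0\<^sub>m k M"
      using X L R_carrier by (auto intro!: eq_matI)
    moreover have "0\<^sub>m k M * 1\<^sub>m M + \<Theta> * 0\<^sub>m k M = 0\<^sub>m k M * L + 1\<^sub>m k * 0\<^sub>m k M"
      using L carriers by (auto intro!: eq_matI)
    moreover have "0\<^sub>m k M * X + \<Theta> * 1\<^sub>m k = 0\<^sub>m k M * 0\<^sub>m M k + 1\<^sub>m k * \<Theta>"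
      using X carriers by (auto intro!: eq_matI)
    ultimately show ?thesis by simp
  qed
  define Q where "Q = V * T"
  define Q' where "Q' = T' * inv_mat V"
  have Q: "Q \<in> carrier_mat N N" "Q' \<in> carrier_mat N N"
    using C V_carrier V_inv(1) by (auto simp: Q_def Q'_def)
  have "Q * Q' = 1\<^sub>m N"
  proof -
    have "Q * Q' = V * ((T * T') * inv_mat V)"
      unfolding Q_def Q'_def using C V_carrier V_inv(1) by (simp add: mat_assoc)
    then show ?thesis unfolding TT' using V_inv by simp
  qed
  moreover have "A * Q = Q * D"
  proof -
    have "A * Q = (A * V) * T" unfolding Q_def using carriers V_carrier C by (simp add: mat_assoc)
    also have "\<dots> = V * (B * T)" unfolding A_V B_def[symmetric] using V_carrier C by (simp add: mat_assoc)
    also have "\<dots> = Q * D" unfolding BT Q_def using V_carrier C by (simp add: mat_assoc)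
    finally show ?thesis .
  qed
  ultimately have bf: "spectral_dist \<mu> (complex_spectrum A) \<le> op_norm Q * op_norm Q' * op_norm (A - E)"
    using bauer_fike[OF carriers(5) Q _ C(3) D_diag _ E \<mu>] by blast
  have "\<gamma> * op_norm X \<le> op_norm R"
    unfolding R_eq
    by (rule sylvester_bound[OF X L carriers(4) choice(6) gap L_le Theta_ge])
  then have Xle: "op_norm X \<le> op_norm R / \<gamma>" using gap by (simp add: field_simps)
  have "op_norm (- X) = op_norm X"
  proof -
    have "eucl_norm (- X *\<^sub>v v) = eucl_norm (X *\<^sub>v v)" if "v \<in> carrier_vec k" for v
    proof -
      have "- X *\<^sub>v v = (- 1) \<cdot>\<^sub>v (X *\<^sub>v v)" using X that by (intro eq_vecI) auto
      then show ?thesis by simp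
    qed
    then show ?thesis unfolding op_norm_def using X by (intro SUP_cong) auto
  qed
  then have T_le: "op_norm T \<le> 1 + op_norm R / \<gamma>" "op_norm T' \<le> 1 + op_norm R / \<gamma>"
    using op_norm_unipotent[OF X] op_norm_unipotent[OF mX] Xle by (simp_all add: T_def T'_def)
  have "op_norm Q \<le> op_norm V * op_norm T"
    unfolding Q_def using V_carrier C by (intro op_norm_mult) auto
  also have "\<dots> \<le> op_norm V * (1 + op_norm R / \<gamma>)" using T_le by (intro mult_left_mono) auto
  finally have Q1: "op_norm Q \<le> op_norm V * (1 + op_norm R / \<gamma>)" .
  have "op_norm Q' \<le> op_norm T' * op_norm (inv_mat V)"
    unfolding Q'_def using V_inv C by (intro op_norm_mult) auto
  also have "\<dots> \<le> (1 + op_norm R / \<gamma>) * op_norm (inv_mat V)" using T_le by (intro mult_right_mono) auto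
  finally have Q2: "op_norm Q' \<le> (1 + op_norm R / \<gamma>) * op_norm (inv_mat V)" .
  have pos: "0 \<le> 1 + op_norm R / \<gamma>" using gap by (simp add: add_nonneg_nonneg)
  note bf
  \<comment> \<open>One factor \<open>1 + op_norm R / \<gamma>\<close> comes from \<open>T\<close>
    and one from its inverse \<open>T'\<close>; \<open>V\<close> contributes its condition
    number.\<close>
  also have "op_norm Q * op_norm Q' * op_norm (A - E) \<le>
      (op_norm V * (1 + op_norm R / \<gamma>)) * ((1 + op_norm R / \<gamma>) * op_norm (inv_mat V)) * op_norm (A - E)"
    using Q1 Q2 pos by (intro mult_right_mono mult_mono) auto
  finally show ?thesis by (simp add: power2_eq_square mult_ac)
qed

end

section \<open>Directional derivatives of polynomial functions\<close>

text \<open>Built from \<open>deriv\<close> on a line, as \<open>laplacian\<close> is, so that for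
  polynomials the Laplacian becomes a sum of iterated \<open>dirderiv\<close>s.\<close>

definition dirderiv :: "'a::real_normed_vector \<Rightarrow> ('a \<Rightarrow> real) \<Rightarrow> 'a \<Rightarrow> real" where
  "dirderiv v h x = deriv (\<lambda>t. h (x + t *\<^sub>R v)) 0"

lemma dirderiv_eqI: "((\<lambda>t. h (x + t *\<^sub>R v)) has_real_derivative d) (at 0) \<Longrightarrow> dirderiv v h x = d"
  unfolding dirderiv_def by (rule DERIV_imp_deriv)

lemma dirderiv_linear:
  assumes "bounded_linear f"
  shows "((\<lambda>t. f (x + t *\<^sub>R v)) has_real_derivative f v) (at 0)"
proof -
  interpret bounded_linear f by fact
  show ?thesis by (auto simp: add scaleR intro!: derivative_eq_intros)
qed

lemma has_dirderiv_0:
  assumes "real_polynomial_function h"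
  shows "((\<lambda>t. h (x + t *\<^sub>R v)) has_real_derivative dirderiv v h x) (at 0)"
proof -
  have "\<exists>d. ((\<lambda>t. h (x + t *\<^sub>R v)) has_real_derivative d) (at 0)"
    using assms
  proof induction
    case (linear f)
    then show ?case using dirderiv_linear by blast
  next
    case (const c)
    then show ?case by (intro exI[of _ 0]) simp
  next
    case (add f g)
    then show ?case using DERIV_add by blast
  next
    case (mult f g)
    then show ?case using DERIV_mult by blast
  qed
  then show ?thesis using dirderiv_eqI by blast
qed

lemma has_dirderiv:
  assumes "real_polynomial_function h"
  shows "((\<lambda>t. h (x + t *\<^sub>R v)) has_real_derivative dirderiv v h (x + s *\<^sub>R v)) (at s)"
proof -
  have "((\<lambda>t. h ((x + s *\<^sub>R v) + t *\<^sub>R v)) has_real_derivative dirderiv v h (x + s *\<^sub>R v)) (at 0)"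
    by (rule has_dirderiv_0[OF assms])
  then have "((\<lambda>t. h (x + (s + t) *\<^sub>R v)) has_real_derivative dirderiv v h (x + s *\<^sub>R v)) (at 0)"
    by (simp add: algebra_simps)
  then show ?thesis
    using DERIV_shift[of "\<lambda>t. h (x + t *\<^sub>R v)" _ 0 s] by (simp add: add.commute)
qed

lemma dirderiv_const: "dirderiv v (\<lambda>x. c) = (\<lambda>x. 0)"
  by (rule ext, rule dirderiv_eqI) simp

lemma dirderiv_bounded_linear: "bounded_linear f \<Longrightarrow> dirderiv v f = (\<lambda>x. f v)"
  by (rule ext, rule dirderiv_eqI, rule dirderiv_linear)

lemma dirderiv_add:
  "real_polynomial_function f \<Longrightarrow> real_polynomial_function g \<Longrightarrow>
    dirderiv v (\<lambda>x. f x + g x) = (\<lambda>x. dirderiv v f x + dirderiv v g x)"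
  by (rule ext, rule dirderiv_eqI) (intro derivative_intros has_dirderiv_0)

lemma dirderiv_mult:
  assumes "real_polynomial_function f" "real_polynomial_function g"
  shows "dirderiv v (\<lambda>x. f x * g x) = (\<lambda>x. dirderiv v f x * g x + f x * dirderiv v g x)"
proof (rule ext, rule dirderiv_eqI)
  fix x
  show "((\<lambda>t. f (x + t *\<^sub>R v) * g (x + t *\<^sub>R v)) has_real_derivative
      dirderiv v f x * g x + f x * dirderiv v g x) (at 0)"
    using DERIV_mult[OF has_dirderiv_0[OF assms(1), of x v] has_dirderiv_0[OF assms(2), of x v]]
    by (simp add: algebra_simps)
qed

lemma real_polynomial_function_dirderiv:
  "real_polynomial_function h \<Longrightarrow> real_polynomial_function (dirderiv v h)"
  by (induction rule: real_polynomial_function.induct)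
     (simp_all add: dirderiv_bounded_linear dirderiv_const dirderiv_add dirderiv_mult
        real_polynomial_function.intros)

text \<open>The induction over polynomial functions takes the place of Schwarz's theorem: for linear
  functions all second derivatives vanish, and the expansion of a product is symmetric in
  \<open>v\<close> and \<open>w\<close> up to the induction hypothesis.\<close>

lemma dirderiv_commute:
  "real_polynomial_function h \<Longrightarrow> dirderiv v (dirderiv w h) = dirderiv w (dirderiv v h)"
proof (induction rule: real_polynomial_function.induct)
  case (add f g)
  then show ?case
    by (simp add: dirderiv_add real_polynomial_function_dirderiv)
next
  case (mult f g)
  note P = mult(1,2) real_polynomial_function_dirderiv
  have "dirderiv v (dirderiv w (\<lambda>x. f x * g x)) =
    (\<lambda>x. (dirderiv v (dirderiv w f) x * g x + dirderiv w f x * dirderiv v g x) +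
          (dirderiv v f x * dirderiv w g x + f x * dirderiv v (dirderiv w g) x))" for v w
  proof -
    have "real_polynomial_function (\<lambda>x. dirderiv w f x * g x)" "real_polynomial_function (\<lambda>x. f x * dirderiv w g x)"
      using P by (auto intro: real_polynomial_function.intros)
    then show ?thesis using mult(1,2)
      by (simp add: dirderiv_mult dirderiv_add real_polynomial_function_dirderiv)
  qed
  then show ?case using mult by (simp add: algebra_simps)
qed (simp_all add: dirderiv_bounded_linear dirderiv_const)

lemma dirderiv_add_dir:
  "real_polynomial_function h \<Longrightarrow> dirderiv (v + w) h x = dirderiv v h x + dirderiv w h x"
  by (induction rule: real_polynomial_function.induct)
     (simp_all add: dirderiv_bounded_linear dirderiv_const dirderiv_add dirderiv_mult
        linear_add bounded_linear.linear algebra_simps)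

lemma dirderiv_scale_dir:
  "real_polynomial_function h \<Longrightarrow> dirderiv (c *\<^sub>R v) h x = c * dirderiv v h x"
  by (induction rule: real_polynomial_function.induct)
     (simp_all add: dirderiv_bounded_linear dirderiv_const dirderiv_add dirderiv_mult
        linear_scale bounded_linear.linear algebra_simps)

lemma dirderiv_zero_dir: "real_polynomial_function h \<Longrightarrow> dirderiv 0 h x = 0"
  using dirderiv_scale_dir[of h 0 0 x] by simp

lemma dirderiv_sum_dir:
  assumes "real_polynomial_function h" "finite I"
  shows "dirderiv (\<Sum>i\<in>I. v i) h x = (\<Sum>i\<in>I. dirderiv (v i) h x)"
  using assms(2,1) by (induction I rule: finite_induct) (simp_all add: dirderiv_zero_dir dirderiv_add_dir)

lemma dirderiv_compose_linear:
  assumes "linear T" 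
  shows "dirderiv v (\<lambda>x. h (T x)) x = dirderiv (T v) h (T x)"
  using assms by (simp add: dirderiv_def linear_add linear_scale)

lemma dirderiv_sum:
  "finite I \<Longrightarrow> (\<And>i. i \<in> I \<Longrightarrow> real_polynomial_function (f i)) \<Longrightarrow>
    dirderiv v (\<lambda>x. \<Sum>i\<in>I. f i x) = (\<lambda>x. \<Sum>i\<in>I. dirderiv v (f i) x)"
  by (induction I rule: finite_induct)
     (simp_all add: dirderiv_const dirderiv_add real_polynomial_function_sum)

lemma laplacian_dirderiv:
  assumes h: "real_polynomial_function h"
  shows "laplacian h x = (\<Sum>b\<in>Basis. dirderiv b (dirderiv b h) x)"
proof -
  have "(deriv ^^ 2) (\<lambda>t. h (x + t *\<^sub>R b)) 0 = dirderiv b (dirderiv b h) x" for b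
  proof -
    have "deriv (\<lambda>t. h (x + t *\<^sub>R b)) = (\<lambda>s. dirderiv b h (x + s *\<^sub>R b))"
      by (rule ext, rule DERIV_imp_deriv, rule has_dirderiv[OF h])
    then show ?thesis by (simp add: numeral_2_eq_2 dirderiv_def[of b "dirderiv b h"])
  qed
  then show ?thesis by (simp add: laplacian_def)
qed

text \<open>The second derivative in direction \<open>T b\<close> is a quadratic form in
  \<open>T b\<close>. Summed over the basis, the products of the coordinates of \<open>T b\<close>
  give the identity matrix, because the inverse of \<open>T\<close> is its adjoint and preserves
  inner products.\<close>

lemma laplacian_compose_orthogonal:
  fixes h :: "'a::euclidean_space \<Rightarrow> real"
  assumes h: "real_polynomial_function h" and T: "orthogonal_transformation (T :: 'a \<Rightarrow> 'a)"
  shows "laplacian (\<lambda>x. h (T x)) x = laplacian h (T x)"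
proof -
  have lin: "linear T" using T by (rule orthogonal_transformation_linear)
  have pT: "polynomial_function T"
    using lin linear_conv_bounded_linear polynomial_function_bounded_linear by blast
  have hT: "real_polynomial_function (\<lambda>x. h (T x))"
    using real_polynomial_function_compose[OF pT h] by (simp add: o_def)
  have "dirderiv b (dirderiv b (\<lambda>x. h (T x))) x = dirderiv (T b) (dirderiv (T b) h) (T x)" for b
  proof -
    have "dirderiv b (\<lambda>x. h (T x)) = (\<lambda>x. dirderiv (T b) h (T x))"
      using dirderiv_compose_linear[OF lin] by blast
    then show ?thesis using dirderiv_compose_linear[OF lin] by simp
  qed
  then have "laplacian (\<lambda>x. h (T x)) x = (\<Sum>b\<in>Basis. dirderiv (T b) (dirderiv (T b) h) (T x))"
    using laplacian_dirderiv[OF hT] by simp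
  also have "\<dots> = (\<Sum>b\<in>Basis. \<Sum>c\<in>Basis. \<Sum>c'\<in>Basis. (inner (T b) c * inner (T b) c') * dirderiv c (dirderiv c' h) (T x))"
  proof (rule sum.cong[OF refl])
    fix b :: 'a assume "b \<in> Basis"
    have e: "T b = (\<Sum>c\<in>Basis. inner (T b) c *\<^sub>R c)" by (simp add: euclidean_representation)
    have "dirderiv (T b) h = (\<lambda>y. \<Sum>c'\<in>Basis. inner (T b) c' * dirderiv c' h y)"
      by (subst e, rule ext, subst dirderiv_sum_dir[OF h]) (simp_all add: dirderiv_scale_dir[OF h])
    then have "dirderiv v (dirderiv (T b) h) y = (\<Sum>c'\<in>Basis. inner (T b) c' * dirderiv v (dirderiv c' h) y)" for v y
      using h by (simp add: dirderiv_sum real_polynomial_function_dirderiv real_polynomial_function.intros dirderiv_mult dirderiv_const)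
    moreover have "dirderiv (T b) g y = (\<Sum>c\<in>Basis. inner (T b) c * dirderiv c g y)"
      if "real_polynomial_function g" for g y
      by (subst e, subst dirderiv_sum_dir[OF that]) (simp_all add: dirderiv_scale_dir[OF that])
    ultimately show "dirderiv (T b) (dirderiv (T b) h) (T x) =
        (\<Sum>c\<in>Basis. \<Sum>c'\<in>Basis. (inner (T b) c * inner (T b) c') * dirderiv c (dirderiv c' h) (T x))"
      using h by (simp add: real_polynomial_function_dirderiv sum_distrib_left)
        (subst sum.swap, simp add: mult_ac)
  qed
  also have "\<dots> = (\<Sum>c\<in>Basis. \<Sum>c'\<in>Basis. (\<Sum>b\<in>Basis. inner (T b) c * inner (T b) c') * dirderiv c (dirderiv c' h) (T x))"
    unfolding sum_distrib_right by (subst sum.swap, rule sum.cong[OF refl], rule sum.swap)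
  also have "\<dots> = (\<Sum>c\<in>Basis. \<Sum>c'\<in>Basis. (if c = c' then 1 else 0) * dirderiv c (dirderiv c' h) (T x))"
  proof (intro sum.cong refl arg_cong2[of _ _ _ _ "(*)"])
    fix c c' :: 'a assume c: "c \<in> Basis" "c' \<in> Basis"
    obtain T' where T': "orthogonal_transformation T'" "T' \<circ> T = id" "T \<circ> T' = id"
      using T orthogonal_transformation_inv orthogonal_transformation_bij
      by (metis bij_is_inj bij_is_surj inv_o_cancel surj_iff)
    have adj: "inner (T b) y = inner b (T' y)" for b y
      using T T' unfolding orthogonal_transformation_def
      by (metis comp_apply id_apply)
    have "(\<Sum>b\<in>Basis. inner (T b) c * inner (T b) c') = (\<Sum>b\<in>Basis. inner (T' c) b * inner (T' c') b)"
      unfolding adj by (simp add: inner_commute)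
    also have "\<dots> = inner (T' c) (T' c')" by (rule euclidean_inner[symmetric])
    also have "\<dots> = inner c c'" using T' by (simp add: orthogonal_transformation_def)
    finally show "(\<Sum>b\<in>Basis. inner (T b) c * inner (T b) c') = (if c = c' then 1 else 0)"
      using c by (simp add: inner_Basis)
  qed
  also have "\<dots> = laplacian h (T x)" by (simp add: laplacian_dirderiv[OF h] if_distrib[of "\<lambda>x. x * _"] cong: if_cong)
  finally show ?thesis .
qed

subsection \<open>The dimension of the space of spherical harmonics\<close>

text \<open>From \<open>q (u + t v) = t ^ l * q (v + u / t)\<close>, reversing the polynomial
  \<open>r\<close> on the line through \<open>v\<close> bounds the degree of \<open>p\<close>.
  Homogeneity is required for \<open>t \<noteq> 0\<close> only, the form in which
  \<open>dirderiv_homogeneous\<close> supplies it for derivatives.\<close>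

lemma homogeneous_line_poly:
  fixes q :: "'a::euclidean_space \<Rightarrow> real"
  assumes q: "real_polynomial_function q" and hom: "\<And>t x. t \<noteq> 0 \<Longrightarrow> q (t *\<^sub>R x) = t ^ l * q x"
  obtains p where "\<And>t. q (u + t *\<^sub>R v) = poly p t" "degree p \<le> l"
proof -
  have line: "\<exists>p. \<forall>t. q (u + t *\<^sub>R v) = poly p t" for u v
  proof -
    have "polynomial_function (\<lambda>t::real. u + t *\<^sub>R v)"
      by (intro polynomial_function_add polynomial_function_const polynomial_function_bounded_linear
            bounded_linear_scaleR_left)
    then have "real_polynomial_function (\<lambda>t. q (u + t *\<^sub>R v))"
      using real_polynomial_function_compose[OF _ q, of "\<lambda>t. u + t *\<^sub>R v"] by (simp add: o_def)
    then obtain a n where "(\<lambda>t. q (u + t *\<^sub>R v)) = (\<lambda>t. \<Sum>i\<le>n. a i * t ^ i)"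
      using real_polynomial_function_iff_sum by blast
    then have "q (u + t *\<^sub>R v) = poly (\<Sum>i\<le>n. monom (a i) i) t" for t
      by (simp add: poly_sum poly_monom fun_eq_iff)
    then show ?thesis by blast
  qed
  obtain p where p: "\<And>t. q (u + t *\<^sub>R v) = poly p t" using line by blast
  obtain r where r: "\<And>t. q (v + t *\<^sub>R u) = poly r t" using line by blast
  have "poly (monom 1 (degree r) * p) t = poly (monom 1 l * reflect_poly r) t" if "t \<noteq> 0" for t
  proof -
    have "u + t *\<^sub>R v = t *\<^sub>R (v + (1 / t) *\<^sub>R u)" using that by (simp add: algebra_simps)
    then have "poly p t = t ^ l * poly r (1 / t)" using hom[OF that] p[of t] r by simp
    then show ?thesis using that by (simp add: poly_monom poly_reflect_poly_nz inverse_eq_divide)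
  qed
  \<comment> \<open>The extra factor \<open>[:0, 1:]\<close> makes both sides agree at 0 as
    well.\<close>
  then have "poly (monom 1 (degree r) * p * [:0, 1:]) = poly (monom 1 l * reflect_poly r * [:0, 1:])"
    by (intro ext, simp, metis)
  then have "monom 1 (degree r) * p * [:0, 1:] = monom 1 l * reflect_poly r * [:0, 1:]"
    by (simp add: poly_eq_poly_eq_iff)
  then have eq: "monom 1 (degree r) * p = monom 1 l * reflect_poly r" by simp
  have "degree p \<le> l"
  proof (cases "p = 0")
    case False
    then have "degree (monom 1 (degree r) * p) = degree r + degree p"
      by (subst degree_mult_eq) (auto simp: degree_monom_eq)
    moreover have "degree (monom 1 l * reflect_poly r) \<le> l + degree r"
      by (rule order_trans[OF degree_mult_le])
         (intro add_mono degree_reflect_poly_le order_trans[OF degree_monom_le], simp)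
    ultimately show ?thesis using eq by simp
  qed simp
  then show ?thesis using that p by blast
qed

section \<open>Finite sets of conditions that determine a harmonic polynomial\<close>

lemma poly_zero_on_grid:
  assumes "degree (p :: real poly) \<le> l" "\<And>i. i \<le> l \<Longrightarrow> poly p (real i) = 0"
  shows "p = 0"
proof (rule ccontr)
  assume "p \<noteq> 0"
  have "card (real ` {..l}) \<le> card {x. poly p x = 0}"
    using poly_roots_finite[OF \<open>p \<noteq> 0\<close>] assms(2) by (intro card_mono) auto
  also have "\<dots> \<le> degree p" by (rule card_poly_roots_bound[OF \<open>p \<noteq> 0\<close>])
  finally show False using assms(1) by (simp add: card_image)
qed

text \<open>One direction is freed at a time by counting zeros of a polynomial in one variable. The
  grid may be finer than the degree requires (\<open>l \<le> l'\<close>), so that one grid serves a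
  polynomial and its derivative.\<close>

lemma zero_on_span_grid:
  fixes q :: "'a::euclidean_space \<Rightarrow> real"
  assumes q: "real_polynomial_function q" and hom: "\<And>t x. t \<noteq> 0 \<Longrightarrow> q (t *\<^sub>R x) = t ^ l * q x" and "l \<le> l'"
    and fin: "finite B"
    and grid: "\<And>k. k \<in> B \<rightarrow>\<^sub>E {..l'} \<Longrightarrow> q (z + (\<Sum>b\<in>B. real (k b) *\<^sub>R b)) = 0"
  shows "q (z + (\<Sum>b\<in>B. k b *\<^sub>R b)) = 0"
  using fin grid
proof (induction B arbitrary: z k rule: finite_induct)
  case empty
  then show ?case using empty[of "\<lambda>_. undefined"] by simp
next
  case (insert a B)
  obtain p where p: "\<And>t. q ((z + (\<Sum>b\<in>B. k b *\<^sub>R b)) + t *\<^sub>R a) = poly p t" and deg: "degree p \<le> l"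
    using homogeneous_line_poly[OF q hom] by blast
  have "poly p (real i) = 0" if i: "i \<le> l'" for i
  proof -
    have "q ((z + real i *\<^sub>R a) + (\<Sum>b\<in>B. k b *\<^sub>R b)) = 0"
    proof (rule insert.IH)
      fix k' assume k': "k' \<in> B \<rightarrow>\<^sub>E {..l'}"
      have "q (z + (\<Sum>b\<in>insert a B. real ((k'(a := i)) b) *\<^sub>R b)) = 0"
        by (rule insert.prems) (use k' i in \<open>auto simp: PiE_iff extensional_def\<close>)
      moreover have "(\<Sum>b\<in>B. real ((k'(a := i)) b) *\<^sub>R b) = (\<Sum>b\<in>B. real (k' b) *\<^sub>R b)"
        using insert.hyps by (intro sum.cong) auto
      ultimately show "q (z + real i *\<^sub>R a + (\<Sum>b\<in>B. real (k' b) *\<^sub>R b)) = 0"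
        using insert.hyps by (simp add: add.assoc)
    qed
    then show ?thesis using p[of "real i"] by (simp add: algebra_simps)
  qed
  then have "p = 0" using deg \<open>l \<le> l'\<close> by (intro poly_zero_on_grid[of p l']) auto
  then show ?case using p[of "k a"] insert.hyps by (simp add: algebra_simps)
qed

text \<open>Homogeneity normalizes the coordinate along \<open>c\<close> to 1; this saves one grid
  direction and leads to the exponent \<open>d - 1\<close>. Points with coordinate 0 are reached on
  a line in direction \<open>c\<close>, where a polynomial vanishes at all points but possibly
  one.\<close>

lemma zero_on_hyperplane_grid:
  fixes q :: "'a::euclidean_space \<Rightarrow> real"
  assumes q: "real_polynomial_function q" and hom: "\<And>t x. t \<noteq> 0 \<Longrightarrow> q (t *\<^sub>R x) = t ^ l * q x" and "l \<le> l'"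
    and b: "b \<in> Basis" "c \<in> Basis" "b \<noteq> c"
    and grid: "\<And>k. k \<in> (Basis - {b, c}) \<rightarrow>\<^sub>E {..l'} \<Longrightarrow> q (c + (\<Sum>a\<in>Basis - {b, c}. real (k a) *\<^sub>R a)) = 0"
    and z: "inner z b = 0"
  shows "q z = 0"
proof -
  have dec: "z = inner z c *\<^sub>R c + (\<Sum>a\<in>Basis - {b, c}. inner z a *\<^sub>R a)" if "inner z b = 0" for z
  proof -
    have "z = (\<Sum>a\<in>Basis. inner z a *\<^sub>R a)" by (rule euclidean_representation[symmetric])
    also have "\<dots> = inner z b *\<^sub>R b + (\<Sum>a\<in>Basis - {b}. inner z a *\<^sub>R a)"
      by (rule sum.remove) (use b in auto)
    also have "(\<Sum>a\<in>Basis - {b}. inner z a *\<^sub>R a) = inner z c *\<^sub>R c + (\<Sum>a\<in>Basis - {b} - {c}. inner z a *\<^sub>R a)"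
      by (rule sum.remove) (use b in auto)
    also have "Basis - {b} - {c} = Basis - {b, c}" by auto
    finally show ?thesis using that by simp
  qed
  have nz: "q z = 0" if "inner z b = 0" "inner z c \<noteq> 0" for z
  proof -
    have "q (c + (\<Sum>a\<in>Basis - {b, c}. (inner z a / inner z c) *\<^sub>R a)) = 0"
      by (rule zero_on_span_grid[OF q hom \<open>l \<le> l'\<close> _ grid]) auto
    moreover have "z = inner z c *\<^sub>R (c + (\<Sum>a\<in>Basis - {b, c}. (inner z a / inner z c) *\<^sub>R a))"
      using dec[OF that(1)] that(2) by (simp add: scaleR_add_right scaleR_sum_right)
    ultimately show ?thesis using hom[OF that(2)] by (metis mult_zero_right)
  qed
  obtain p where p: "\<And>t. q (z + t *\<^sub>R c) = poly p t" using homogeneous_line_poly[OF q hom] by blast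
  have "poly p t = 0" if "t \<noteq> - inner z c" for t
    using nz[of "z + t *\<^sub>R c"] z b that p by (simp add: inner_add_left inner_Basis)
  then have "UNIV \<subseteq> insert (- inner z c) {t. poly p t = 0}" by blast
  then have "infinite {t. poly p t = 0}"
    using infinite_UNIV_char_0[where ?'a = real] by (metis finite_insert finite_subset)
  then have "p = 0" using poly_roots_finite by blast
  then show ?thesis using p[of 0] by simp
qed

text \<open>Laplace's equation expresses the second derivative along \<open>b\<close> by tangential
  ones, so all derivatives along \<open>b\<close> vanish on the hyperplane, and these determine the
  polynomial on each line in direction \<open>b\<close>.\<close>

lemma harmonic_zero_if_cauchy_data_zero:
  fixes h :: "'a::euclidean_space \<Rightarrow> real"
  assumes h: "real_polynomial_function h" and harm: "\<And>x. laplacian h x = 0" and b: "b \<in> Basis"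
    and 0: "\<And>z. inner z b = 0 \<Longrightarrow> h z = 0" and 1: "\<And>z. inner z b = 0 \<Longrightarrow> dirderiv b h z = 0"
  shows "h x = 0"
proof -
  define D where "D = (\<lambda>k. (dirderiv b ^^ k) h)"
  have D: "real_polynomial_function (D k)" for k
    by (induction k) (simp_all add: D_def h real_polynomial_function_dirderiv)
  have DS: "dirderiv b (D k) = D (Suc k)" for k by (simp add: D_def)
  have comm: "dirderiv a (dirderiv a (D k)) = (dirderiv b ^^ k) (dirderiv a (dirderiv a h))" for a k
  proof (induction k)
    case (Suc k)
    have "dirderiv a (dirderiv a (D (Suc k))) = dirderiv b (dirderiv a (dirderiv a (D k)))"
      unfolding DS[symmetric]
      by (metis D dirderiv_commute real_polynomial_function_dirderiv)
    then show ?case using Suc by simp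
  qed (simp add: D_def)
  \<comment> \<open>\<open>D k\<close> is again harmonic, since derivatives commute.\<close>
  have harmD: "(\<Sum>a\<in>Basis. dirderiv a (dirderiv a (D k)) x) = 0" for k x
  proof -
    have "(dirderiv b ^^ k) (\<lambda>x. \<Sum>a\<in>Basis. dirderiv a (dirderiv a h) x) x
        = (\<Sum>a\<in>Basis. (dirderiv b ^^ k) (dirderiv a (dirderiv a h)) x)"
    proof (induction k arbitrary: x)
      case (Suc k)
      have P: "real_polynomial_function ((dirderiv b ^^ k) (dirderiv a (dirderiv a h)))" for a
        by (induction k) (simp_all add: h real_polynomial_function_dirderiv)
      have "(dirderiv b ^^ k) (\<lambda>x. \<Sum>a\<in>Basis. dirderiv a (dirderiv a h) x)
          = (\<lambda>x. \<Sum>a\<in>Basis. (dirderiv b ^^ k) (dirderiv a (dirderiv a h)) x)"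
        using Suc by blast
      then show ?case by (simp add: dirderiv_sum P)
    qed simp
    moreover have "(\<lambda>x. \<Sum>a\<in>Basis. dirderiv a (dirderiv a h) x) = (\<lambda>x. 0)"
      using harm laplacian_dirderiv[OF h] by simp
    moreover have "(dirderiv b ^^ k) (\<lambda>x. 0) = (\<lambda>x. 0)" by (induction k) (simp_all add: dirderiv_const)
    ultimately show ?thesis by (simp add: comm)
  qed
  have van: "(\<forall>z. inner z b = 0 \<longrightarrow> D k z = 0) \<and> (\<forall>z. inner z b = 0 \<longrightarrow> D (Suc k) z = 0)" for k
  proof (induction k)
    case 0
    then show ?case using assms(4,5) by (simp add: D_def)
  next
    case (Suc k)
    have "D (Suc (Suc k)) z = 0" if z: "inner z b = 0" for z
    proof -
      have "dirderiv a (dirderiv a (D k)) z = 0" if a: "a \<in> Basis - {b}" for a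
      proof -
        have t: "inner (y + t *\<^sub>R a) b = 0" if "inner y b = 0" for y t
          using a b that by (auto simp: inner_add_left inner_Basis)
        have "dirderiv a (D k) y = 0" if "inner y b = 0" for y
        proof -
          have "(\<lambda>t. D k (y + t *\<^sub>R a)) = (\<lambda>t. 0)" using Suc t[OF that] by auto
          then show ?thesis by (simp add: dirderiv_def)
        qed
        then have "(\<lambda>s. dirderiv a (D k) (z + s *\<^sub>R a)) = (\<lambda>s. 0)" using t[OF z] by auto
        then show ?thesis by (simp add: dirderiv_def[of a "dirderiv a (D k)"])
      qed
      then have "(\<Sum>a\<in>Basis. dirderiv a (dirderiv a (D k)) z) = dirderiv b (dirderiv b (D k)) z"
        using b by (simp add: sum.remove[of Basis b])
      then show ?thesis using harmD by (simp add: DS)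
    qed
    then show ?case using Suc by blast
  qed
  define z where "z = x - inner x b *\<^sub>R b"
  have z: "inner z b = 0" using b by (simp add: z_def inner_diff_left)
  have "polynomial_function (\<lambda>t::real. z + t *\<^sub>R b)"
    by (intro polynomial_function_add polynomial_function_const polynomial_function_bounded_linear
          bounded_linear_scaleR_left)
  then have "real_polynomial_function (\<lambda>t. h (z + t *\<^sub>R b))"
    using real_polynomial_function_compose[OF _ h, of "\<lambda>t. z + t *\<^sub>R b"] by (simp add: o_def)
  then obtain a n where an: "(\<lambda>t. h (z + t *\<^sub>R b)) = (\<lambda>t. \<Sum>i\<le>n. a i * t ^ i)"
    using real_polynomial_function_iff_sum by blast
  define p where "p = (\<Sum>i\<le>n. monom (a i) i)"
  have p: "h (z + t *\<^sub>R b) = poly p t" for t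
    using fun_cong[OF an, of t] by (simp add: p_def poly_sum poly_monom)
  have Dp: "D k (z + t *\<^sub>R b) = poly ((pderiv ^^ k) p) t" for k t
  proof (induction k arbitrary: t)
    case 0
    then show ?case using p by (simp add: D_def)
  next
    case (Suc k)
    have "((\<lambda>t. D k (z + t *\<^sub>R b)) has_real_derivative D (Suc k) (z + t *\<^sub>R b)) (at t)"
      using has_dirderiv[OF D] unfolding DS[symmetric] by blast
    moreover have "(\<lambda>t. D k (z + t *\<^sub>R b)) = poly ((pderiv ^^ k) p)" using Suc by blast
    ultimately have "(poly ((pderiv ^^ k) p) has_real_derivative D (Suc k) (z + t *\<^sub>R b)) (at t)"
      by simp
    then show ?case using DERIV_unique[OF _ poly_DERIV] by auto
  qed
  have "poly.coeff p k = 0" for k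
  proof -
    have "poly ((pderiv ^^ k) p) 0 = 0" using Dp[of k 0] van[of k] z by simp
    then have "pochhammer 1 k = (0 :: real) \<or> poly.coeff p k = 0"
      by (simp add: poly_0_coeff_0 coeff_higher_pderiv)
    then show ?thesis by (simp add: pochhammer_fact[symmetric])
  qed
  then have "p = 0" by (simp add: poly_eq_iff)
  moreover have "x = z + inner x b *\<^sub>R b" by (simp add: z_def)
  ultimately show ?thesis using p by (metis poly_0)
qed

lemma dirderiv_homogeneous:
  assumes h: "real_polynomial_function h" and hom: "\<And>t x. h (t *\<^sub>R x) = t ^ Suc l * h x" and "s \<noteq> 0"
  shows "dirderiv v h (s *\<^sub>R x) = s ^ l * dirderiv v h x"
proof -
  have "((\<lambda>t. h (s *\<^sub>R x + t *\<^sub>R (s *\<^sub>R v))) has_real_derivative s ^ Suc l * dirderiv v h x) (at 0)"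
  proof -
    have "(\<lambda>t. h (s *\<^sub>R x + t *\<^sub>R (s *\<^sub>R v))) = (\<lambda>t. s ^ Suc l * h (x + t *\<^sub>R v))"
      by (rule ext) (metis hom scaleR_add_right scaleR_left_commute)
    then show ?thesis using DERIV_cmult[OF has_dirderiv_0[OF h]] by simp
  qed
  then have "dirderiv (s *\<^sub>R v) h (s *\<^sub>R x) = s ^ Suc l * dirderiv v h x" by (rule dirderiv_eqI)
  then show ?thesis using \<open>s \<noteq> 0\<close> by (simp add: dirderiv_scale_dir[OF h])
qed

text \<open>A harmonic polynomial is determined by its Cauchy data on a coordinate hyperplane, and homogeneous
  polynomials on that hyperplane by their values on a grid with \<open>(l + 1) ^ (d - 1)\<close> points.\<close>

lemma harmonic_grid_functionals:
  assumes "DIM('a::euclidean_space) = d + 1" "d \<ge> 1"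
  obtains G :: "'a::euclidean_space set" and b :: "'a::euclidean_space" where "finite G" "card G \<le> (l + 2) ^ (d - 1)" "b \<in> Basis"
    "\<And>h x. real_polynomial_function h \<Longrightarrow> (\<And>t x. h (t *\<^sub>R x) = t ^ Suc l * h x) \<Longrightarrow>
       (\<And>x. laplacian h x = 0) \<Longrightarrow> (\<And>z. z \<in> G \<Longrightarrow> h z = 0) \<Longrightarrow> (\<And>z. z \<in> G \<Longrightarrow> dirderiv b h z = 0) \<Longrightarrow>
       h x = 0"
proof -
  have "card (Basis :: 'a set) \<ge> 2" using assms by simp
  then obtain S where "S \<subseteq> (Basis :: 'a set)" "card S = 2" by (rule obtain_subset_with_card_n)
  then obtain b c :: 'a where b: "b \<in> Basis" "c \<in> Basis" "b \<noteq> c" by (auto simp: card_2_iff)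
  define B where "B = (Basis :: 'a set) - {b, c}"
  \<comment> \<open>The degree is \<open>l + 1\<close>, hence \<open>l + 2\<close> grid values per
    direction.\<close>
  define G where "G = (\<lambda>k. c + (\<Sum>a\<in>B. real (k a) *\<^sub>R a)) ` (B \<rightarrow>\<^sub>E {..Suc l})"
  have fin: "finite G" by (auto simp: G_def B_def intro!: finite_PiE)
  have "card G \<le> card (B \<rightarrow>\<^sub>E {..Suc l})"
    unfolding G_def by (intro card_image_le finite_PiE) (auto simp: B_def)
  also have "\<dots> = (l + 2) ^ card B" by (subst card_PiE) (auto simp: B_def)
  also have "card B = d - 1" using b assms by (simp add: B_def card_Diff_subset)
  finally have card: "card G \<le> (l + 2) ^ (d - 1)" .
  show ?thesis
  proof (rule that[OF fin card b(1)])
    fix h :: "'a \<Rightarrow> real" and x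
    assume h: "real_polynomial_function h" and hom: "\<And>t x. h (t *\<^sub>R x) = t ^ Suc l * h x"
      and harm: "\<And>x. laplacian h x = 0" and 0: "\<And>z. z \<in> G \<Longrightarrow> h z = 0"
      and 1: "\<And>z. z \<in> G \<Longrightarrow> dirderiv b h z = 0"
    show "h x = 0"
    proof (rule harmonic_zero_if_cauchy_data_zero[OF h harm b(1)])
      fix z assume z: "inner z b = 0"
      show "h z = 0"
      proof (rule zero_on_hyperplane_grid[OF h _ order_refl b _ z, where l = "Suc l"])
        show "h (t *\<^sub>R x) = t ^ Suc l * h x" for t x by (rule hom)
        show "h (c + (\<Sum>a\<in>Basis - {b, c}. real (k a) *\<^sub>R a)) = 0"
          if "k \<in> Basis - {b, c} \<rightarrow>\<^sub>E {..Suc l}" for k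
          by (rule 0) (use that in \<open>auto simp: G_def B_def\<close>)
      qed
      \<comment> \<open>The derivative is homogeneous of degree \<open>l\<close>, one below the
        degree for which the grid was chosen.\<close>
      show "dirderiv b h z = 0"
        by (rule zero_on_hyperplane_grid[OF real_polynomial_function_dirderiv[OF h]
              dirderiv_homogeneous[OF h hom] _ b _ z, where l' = "Suc l"])
           (use 1 in \<open>auto simp: G_def B_def\<close>)
    qed
  qed
qed

section \<open>Rotation invariance of the surface measure\<close>

lemma orthogonal_transformation_inverse:
  fixes T :: "'a::euclidean_space \<Rightarrow> 'a"
  assumes "orthogonal_transformation T"
  obtains T' where "orthogonal_transformation T'" "\<And>x. T' (T x) = x" "\<And>x. T (T' x) = x"
  using assms orthogonal_transformation_inv orthogonal_transformation_bij
  by (metis bij_inv_eq_iff)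

text \<open>By Vitali's covering theorem \<open>B\<close> is, up to a null set, a disjoint union of balls, and \<open>T\<close> maps balls to
  balls of the same radius.\<close>

lemma emeasure_le_orthogonal_image:
  fixes T :: "'a::euclidean_space \<Rightarrow> 'a"
  assumes T: "orthogonal_transformation T" and B: "open B"
  shows "emeasure lborel B \<le> emeasure lborel (T ` B)"
proof -
  define K where "K = {(a::'a, r). 0 < r \<and> ball a r \<subseteq> B}"
  have cover: "\<exists>i. i \<in> K \<and> x \<in> ball (fst i) (snd i) \<and> snd i < d" if "x \<in> B" "0 < d" for x d
  proof -
    obtain e where "e > 0" "ball x e \<subseteq> B" using B \<open>x \<in> B\<close> openE by blast
    then have "(x, min (d / 2) e) \<in> K" using \<open>0 < d\<close> by (auto simp: K_def)
    then show ?thesis using \<open>0 < d\<close> \<open>e > 0\<close> by (intro exI[of _ "(x, min (d / 2) e)"]) auto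
  qed
  obtain C where C: "countable C" "C \<subseteq> K"
    "pairwise (\<lambda>i j. disjnt (ball (fst i) (snd i)) (ball (fst j) (snd j))) C"
    "negligible (B - (\<Union>i\<in>C. ball (fst i) (snd i)))"
    using Vitali_covering_theorem_balls[of B K fst snd] cover by blast
  define U where "U = (\<Union>i\<in>C. ball (fst i) (snd i))"
  have inj: "inj T" using T orthogonal_transformation_inj by blast
  have img: "T ` ball a r = ball (T a) r" for a r by (rule image_orthogonal_transformation_ball[OF T])
  have "open U" by (auto simp: U_def)
  then have meas: "U \<in> sets lborel" "B - U \<in> sets lborel" using B by auto
  have "emeasure lborel (B - U) = 0"
    using C(4) meas(2) unfolding U_def[symmetric] negligible_iff_null_sets
    by (simp add: null_sets_completion_iff null_setsD1)
  have "U \<subseteq> B"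
    unfolding U_def
  proof (rule UN_least)
    fix i assume "i \<in> C"
    then have "i \<in> K" using C(2) by blast
    then show "ball (fst i) (snd i) \<subseteq> B" by (simp add: K_def split_beta)
  qed
  then have "B = U \<union> (B - U)" by blast
  then have "emeasure lborel B \<le> emeasure lborel U + emeasure lborel (B - U)"
    using emeasure_subadditive[OF meas] by simp
  also have "\<dots> = emeasure lborel U" using \<open>emeasure lborel (B - U) = 0\<close> by simp
  also have "\<dots> = (\<integral>\<^sup>+i. emeasure lborel (ball (fst i) (snd i)) \<partial>count_space C)"
    unfolding U_def using C(1,3)
    by (intro emeasure_UN_countable) (auto simp: disjoint_family_on_def pairwise_def disjnt_def)
  also have "\<dots> = (\<integral>\<^sup>+i. emeasure lborel (T ` ball (fst i) (snd i)) \<partial>count_space C)"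
    using C(2) by (intro nn_integral_cong) (auto simp: img emeasure_ball K_def)
  also have "\<dots> = emeasure lborel (\<Union>i\<in>C. T ` ball (fst i) (snd i))"
  proof (rule emeasure_UN_countable[symmetric])
    show "disjoint_family_on (\<lambda>i. T ` ball (fst i) (snd i)) C"
      using C(3) inj unfolding disjoint_family_on_def pairwise_def disjnt_def
      by (metis image_Int image_empty)
  qed (use C(1) in \<open>auto simp: img\<close>)
  also have "(\<Union>i\<in>C. T ` ball (fst i) (snd i)) = T ` U" by (auto simp: U_def)
  also have "emeasure lborel (T ` U) \<le> emeasure lborel (T ` B)"
  proof (rule emeasure_mono)
    have "open (T ` B)"
      using B T orthogonal_transformation_surj orthogonal_transformation_linear
      by (intro open_surjective_linear_image) auto
    then show "T ` B \<in> sets lborel" by simp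
  qed (use \<open>U \<subseteq> B\<close> in auto)
  finally show ?thesis .
qed

text \<open>The inequality for open sets, applied to \<open>T\<close> and to its inverse, gives
  equality on boxes, and these determine Lebesgue measure.\<close>

lemma lborel_distr_orthogonal:
  fixes T :: "'a::euclidean_space \<Rightarrow> 'a"
  assumes T: "orthogonal_transformation T"
  shows "distr lborel borel T = lborel"
proof (rule lborel_eqI[symmetric])
  obtain T' where T': "orthogonal_transformation T'" "\<And>x. T' (T x) = x" "\<And>x. T (T' x) = x"
    using orthogonal_transformation_inverse[OF T] by blast
  have cont: "continuous_on UNIV T"
    using T by (intro linear_continuous_on) (simp add: orthogonal_transformation_linear linear_conv_bounded_linear[symmetric])
  have Tm: "T \<in> borel_measurable lborel"
    using borel_measurable_continuous_onI[OF cont] by simp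
  fix l u :: 'a assume lu: "\<And>b. b \<in> Basis \<Longrightarrow> inner l b \<le> inner u b"
  have vim: "T -` box l u = T' ` box l u" using T'(2,3) by (auto simp: image_iff) (metis)
  have "open (T' ` box l u)"
    using T'(1) orthogonal_transformation_surj orthogonal_transformation_linear
    by (intro open_surjective_linear_image) auto
  have "emeasure lborel (T' ` box l u) \<le> emeasure lborel (T ` T' ` box l u)"
    by (rule emeasure_le_orthogonal_image[OF T]) fact
  also have "T ` T' ` box l u = box l u" using T'(3) by (simp add: image_image)
  finally have "emeasure lborel (T' ` box l u) = emeasure lborel (box l u)"
    using emeasure_le_orthogonal_image[OF T'(1), of "box l u"] by (simp add: open_box)
  then show "emeasure (distr lborel borel T) (box l u) = ennreal (prod (inner (u - l)) Basis)"
    using lu Tm by (simp add: emeasure_distr vim)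
qed simp

section \<open>The surface measure as a cone measure\<close>

lemma sgn_measurable_sphere:
  "sgn \<in> measurable (restrict_space lborel (cball 0 1 - {0})) (restrict_space borel (sphere 0 (1::real) :: 'a::euclidean_space set))"
proof (rule measurable_restrict_space2)
  show "sgn \<in> space (restrict_space lborel (cball 0 1 - {0})) \<rightarrow> (sphere 0 1 :: 'a set)"
    by (auto simp: space_restrict_space norm_sgn)
  have "(\<lambda>x::'a. x /\<^sub>R norm x) \<in> borel_measurable lborel" by measurable
  then have "(sgn :: 'a \<Rightarrow> 'a) \<in> borel_measurable lborel" by (simp add: sgn_div_norm[abs_def])
  then show "(sgn :: 'a \<Rightarrow> 'a) \<in> borel_measurable (restrict_space lborel (cball 0 1 - {0}))"
    by (rule measurable_restrict_space1)
qed

lemma sets_surface_measure: "sets (surface_measure :: 'a::euclidean_space measure) = sets (restrict_space borel (sphere 0 1))"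
  by (simp add: surface_measure_def sets_scale_measure)

lemma space_surface_measure [simp]: "space (surface_measure :: 'a::euclidean_space measure) = sphere 0 1"
  by (simp add: surface_measure_def space_scale_measure space_restrict_space)

lemma emeasure_surface_measure:
  assumes A: "A \<in> sets (surface_measure :: 'a::euclidean_space measure)"
  shows "emeasure surface_measure A = ennreal (real DIM('a)) * emeasure lborel {z \<in> cball 0 1 - {0}. sgn z \<in> A}"
proof -
  let ?R = "restrict_space lborel (cball 0 1 - {0 :: 'a})"
  have "emeasure (distr ?R (restrict_space borel (sphere 0 1)) sgn) A = emeasure ?R (sgn -` A \<inter> space ?R)"
    using A by (intro emeasure_distr[OF sgn_measurable_sphere]) (simp add: sets_surface_measure)
  also have "sgn -` A \<inter> space ?R = {z \<in> cball 0 1 - {0}. sgn z \<in> A}" by (auto simp: space_restrict_space)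
  also have "emeasure ?R \<dots> = emeasure lborel {z \<in> cball 0 1 - {0}. sgn z \<in> A}"
    by (intro emeasure_restrict_space) auto
  finally show ?thesis by (simp add: surface_measure_def)
qed

lemma finite_measure_surface: "finite_measure (surface_measure :: 'a::euclidean_space measure)"
proof
  have "emeasure lborel {z \<in> cball 0 1 - {0 :: 'a}. sgn z \<in> sphere 0 1} \<le> emeasure lborel (cball 0 1 :: 'a set)"
    by (rule emeasure_mono) auto
  also have "\<dots> < \<infinity>" by (simp add: emeasure_cball)
  finally show "emeasure (surface_measure :: 'a measure) (space surface_measure) \<noteq> \<infinity>"
    using sets.top[of "surface_measure :: 'a measure"]
    by (subst emeasure_surface_measure) (auto simp: ennreal_mult_eq_top_iff)
qed

interpretation surface: finite_measure "surface_measure :: 'a::euclidean_space measure"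
  by (rule finite_measure_surface)

text \<open>\<open>sgn\<close> commutes with \<open>T\<close>, so the cone over a preimage is the
  preimage of the cone, and invariance is inherited from Lebesgue measure.\<close>

lemma surface_measure_orthogonal:
  fixes T :: "'a::euclidean_space \<Rightarrow> 'a"
  assumes T: "orthogonal_transformation T"
  shows "T \<in> measurable surface_measure surface_measure" "distr surface_measure surface_measure T = surface_measure"
proof -
  have lin: "linear T" using T by (rule orthogonal_transformation_linear)
  have nT: "norm (T z) = norm z" for z using T by (rule orthogonal_transformation_norm)
  have Tm: "T \<in> borel_measurable borel"
    using lin by (intro borel_measurable_continuous_onI linear_continuous_on)
      (simp add: linear_conv_bounded_linear[symmetric])
  show M: "T \<in> measurable surface_measure surface_measure"
  proof -
    have "T \<in> measurable (restrict_space borel (sphere 0 1)) (restrict_space borel (sphere 0 1))"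
      by (rule measurable_restrict_space2)
        (auto simp: space_restrict_space nT intro: measurable_restrict_space1 Tm)
    then show ?thesis by (simp cong: measurable_cong_sets add: sets_surface_measure)
  qed
  show "distr surface_measure surface_measure T = surface_measure"
  proof (rule measure_eqI)
    fix A assume "A \<in> sets (distr surface_measure surface_measure T)"
    then have A: "A \<in> sets surface_measure" by simp
    let ?C = "{z \<in> cball 0 1 - {0}. sgn z \<in> A}"
    have meas: "?C \<in> sets borel"
    proof -
      have "?C = sgn -` A \<inter> (cball 0 1 - {0})" by auto
      moreover have "sgn -` A \<inter> space (restrict_space lborel (cball 0 1 - {0})) \<in> sets (restrict_space lborel (cball 0 1 - {0}))"
        using A by (intro measurable_sets[OF sgn_measurable_sphere]) (simp add: sets_surface_measure)
      ultimately show ?thesis by (simp add: sets_restrict_space_iff space_restrict_space)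
    qed
    have A': "T -` A \<inter> sphere 0 1 \<in> sets surface_measure" using measurable_sets[OF M A] by simp
    have "T (sgn z) = sgn (T z)" for z using nT lin by (simp add: sgn_div_norm linear_scale)
    then have eq: "{z \<in> cball 0 1 - {0}. sgn z \<in> T -` A \<inter> sphere 0 1} = T -` ?C"
    proof -
      have "T z = 0 \<longleftrightarrow> z = 0" for z by (metis nT norm_eq_zero)
      then show ?thesis using \<open>\<And>z. T (sgn z) = sgn (T z)\<close> by (auto simp: norm_sgn nT)
    qed
    have "emeasure (distr surface_measure surface_measure T) A = emeasure surface_measure (T -` A \<inter> sphere 0 1)"
      using emeasure_distr[OF M A] by simp
    also have "\<dots> = ennreal (real DIM('a)) * emeasure lborel (T -` ?C)"
      unfolding emeasure_surface_measure[OF A'] eq ..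
    also have "emeasure lborel (T -` ?C) = emeasure (distr lborel borel T) ?C"
      using Tm meas by (simp add: emeasure_distr)
    also have "ennreal (real DIM('a)) * \<dots> = emeasure surface_measure A"
      unfolding lborel_distr_orthogonal[OF T] emeasure_surface_measure[OF A] ..
    finally show "emeasure (distr surface_measure surface_measure T) A = emeasure surface_measure A" .
  qed simp
qed

lemma borel_measurable_surface:
  fixes f :: "'a::euclidean_space \<Rightarrow> real"
  assumes "continuous_on (sphere 0 1) f"
  shows "f \<in> borel_measurable surface_measure"
  using borel_measurable_continuous_on_restrict[OF assms]
  by (simp cong: measurable_cong_sets add: sets_surface_measure)

lemma integrable_surface:
  fixes f :: "'a::euclidean_space \<Rightarrow> real"
  assumes "continuous_on (sphere 0 1) f"
  shows "integrable surface_measure f"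
proof -
  have "bounded (f ` sphere 0 1)"
    by (intro compact_imp_bounded compact_continuous_image assms compact_sphere)
  then obtain B where "\<forall>y\<in>f ` sphere 0 1. norm y \<le> B" unfolding bounded_iff by blast
  then show ?thesis
    by (intro surface.integrable_const_bound[of _ B] borel_measurable_surface assms AE_I2) auto
qed

lemma sphere_inner_orthogonal:
  fixes T :: "'a::euclidean_space \<Rightarrow> 'a"
  assumes T: "orthogonal_transformation T" and "continuous_on (sphere 0 1) f" "continuous_on (sphere 0 1) g"
  shows "sphere_inner (\<lambda>x. f (T x)) (\<lambda>x. g (T x)) = sphere_inner f g"
proof -
  have "(LINT x|distr surface_measure surface_measure T. f x * g x) = (LINT x|surface_measure. f (T x) * g (T x))"
    by (rule integral_distr[OF surface_measure_orthogonal(1)[OF T]])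
      (intro borel_measurable_surface continuous_intros assms)
  then show ?thesis by (simp add: sphere_inner_def surface_measure_orthogonal(2)[OF T])
qed

text \<open>For \<open>x \<noteq> y\<close> this is the Householder reflection along
  \<open>w = x - y\<close>; equal norms give \<open>2 * inner x w = inner w w\<close>, so that
  \<open>x\<close> is sent to \<open>x - w\<close>.\<close>

lemma orthogonal_reflection:
  fixes x y :: "'a::euclidean_space"
  assumes "norm x = 1" "norm y = 1"
  obtains T where "orthogonal_transformation T" "T x = y"
proof (cases "x = y")
  case True
  then show ?thesis using that[of "\<lambda>x. x"] by (simp add: orthogonal_transformation_id)
next
  case False
  define w where "w = x - y"
  define T where "T z = z - (2 * inner z w / inner w w) *\<^sub>R w" for z
  have ww: "inner w w \<noteq> 0" using False by (simp add: w_def)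
  have xy: "inner x x = 1" "inner y y = 1" using assms by (simp_all add: dot_square_norm)
  have "linear T"
    by (rule linearI) (simp_all add: T_def inner_add_left algebra_simps add_divide_distrib)
  moreover have "inner (T v) (T z) = inner v z" for v z
    using ww inner_commute[of w v] inner_commute[of w z]
    by (simp add: T_def inner_diff_left inner_diff_right field_simps)
  ultimately have "orthogonal_transformation T" by (simp add: orthogonal_transformation_def)
  moreover have "T x = y"
  proof -
    have "2 * inner x w = inner w w" using xy by (simp add: w_def inner_diff_left inner_diff_right inner_commute)
    then show ?thesis using ww by (simp add: T_def w_def)
  qed
  ultimately show ?thesis using that by blast
qed

section \<open>The reproducing kernel of the spherical harmonics\<close>

lemma laplacian_scale_add:
  assumes "real_polynomial_function f" "real_polynomial_function g"
  shows "laplacian (\<lambda>x. c * f x + g x) x = c * laplacian f x + laplacian g x"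
proof -
  have P: "real_polynomial_function (\<lambda>x. c * f x)" if "real_polynomial_function f" for f :: "'a \<Rightarrow> real"
    using that by (rule real_polynomial_function.intros(4)[OF real_polynomial_function.intros(2)])
  have D: "dirderiv b (\<lambda>x. c * f x + g x) = (\<lambda>x. c * dirderiv b f x + dirderiv b g x)"
    if "real_polynomial_function f" "real_polynomial_function g" for b and f g :: "'a \<Rightarrow> real"
    using that P by (simp add: dirderiv_add dirderiv_mult dirderiv_const real_polynomial_function.intros)
  have "real_polynomial_function (\<lambda>x. c * f x + g x)"
    using assms P by (intro real_polynomial_function.intros(3))
  then show ?thesis
    using assms by (simp add: laplacian_dirderiv D real_polynomial_function_dirderiv sum.distrib sum_distrib_left)
qed

lemma spherical_harmonics_add:
  assumes "f \<in> spherical_harmonics l" "g \<in> spherical_harmonics l"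
  shows "(\<lambda>x. c * f x + g x) \<in> spherical_harmonics l"
proof -
  obtain h where h: "real_polynomial_function h" "\<And>t x. h (t *\<^sub>R x) = t ^ l * h x" "\<And>x. laplacian h x = 0"
    "\<And>x. x \<in> sphere 0 1 \<Longrightarrow> f x = h x" using assms(1) unfolding spherical_harmonics_def by blast
  obtain k where k: "real_polynomial_function k" "\<And>t x. k (t *\<^sub>R x) = t ^ l * k x" "\<And>x. laplacian k x = 0"
    "\<And>x. x \<in> sphere 0 1 \<Longrightarrow> g x = k x" using assms(2) unfolding spherical_harmonics_def by blast
  show ?thesis unfolding spherical_harmonics_def
  proof (intro CollectI exI[of _ "\<lambda>x. c * h x + k x"] conjI allI ballI)
    show "real_polynomial_function (\<lambda>x. c * h x + k x)"
      using h k by (intro real_polynomial_function.intros(3) real_polynomial_function.intros(4) real_polynomial_function.intros(2))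
    show "c * h (t *\<^sub>R x) + k (t *\<^sub>R x) = t ^ l * (c * h x + k x)" for t x
      using h k by (simp add: algebra_simps)
  qed (use h k in \<open>auto simp: laplacian_scale_add\<close>)
qed

lemma zero_spherical_harmonics: "(\<lambda>x. 0) \<in> spherical_harmonics l"
  unfolding spherical_harmonics_def
  by (intro CollectI exI[of _ "\<lambda>x. 0"]) (auto simp: real_polynomial_function.intros laplacian_def numeral_2_eq_2)

lemma spherical_harmonics_sum:
  "finite I \<Longrightarrow> (\<And>i. i \<in> I \<Longrightarrow> f i \<in> spherical_harmonics l) \<Longrightarrow>
    (\<lambda>x. \<Sum>i\<in>I. a i * f i x) \<in> spherical_harmonics l"
  by (induction I rule: finite_induct) (simp_all add: zero_spherical_harmonics spherical_harmonics_add)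

lemma spherical_harmonics_compose:
  fixes T :: "'a::euclidean_space \<Rightarrow> 'a"
  assumes f: "f \<in> spherical_harmonics l" and T: "orthogonal_transformation T"
  shows "(\<lambda>x. f (T x)) \<in> spherical_harmonics l"
proof -
  obtain h where h: "real_polynomial_function h" "\<And>t x. h (t *\<^sub>R x) = t ^ l * h x" "\<And>x. laplacian h x = 0"
    "\<And>x. x \<in> sphere 0 1 \<Longrightarrow> f x = h x" using f unfolding spherical_harmonics_def by blast
  have lin: "linear T" using T by (rule orthogonal_transformation_linear)
  then have "polynomial_function T"
    using linear_conv_bounded_linear polynomial_function_bounded_linear by blast
  then have "real_polynomial_function (\<lambda>x. h (T x))"
    using real_polynomial_function_compose[OF _ h(1)] by (simp add: o_def)
  then show ?thesis unfolding spherical_harmonics_def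
    using h lin T
    by (intro CollectI exI[of _ "\<lambda>x. h (T x)"])
       (auto simp: laplacian_compose_orthogonal linear_scale orthogonal_transformation_norm)
qed

lemma spherical_harmonics_continuous:
  fixes f :: "'a::euclidean_space \<Rightarrow> real"
  assumes "f \<in> spherical_harmonics l"
  shows "continuous_on (sphere 0 1) f"
proof -
  obtain h where h: "real_polynomial_function h" "\<And>x. x \<in> sphere 0 1 \<Longrightarrow> f x = h x"
    using assms unfolding spherical_harmonics_def by blast
  have "continuous_on (sphere 0 1) h"
    using h(1) by (intro continuous_on_polymonial_function) (simp add: real_polynomial_function_eq)
  then show ?thesis using h(2) by (metis continuous_on_cong)
qed

lemma sphere_inner_cong:
  assumes "\<And>x. x \<in> sphere 0 1 \<Longrightarrow> f x = f' x" "\<And>x. x \<in> sphere 0 1 \<Longrightarrow> g x = g' x"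
  shows "sphere_inner f g = sphere_inner f' g'"
  unfolding sphere_inner_def using assms by (intro Bochner_Integration.integral_cong) auto

lemma sphere_inner_sum_left:
  assumes "\<And>i. i \<in> I \<Longrightarrow> continuous_on (sphere 0 1) (f i)" "continuous_on (sphere 0 1) g"
  shows "sphere_inner (\<lambda>x. \<Sum>i\<in>I. a i * f i x) g = (\<Sum>i\<in>I. a i * sphere_inner (f i) g)"
proof -
  have "sphere_inner (\<lambda>x. \<Sum>i\<in>I. a i * f i x) g = (LINT x|surface_measure. (\<Sum>i\<in>I. a i * (f i x * g x)))"
    by (simp add: sphere_inner_def sum_distrib_right mult.assoc)
  also have "\<dots> = (\<Sum>i\<in>I. LINT x|surface_measure. a i * (f i x * g x))"
    using assms by (intro Bochner_Integration.integral_sum integrable_surface continuous_intros)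
  finally show ?thesis by (simp add: sphere_inner_def)
qed

lemma sphere_inner_commute: "sphere_inner f g = sphere_inner g f"
  by (simp add: sphere_inner_def mult.commute)

section \<open>Size and number of the harmonics of one degree\<close>

locale harmonics =
  fixes n :: "nat \<Rightarrow> nat" and Y :: "nat \<Rightarrow> nat \<Rightarrow> 'a::euclidean_space \<Rightarrow> real" and d :: nat
  assumes basis: "harmonic_basis n Y" and dim: "DIM('a) = d + 1" and d: "d \<ge> 1"
begin

lemma Y: "\<mu> \<in> {1..n l} \<Longrightarrow> Y l \<mu> \<in> spherical_harmonics l"
  using basis by (simp add: harmonic_basis_def)

lemma Y_continuous: "\<mu> \<in> {1..n l} \<Longrightarrow> continuous_on (sphere 0 1) (Y l \<mu>)"
  using Y spherical_harmonics_continuous by blast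

lemma Y_inner: "\<mu> \<in> {1..n l} \<Longrightarrow> \<mu>' \<in> {1..n l'} \<Longrightarrow>
    sphere_inner (Y l \<mu>) (Y l' \<mu>') = (if l = l' \<and> \<mu> = \<mu>' then 1 else 0)"
  using basis by (simp add: harmonic_basis_def)

lemma Y_span:
  assumes "f \<in> spherical_harmonics l"
  obtains a where "\<And>x. x \<in> sphere 0 1 \<Longrightarrow> f x = (\<Sum>\<mu>=1..n l. a \<mu> * Y l \<mu> x)"
  using basis assms unfolding harmonic_basis_def by metis

lemma sphere_inner_Y_sum:
  assumes "\<nu> \<in> {1..n l}"
  shows "sphere_inner (\<lambda>x. \<Sum>\<mu>=1..n l. a \<mu> * Y l \<mu> x) (Y l \<nu>) = a \<nu>"
proof -
  have "sphere_inner (\<lambda>x. \<Sum>\<mu>=1..n l. a \<mu> * Y l \<mu> x) (Y l \<nu>) = (\<Sum>\<mu>=1..n l. a \<mu> * sphere_inner (Y l \<mu>) (Y l \<nu>))"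
    using assms by (intro sphere_inner_sum_left Y_continuous)
  also have "\<dots> = (\<Sum>\<mu>=1..n l. if \<mu> = \<nu> then a \<nu> else 0)"
    using assms by (intro sum.cong) (auto simp: Y_inner)
  finally show ?thesis using assms by simp
qed

lemma Y_sum_continuous: "continuous_on (sphere 0 1) (\<lambda>x. \<Sum>\<mu>=1..n l. a \<mu> * Y l \<mu> x)"
  by (intro continuous_intros Y_continuous)

lemma parseval: "sphere_inner (\<lambda>x. \<Sum>\<mu>=1..n l. a \<mu> * Y l \<mu> x) (\<lambda>x. \<Sum>\<mu>=1..n l. a \<mu> * Y l \<mu> x) = (\<Sum>\<mu>=1..n l. (a \<mu>)\<^sup>2)"
proof -
  have "sphere_inner (\<lambda>x. \<Sum>\<mu>=1..n l. a \<mu> * Y l \<mu> x) (\<lambda>x. \<Sum>\<mu>=1..n l. a \<mu> * Y l \<mu> x)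
      = (\<Sum>\<mu>=1..n l. a \<mu> * sphere_inner (Y l \<mu>) (\<lambda>x. \<Sum>\<mu>=1..n l. a \<mu> * Y l \<mu> x))"
    by (intro sphere_inner_sum_left Y_continuous Y_sum_continuous)
  also have "\<dots> = (\<Sum>\<mu>=1..n l. a \<mu> * a \<mu>)"
    by (intro sum.cong refl arg_cong[of _ _ "(*) _"]) (subst sphere_inner_commute, rule sphere_inner_Y_sum)
  finally show ?thesis by (simp add: power2_eq_square)
qed

definition christoffel :: "nat \<Rightarrow> 'a \<Rightarrow> real" where
  "christoffel l x = (\<Sum>\<mu>=1..n l. (Y l \<mu> x)\<^sup>2)"

text \<open>\<open>christoffel l x\<close> is the maximum of \<open>h x ^ 2\<close> over the harmonics \<open>h\<close> of degree \<open>l\<close> and norm 1, and this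
  maximum is invariant under rotations.\<close>

lemma christoffel_le:
  assumes T: "orthogonal_transformation T" and x: "x \<in> sphere 0 1"
  shows "christoffel l (T x) \<le> christoffel l x"
proof -
  define A where "A = christoffel l (T x)"
  have nT: "T z \<in> sphere 0 1" if "z \<in> sphere 0 1" for z
    using that orthogonal_transformation_norm[OF T] by simp
  \<comment> \<open>The reproducing kernel with one argument fixed at \<open>T x\<close>: its value
    at \<open>T x\<close> and its squared norm are both \<open>A\<close>. Rotation keeps the norm,
    so Cauchy-Schwarz at \<open>x\<close> yields
    \<open>A * A \<le> A * christoffel l x\<close>.\<close>
  define h where "h = (\<lambda>z. \<Sum>\<mu>=1..n l. Y l \<mu> (T x) * Y l \<mu> z)"
  have h: "h \<in> spherical_harmonics l" unfolding h_def by (intro spherical_harmonics_sum Y) auto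
  obtain a where a: "\<And>z. z \<in> sphere 0 1 \<Longrightarrow> h (T z) = (\<Sum>\<mu>=1..n l. a \<mu> * Y l \<mu> z)"
    using Y_span[OF spherical_harmonics_compose[OF h T]] by blast
  have "(\<Sum>\<mu>=1..n l. (a \<mu>)\<^sup>2) = sphere_inner (\<lambda>z. h (T z)) (\<lambda>z. h (T z))"
    unfolding parseval[symmetric] by (rule sphere_inner_cong) (simp_all add: a)
  also have "\<dots> = sphere_inner h h"
    using h spherical_harmonics_continuous by (intro sphere_inner_orthogonal T) auto
  also have "\<dots> = A" unfolding h_def parseval by (simp add: A_def christoffel_def)
  finally have a2: "(\<Sum>\<mu>=1..n l. (a \<mu>)\<^sup>2) = A" .
  have "A = h (T x)" by (simp add: A_def h_def christoffel_def power2_eq_square)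
  also have "\<dots> = (\<Sum>\<mu>=1..n l. a \<mu> * Y l \<mu> x)" using a x by blast
  finally have "A\<^sup>2 \<le> (\<Sum>\<mu>=1..n l. (a \<mu>)\<^sup>2) * (\<Sum>\<mu>=1..n l. (Y l \<mu> x)\<^sup>2)"
    using Cauchy_Schwarz_ineq_sum[of a "\<lambda>\<mu>. Y l \<mu> x" "{1..n l}"] by simp
  then have le: "A * A \<le> A * christoffel l x" unfolding a2 by (simp add: christoffel_def power2_eq_square)
  have "A \<ge> 0" "christoffel l x \<ge> 0" by (auto simp: A_def christoffel_def intro!: sum_nonneg)
  then show ?thesis using le unfolding A_def[symmetric] by (cases "A = 0") auto
qed

lemma christoffel_const:
  assumes "x \<in> sphere 0 1" "y \<in> sphere 0 1"
  shows "christoffel l x = christoffel l y"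
proof -
  have "christoffel l y \<le> christoffel l x" if "x \<in> sphere 0 1" "y \<in> sphere 0 1" for x y
  proof -
    have "norm x = 1" "norm y = 1" using that by auto
    then obtain T where "orthogonal_transformation T" "T x = y" by (rule orthogonal_reflection)
    then show ?thesis using christoffel_le that by blast
  qed
  then show ?thesis using assms by (intro antisym) auto
qed

text \<open>The addition theorem on the diagonal: a constant is determined by its integral, to which
  every member of the basis contributes 1.\<close>

lemma christoffel_integral:
  assumes "x \<in> sphere 0 1"
  shows "christoffel l x * measure surface_measure (sphere 0 1 :: 'a set) = real (n l)"
proof -
  have "(LINT y::'a|surface_measure. christoffel l y) = (LINT y::'a|surface_measure. christoffel l x)"
    by (intro Bochner_Integration.integral_cong refl christoffel_const) (use assms in auto)
  then have "christoffel l x * measure surface_measure (sphere 0 1 :: 'a set) = (LINT y::'a|surface_measure. christoffel l y)"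
    by (simp add: mult.commute)
  also have "\<dots> = (\<Sum>\<mu>=1..n l. LINT y|surface_measure. (Y l \<mu> y)\<^sup>2)"
    unfolding christoffel_def
    by (intro Bochner_Integration.integral_sum integrable_surface continuous_intros Y_continuous)
  also have "\<dots> = (\<Sum>\<mu>=1..n l. sphere_inner (Y l \<mu>) (Y l \<mu>))"
    by (simp add: sphere_inner_def power2_eq_square)
  also have "\<dots> = real (n l)" by (simp add: Y_inner)
  finally show ?thesis .
qed

text \<open>At most \<open>2 * (l + 2) ^ (d - 1)\<close> functionals, values and derivatives along
  \<open>b\<close> on the grid, determine a harmonic of degree \<open>l + 1\<close>. With more basis
  elements, a nontrivial combination would be killed by all of them and hence vanish, against
  orthonormality.\<close>

lemma n_le: "n (Suc l) \<le> 2 * (l + 2) ^ (d - 1)"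
proof (rule ccontr)
  assume big: "\<not> ?thesis"
  let ?n = "n (Suc l)"
  obtain G :: "'a set" and b :: 'a where G: "finite G" "card G \<le> (l + 2) ^ (d - 1)"
    and zero: "\<And>h x. real_polynomial_function h \<Longrightarrow> (\<And>t x. h (t *\<^sub>R x) = t ^ Suc l * h x) \<Longrightarrow>
       (\<And>x. laplacian h x = 0) \<Longrightarrow> (\<And>z. z \<in> G \<Longrightarrow> h z = 0) \<Longrightarrow> (\<And>z. z \<in> G \<Longrightarrow> dirderiv b h z = 0) \<Longrightarrow>
       h x = 0"
    using harmonic_grid_functionals[OF dim d, of l] by metis
  obtain e where e: "bij_betw e {0..<card G} G" using ex_bij_betw_nat_finite[OF G(1)] by blast
  \<comment> \<open>The basis is known only on the sphere and the grid points need not lie there, so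
    the functionals are evaluated on homogeneous polynomial extensions.\<close>
  have "\<exists>h. \<forall>\<mu>\<in>{1..?n}. real_polynomial_function (h \<mu>) \<and> (\<forall>t x. h \<mu> (t *\<^sub>R x) = t ^ Suc l * h \<mu> x) \<and>
      (\<forall>x. laplacian (h \<mu>) x = 0) \<and> (\<forall>x\<in>sphere 0 1. Y (Suc l) \<mu> x = h \<mu> x)"
    using Y[of _ "Suc l"] unfolding spherical_harmonics_def by (intro bchoice) blast
  then obtain H where H: "\<And>\<mu>. \<mu> \<in> {1..?n} \<Longrightarrow> real_polynomial_function (H \<mu>)"
    "\<And>\<mu> t x. \<mu> \<in> {1..?n} \<Longrightarrow> H \<mu> (t *\<^sub>R x) = t ^ Suc l * H \<mu> x"
    "\<And>\<mu> x. \<mu> \<in> {1..?n} \<Longrightarrow> laplacian (H \<mu>) x = 0"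
    "\<And>\<mu> x. \<mu> \<in> {1..?n} \<Longrightarrow> x \<in> sphere 0 1 \<Longrightarrow> Y (Suc l) \<mu> x = H \<mu> x" by blast
  define A where "A = mat (2 * card G) ?n (\<lambda>(i, j). if i < card G then H (Suc j) (e i) else dirderiv b (H (Suc j)) (e (i - card G)))"
  have A: "A \<in> carrier_mat (2 * card G) ?n" by (simp add: A_def)
  have "2 * card G < ?n" using big G(2) by linarith
  then obtain v where v: "v \<in> carrier_vec ?n" "v \<noteq> 0\<^sub>v ?n" "A *\<^sub>v v = 0\<^sub>v (2 * card G)"
    using underdetermined_solution[OF A] by blast
  define w where "w \<mu> = v $ (\<mu> - 1)" for \<mu>
  have row: "(\<Sum>\<mu>=1..?n. w \<mu> * (if i < card G then H \<mu> (e i) else dirderiv b (H \<mu>) (e (i - card G)))) = 0"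
    if i: "i < 2 * card G" for i
  proof -
    have "(A *\<^sub>v v) $ i = 0" using v(3) i by simp
    then have "(\<Sum>j<?n. A $$ (i, j) * v $ j) = 0"
      using i v(1) A by (simp add: scalar_prod_def atLeast0LessThan)
    also have "(\<Sum>j<?n. A $$ (i, j) * v $ j) = (\<Sum>j<?n. w (Suc j) * (if i < card G then H (Suc j) (e i) else dirderiv b (H (Suc j)) (e (i - card G))))"
      using i by (intro sum.cong) (auto simp: A_def w_def)
    also have "\<dots> = (\<Sum>\<mu>=1..?n. w \<mu> * (if i < card G then H \<mu> (e i) else dirderiv b (H \<mu>) (e (i - card G))))"
      by (rule sum.reindex_bij_witness[of _ "\<lambda>\<mu>. \<mu> - 1" Suc]) auto
    finally show ?thesis .
  qed
  define h where "h x = (\<Sum>\<mu>=1..?n. w \<mu> * H \<mu> x)" for x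
  have P: "real_polynomial_function (\<lambda>x. w \<mu> * H \<mu> x)" if "\<mu> \<in> {1..?n}" for \<mu>
    using H(1)[OF that] by (rule real_polynomial_function.intros(4)[OF real_polynomial_function.intros(2)])
  have hp: "real_polynomial_function h"
    unfolding h_def by (intro real_polynomial_function_sum P) auto
  have dh: "dirderiv a h z = (\<Sum>\<mu>=1..?n. w \<mu> * dirderiv a (H \<mu>) z)" for a z
  proof -
    have "dirderiv a h z = (\<Sum>\<mu>=1..?n. dirderiv a (\<lambda>x. w \<mu> * H \<mu> x) z)"
      unfolding h_def by (subst dirderiv_sum) (use P in auto)
    also have "\<dots> = (\<Sum>\<mu>=1..?n. w \<mu> * dirderiv a (H \<mu>) z)"
      using H(1) by (intro sum.cong) (auto simp: dirderiv_mult dirderiv_const real_polynomial_function.intros(2))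
    finally show ?thesis .
  qed
  have "h x = 0" for x
  proof (rule zero[OF hp])
    show "h (t *\<^sub>R x) = t ^ Suc l * h x" for t x
      unfolding h_def sum_distrib_left by (intro sum.cong refl) (simp add: H(2) mult.left_commute)
    show "laplacian h x = 0" for x
    proof -
      have "dirderiv a (dirderiv a h) x = (\<Sum>\<mu>=1..?n. w \<mu> * dirderiv a (dirderiv a (H \<mu>)) x)" for a
      proof -
        have Q: "real_polynomial_function (\<lambda>x. w \<mu> * dirderiv a (H \<mu>) x)" if "\<mu> \<in> {1..?n}" for \<mu>
          using real_polynomial_function_dirderiv[OF H(1)[OF that]]
          by (rule real_polynomial_function.intros(4)[OF real_polynomial_function.intros(2)])
        have "dirderiv a (dirderiv a h) x = (\<Sum>\<mu>=1..?n. dirderiv a (\<lambda>x. w \<mu> * dirderiv a (H \<mu>) x) x)"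
          unfolding dh by (subst dirderiv_sum) (use Q in auto)
        also have "\<dots> = (\<Sum>\<mu>=1..?n. w \<mu> * dirderiv a (dirderiv a (H \<mu>)) x)"
          using real_polynomial_function_dirderiv[OF H(1)]
          by (intro sum.cong) (auto simp: dirderiv_mult dirderiv_const real_polynomial_function.intros(2))
        finally show ?thesis .
      qed
      then have "laplacian h x = (\<Sum>a\<in>Basis. \<Sum>\<mu>=1..?n. w \<mu> * dirderiv a (dirderiv a (H \<mu>)) x)"
        by (simp add: laplacian_dirderiv[OF hp])
      also have "\<dots> = (\<Sum>\<mu>=1..?n. w \<mu> * laplacian (H \<mu>) x)"
        by (subst sum.swap, intro sum.cong refl) (simp add: laplacian_dirderiv[OF H(1)] sum_distrib_left)
      also have "\<dots> = 0" by (intro sum.neutral ballI) (simp add: H(3))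
      finally show ?thesis .
    qed
    fix z assume "z \<in> G"
    then have "z \<in> e ` {0..<card G}" using e by (simp add: bij_betw_def)
    then obtain i where i: "i < card G" "z = e i" by auto
    show "h z = 0" using row[of i] i by (simp add: h_def)
    show "dirderiv b h z = 0" using row[of "i + card G"] i by (simp add: dh)
  qed
  then have "(\<Sum>\<mu>=1..?n. w \<mu> * Y (Suc l) \<mu> x) = 0" if "x \<in> sphere 0 1" for x
    using H(4)[OF _ that] by (simp add: h_def)
  then have w0: "w \<mu> = 0" if "\<mu> \<in> {1..?n}" for \<mu>
  proof -
    have "w \<mu> = sphere_inner (\<lambda>x. \<Sum>\<mu>=1..?n. w \<mu> * Y (Suc l) \<mu> x) (Y (Suc l) \<mu>)"
      by (rule sphere_inner_Y_sum[OF that, symmetric])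
    also have "\<dots> = sphere_inner (\<lambda>x. 0) (Y (Suc l) \<mu>)"
      using \<open>\<And>x. x \<in> sphere 0 1 \<Longrightarrow> _ = 0\<close> by (intro sphere_inner_cong) auto
    finally show ?thesis by (simp add: sphere_inner_def)
  qed
  have "v $ j = 0" if "j < ?n" for j using w0[of "Suc j"] that by (simp add: w_def)
  then have "v = 0\<^sub>v ?n" using v(1) by (intro eq_vecI) auto
  then show False using v(2) by blast
qed

text \<open>Serves to show that the sphere has positive measure: \<open>christoffel 0 x\<close>
  times that measure is \<open>n 0\<close>. The witness is the constant harmonic.\<close>

lemma n_0_pos: "n 0 \<ge> 1"
proof (rule ccontr)
  assume "\<not> ?thesis"
  then have n0: "n 0 = 0" by simp
  have "(\<lambda>x::'a. 1) \<in> spherical_harmonics 0"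
    unfolding spherical_harmonics_def
    by (intro CollectI exI[of _ "\<lambda>x. 1"]) (auto simp: real_polynomial_function.intros(2) laplacian_def numeral_2_eq_2)
  then obtain a where "\<And>x::'a. x \<in> sphere 0 1 \<Longrightarrow> 1 = (\<Sum>\<mu>=1..n 0. a \<mu> * Y 0 \<mu> x)"
    using Y_span by blast
  moreover obtain x :: 'a where "x \<in> sphere 0 1" using vector_choose_size[of 1] by auto
  ultimately show False using n0 by fastforce
qed

text \<open>The inequality between geometric and arithmetic mean reduces to the diagonal, where
  \<open>christoffel\<close> is the constant \<open>n l / \<omega>\<close>. Degree 0 is left out
  because \<open>real 0 ^ (d - 1)\<close> is 0 for \<open>d > 1\<close>.\<close>

lemma abs_Y_le:
  obtains C where "C \<ge> 0" "\<And>l x y. x \<in> sphere 0 1 \<Longrightarrow> y \<in> sphere 0 1 \<Longrightarrow> l \<ge> 1 \<Longrightarrow>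
    (\<Sum>\<mu>=1..n l. \<bar>Y l \<mu> x * Y l \<mu> y\<bar>) \<le> C * real l ^ (d - 1)"
proof -
  define \<omega> where "\<omega> = measure surface_measure (sphere 0 1 :: 'a set)"
  obtain x0 :: 'a where "x0 \<in> sphere 0 1" using vector_choose_size[of 1] by auto
  then have "\<omega> \<noteq> 0" using christoffel_integral[of x0 0] n_0_pos by (auto simp: \<omega>_def)
  then have \<omega>: "\<omega> > 0" by (simp add: \<omega>_def less_le)
  show ?thesis
  proof (rule that[of "2 * 2 ^ (d - 1) / \<omega>"])
    fix l :: nat and x y :: 'a assume x: "x \<in> sphere 0 1" and y: "y \<in> sphere 0 1" and l: "l \<ge> 1"
    have "(\<Sum>\<mu>=1..n l. \<bar>Y l \<mu> x * Y l \<mu> y\<bar>) \<le> (\<Sum>\<mu>=1..n l. ((Y l \<mu> x)\<^sup>2 + (Y l \<mu> y)\<^sup>2) / 2)"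
    proof (rule sum_mono)
      fix \<mu>
      have "0 \<le> (\<bar>Y l \<mu> x\<bar> - \<bar>Y l \<mu> y\<bar>)\<^sup>2" by simp
      then show "\<bar>Y l \<mu> x * Y l \<mu> y\<bar> \<le> ((Y l \<mu> x)\<^sup>2 + (Y l \<mu> y)\<^sup>2) / 2"
        by (simp add: power2_diff abs_mult)
    qed
    also have "\<dots> = (christoffel l x + christoffel l y) / 2"
      by (simp add: christoffel_def sum.distrib flip: sum_divide_distrib)
    also have "\<dots> = christoffel l x" using christoffel_const[OF x y] by simp
    also have "\<dots> = real (n l) / \<omega>"
      using christoffel_integral[OF x, of l] \<omega> unfolding \<omega>_def[symmetric] by (simp add: field_simps)
    also have "real (n l) \<le> 2 * (2 ^ (d - 1) * real l ^ (d - 1))"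
    proof -
      \<comment> \<open>The shift of the degree by one is absorbed by
        \<open>l + 1 \<le> 2 * l\<close>, the origin of the factor
        \<open>2 ^ (d - 1)\<close>.\<close>
      have "n l \<le> 2 * (l + 1) ^ (d - 1)" using n_le[of "l - 1"] l by simp
      also have "\<dots> \<le> 2 * (2 * l) ^ (d - 1)" using l by (intro mult_left_mono power_mono) auto
      finally have "real (n l) \<le> real (2 * (2 * l) ^ (d - 1))" by (rule of_nat_mono)
      then show ?thesis by (simp add: power_mult_distrib)
    qed
    then have "real (n l) / \<omega> \<le> 2 * (2 ^ (d - 1) * real l ^ (d - 1)) / \<omega>"
      using \<omega> by (intro divide_right_mono) auto
    finally show "(\<Sum>\<mu>=1..n l. \<bar>Y l \<mu> x * Y l \<mu> y\<bar>) \<le> 2 * 2 ^ (d - 1) / \<omega> * real l ^ (d - 1)"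
      by simp
  qed (use \<omega> in simp)
qed

end

section \<open>Conditionally positive definite zonal kernels\<close>

lemma common_uniform_delta:
  fixes h :: "'j \<Rightarrow> 'a::euclidean_space \<Rightarrow> real"
  assumes "finite J" "\<And>j. j \<in> J \<Longrightarrow> continuous_on (sphere 0 1) (h j)" "\<epsilon> > 0"
  obtains \<delta> where "\<delta> > 0" "\<And>j z w. j \<in> J \<Longrightarrow> z \<in> sphere 0 1 \<Longrightarrow> w \<in> sphere 0 1 \<Longrightarrow> dist z w < \<delta> \<Longrightarrow>
    \<bar>h j z - h j w\<bar> \<le> \<epsilon>"
proof -
  have "\<exists>\<delta>>0. \<forall>j\<in>J. \<forall>z\<in>sphere 0 1. \<forall>w\<in>sphere 0 1. dist z w < \<delta> \<longrightarrow> \<bar>h j z - h j w\<bar> \<le> \<epsilon>"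
    using assms(1,2)
  proof (induction J rule: finite_induct)
    case empty
    then show ?case by (auto intro: exI[of _ 1])
  next
    case (insert j J)
    obtain \<delta>1 where 1: "\<delta>1 > 0" "\<forall>j\<in>J. \<forall>z\<in>sphere 0 1. \<forall>w\<in>sphere 0 1. dist z w < \<delta>1 \<longrightarrow> \<bar>h j z - h j w\<bar> \<le> \<epsilon>"
      using insert by auto
    have "uniformly_continuous_on (sphere 0 1) (h j)"
      using insert.prems by (intro compact_uniformly_continuous) auto
    then obtain \<delta>2 where 2: "\<delta>2 > 0" "\<And>z w. z \<in> sphere 0 1 \<Longrightarrow> w \<in> sphere 0 1 \<Longrightarrow> dist w z < \<delta>2 \<Longrightarrow> dist (h j w) (h j z) < \<epsilon>"
      using assms(3) unfolding uniformly_continuous_on_def by metis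
    show ?case
    proof (intro exI[of _ "min \<delta>1 \<delta>2"] conjI ballI impI)
      fix i and z w :: 'a assume a: "i \<in> insert j J" "z \<in> sphere 0 1" "w \<in> sphere 0 1" "dist z w < min \<delta>1 \<delta>2"
      show "\<bar>h i z - h i w\<bar> \<le> \<epsilon>"
      proof (cases "i = j")
        case True
        then show ?thesis using 2(2)[of w z] a by (simp add: dist_real_def)
      next
        case False
        then show ?thesis using 1(2) a by auto
      qed
    qed (use 1 2 in auto)
  qed
  then show ?thesis using that by blast
qed

text \<open>The weights are the integrals of \<open>f\<close> over the pieces of a partition of the sphere into sets of
  diameter less than \<open>2 \<delta>\<close>.\<close>

lemma quadrature:
  fixes f :: "'a::euclidean_space \<Rightarrow> real"
  assumes f: "continuous_on (sphere 0 1) f" and "\<delta> > 0"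
  obtains k :: nat and e :: "nat \<Rightarrow> 'a" and F :: "nat \<Rightarrow> real" where "\<And>i. i < k \<Longrightarrow> e i \<in> sphere 0 1"
    "(\<Sum>i<k. \<bar>F i\<bar>) \<le> (LINT z|surface_measure. \<bar>f z\<bar>)"
    "\<And>h \<epsilon>. continuous_on (sphere 0 1) h \<Longrightarrow>
      (\<And>z w. z \<in> sphere 0 1 \<Longrightarrow> w \<in> sphere 0 1 \<Longrightarrow> dist z w < \<delta> \<Longrightarrow> \<bar>h z - h w\<bar> \<le> \<epsilon>) \<Longrightarrow>
      \<bar>(\<Sum>i<k. F i * h (e i)) - sphere_inner f h\<bar> \<le> \<epsilon> * (LINT z|surface_measure. \<bar>f z\<bar>)"
proof -
  obtain E where E: "finite E" "E \<subseteq> sphere (0::'a) 1" "sphere 0 1 \<subseteq> (\<Union>x\<in>E. ball x \<delta>)"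
    using compactE_image[of "sphere (0::'a) 1" "sphere 0 1" "\<lambda>x. ball x \<delta>"] \<open>\<delta> > 0\<close>
    by (metis (no_types, lifting) centre_in_ball compact_sphere open_ball subsetI UN_iff)
  obtain e where "bij_betw e {0..<card E} E" using ex_bij_betw_nat_finite[OF E(1)] by blast
  then have eE: "e ` {..<card E} = E" by (simp add: bij_betw_def atLeast0LessThan)
  let ?k = "card E"
  let ?\<mu> = "surface_measure :: 'a measure"
  \<comment> \<open>Balls made disjoint: \<open>z\<close> belongs to the first ball that contains
    it.\<close>
  define A where "A i = {z \<in> sphere 0 1. z \<in> ball (e i) \<delta> \<and> (\<forall>i'<i. z \<notin> ball (e i') \<delta>)}" for i
  have A_sets: "A i \<in> sets ?\<mu>" for i
  proof -
    have "A i = (ball (e i) \<delta> - (\<Union>i'<i. ball (e i') \<delta>)) \<inter> sphere 0 1" by (auto simp: A_def)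
    then show ?thesis by (simp add: sets_surface_measure sets_restrict_space_iff)
  qed
  have part: "(\<Sum>i<?k. indicator (A i) z) = (1::real)" if z: "z \<in> sphere 0 1" for z
  proof -
    define i where "i = (LEAST i. z \<in> ball (e i) \<delta>)"
    obtain \<xi> where "\<xi> \<in> E" "z \<in> ball \<xi> \<delta>" using z E(3) by blast
    moreover from this have "\<xi> \<in> e ` {..<?k}" using eE by simp
    ultimately obtain j where j: "j < ?k" "z \<in> ball (e j) \<delta>" by blast
    have zi: "z \<in> ball (e i) \<delta>" unfolding i_def by (rule LeastI) (fact j)
    have "i \<le> j" unfolding i_def by (rule Least_le) (fact j)
    then have "i < ?k" using j by simp
    have "z \<in> A i' \<longleftrightarrow> i' = i" for i'
    proof
      assume "z \<in> A i'"
      then have "z \<in> ball (e i') \<delta>" "\<forall>i''<i'. z \<notin> ball (e i'') \<delta>" by (auto simp: A_def)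
      moreover from this have "i \<le> i'" unfolding i_def by (intro Least_le)
      ultimately show "i' = i" using zi by (metis le_neq_implies_less)
    next
      assume "i' = i"
      then show "z \<in> A i'" using z zi not_less_Least unfolding A_def i_def by blast
    qed
    then have "(\<Sum>i'<?k. indicator (A i') z) = (\<Sum>i'<?k. if i' = i then 1 else (0::real))"
      by (intro sum.cong) (auto simp: indicator_def)
    then show ?thesis using \<open>i < ?k\<close> by simp
  qed
  define F where "F i = (LINT z|?\<mu>. indicator (A i) z * f z)" for i
  have int: "integrable ?\<mu> (\<lambda>z. indicator (A i) z * g z)" if "continuous_on (sphere 0 1) g" for i and g :: "'a \<Rightarrow> real"
    using integrable_real_mult_indicator[OF A_sets integrable_surface[OF that]] by (simp add: mult.commute)
  have absf: "continuous_on (sphere 0 1) (\<lambda>z. \<bar>f z\<bar>)" using f by (intro continuous_intros)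
  show ?thesis
  proof (rule that[of ?k e F])
    show "e i \<in> sphere 0 1" if "i < ?k" for i using eE E(2) that by blast
    have "(\<Sum>i<?k. \<bar>F i\<bar>) \<le> (\<Sum>i<?k. (LINT z|?\<mu>. indicator (A i) z * \<bar>f z\<bar>))"
    proof (rule sum_mono)
      fix i
      have "\<bar>F i\<bar> \<le> (LINT z|?\<mu>. \<bar>indicator (A i) z * f z\<bar>)" unfolding F_def by (rule integral_abs_bound)
      then show "\<bar>F i\<bar> \<le> (LINT z|?\<mu>. indicator (A i) z * \<bar>f z\<bar>)" by (simp add: abs_mult)
    qed
    also have "\<dots> = (LINT z|?\<mu>. (\<Sum>i<?k. indicator (A i) z * \<bar>f z\<bar>))"
      by (intro Bochner_Integration.integral_sum[symmetric] int absf)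
    also have "\<dots> = (LINT z|?\<mu>. \<bar>f z\<bar>)"
      using part by (intro Bochner_Integration.integral_cong) (auto simp flip: sum_distrib_right)
    finally show "(\<Sum>i<?k. \<bar>F i\<bar>) \<le> (LINT z|?\<mu>. \<bar>f z\<bar>)" .
    \<comment> \<open>\<open>h\<close> and \<open>\<epsilon>\<close> come after the points and
      weights: a single rule has to serve the low degree harmonics, \<open>f\<close> itself and all
      kernel sections.\<close>
    fix h :: "'a \<Rightarrow> real" and \<epsilon> :: real
    assume h: "continuous_on (sphere 0 1) h"
      and osc: "\<And>z w. z \<in> sphere 0 1 \<Longrightarrow> w \<in> sphere 0 1 \<Longrightarrow> dist z w < \<delta> \<Longrightarrow> \<bar>h z - h w\<bar> \<le> \<epsilon>"
    have c: "continuous_on (sphere 0 1) (\<lambda>z. f z * (h (e i) - h z))" for i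
      using f h by (intro continuous_intros)
    \<comment> \<open>Since the indicators of the pieces sum to 1, the error is one integral of
      \<open>f\<close> against the oscillation of \<open>h\<close> on each piece.\<close>
    have "(\<Sum>i<?k. F i * h (e i)) - sphere_inner f h
        = (LINT z|?\<mu>. (\<Sum>i<?k. indicator (A i) z * (f z * (h (e i) - h z))))"
    proof -
      have "(\<Sum>i<?k. F i * h (e i)) = (LINT z|?\<mu>. (\<Sum>i<?k. indicator (A i) z * f z * h (e i)))"
        unfolding F_def by (subst Bochner_Integration.integral_sum) (auto intro!: int f integrable_mult_left)
      moreover have "sphere_inner f h = (LINT z|?\<mu>. (\<Sum>i<?k. indicator (A i) z * (f z * h z)))"
        unfolding sphere_inner_def using part
        by (intro Bochner_Integration.integral_cong) (auto simp flip: sum_distrib_right)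
      moreover have "integrable ?\<mu> (\<lambda>z. \<Sum>i<?k. indicator (A i) z * f z * h (e i))"
        by (intro Bochner_Integration.integrable_sum integrable_mult_left int f)
      moreover have "integrable ?\<mu> (\<lambda>z. \<Sum>i<?k. indicator (A i) z * (f z * h z))"
        by (intro Bochner_Integration.integrable_sum int continuous_intros f h)
      ultimately have "(\<Sum>i<?k. F i * h (e i)) - sphere_inner f h
          = (LINT z|?\<mu>. (\<Sum>i<?k. indicator (A i) z * f z * h (e i)) - (\<Sum>i<?k. indicator (A i) z * (f z * h z)))"
        by simp
      then show ?thesis by (simp add: sum_subtractf[symmetric] algebra_simps)
    qed
    also have "\<bar>\<dots>\<bar> \<le> (LINT z|?\<mu>. \<epsilon> * \<bar>f z\<bar>)"
    proof (rule order_trans[OF integral_abs_bound integral_mono])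
      show "integrable ?\<mu> (\<lambda>z. \<bar>\<Sum>i<?k. indicator (A i) z * (f z * (h (e i) - h z))\<bar>)"
        by (intro integrable_abs Bochner_Integration.integrable_sum int c)
      show "integrable ?\<mu> (\<lambda>z. \<epsilon> * \<bar>f z\<bar>)" by (intro integrable_surface continuous_intros f)
      fix z assume "z \<in> space ?\<mu>"
      then have z: "z \<in> sphere 0 1" by simp
      have "\<bar>\<Sum>i<?k. indicator (A i) z * (f z * (h (e i) - h z))\<bar> \<le> (\<Sum>i<?k. indicator (A i) z * (\<epsilon> * \<bar>f z\<bar>))"
      proof (rule order_trans[OF sum_abs sum_mono])
        fix i assume i: "i \<in> {..<?k}"
        show "\<bar>indicator (A i) z * (f z * (h (e i) - h z))\<bar> \<le> indicator (A i) z * (\<epsilon> * \<bar>f z\<bar>)"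
        proof (cases "z \<in> A i")
          case True
          then have "dist (e i) z < \<delta>" by (auto simp: A_def)
          then have "\<bar>h (e i) - h z\<bar> \<le> \<epsilon>" using osc[of "e i" z] eE E(2) i z by blast
          then have "\<bar>f z\<bar> * \<bar>h (e i) - h z\<bar> \<le> \<bar>f z\<bar> * \<epsilon>" by (rule mult_left_mono) simp
          then show ?thesis using True by (simp add: abs_mult mult.commute)
        qed simp
      qed
      also have "\<dots> = \<epsilon> * \<bar>f z\<bar>" using part[OF z] by (simp flip: sum_distrib_right)
      finally show "\<bar>\<Sum>i<?k. indicator (A i) z * (f z * (h (e i) - h z))\<bar> \<le> \<epsilon> * \<bar>f z\<bar>" .
    qed
    also have "\<dots> = \<epsilon> * (LINT z|?\<mu>. \<bar>f z\<bar>)" by simp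
    finally show "\<bar>(\<Sum>i<?k. F i * h (e i)) - sphere_inner f h\<bar> \<le> \<epsilon> * (LINT z|?\<mu>. \<bar>f z\<bar>)" .
  qed
qed

section \<open>Continuity, Fourier coefficients and positivity of a zonal kernel\<close>

locale zonal = harmonics n Y d for n and Y :: "nat \<Rightarrow> nat \<Rightarrow> 'a::euclidean_space \<Rightarrow> real" and d +
  fixes c :: "nat \<Rightarrow> real" and \<Phi> :: "'a \<Rightarrow> 'a \<Rightarrow> real" and m :: nat
  assumes zonal: "zonal_kernel n Y c \<Phi>" and cpd: "cond_pos_def n Y m \<Phi>" and m: "m \<ge> 1"
begin

lemma Phi_uniform:
  "uniform_limit (sphere 0 1 \<times> sphere 0 1)
     (\<lambda>L (x, y). \<Sum>l<L. \<Sum>\<mu>=1..n l. c l * Y l \<mu> x * Y l \<mu> y) (\<lambda>(x, y). \<Phi> x y) sequentially"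
  using zonal by (simp add: zonal_kernel_def)

lemma Phi_sums:
  assumes "x \<in> sphere 0 1" "y \<in> sphere 0 1"
  shows "(\<lambda>l. \<Sum>\<mu>=1..n l. c l * Y l \<mu> x * Y l \<mu> y) sums \<Phi> x y"
  unfolding sums_def using tendsto_uniform_limitI[OF Phi_uniform, of "(x, y)"] assms by simp

lemma Phi_sym:
  assumes "x \<in> sphere 0 1" "y \<in> sphere 0 1"
  shows "\<Phi> x y = \<Phi> y x"
proof -
  have eq: "(\<lambda>l. \<Sum>\<mu>=1..n l. c l * Y l \<mu> x * Y l \<mu> y) = (\<lambda>l. \<Sum>\<mu>=1..n l. c l * Y l \<mu> y * Y l \<mu> x)"
    by (simp add: mult_ac)
  show ?thesis using Phi_sums[OF assms] Phi_sums[OF assms(2,1)] unfolding eq by (rule sums_unique2)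
qed

lemma Phi_continuous: "continuous_on (sphere 0 1 \<times> sphere 0 1) (\<lambda>(x, y). \<Phi> x y)"
proof (rule uniform_limit_theorem[OF _ Phi_uniform])
  have Y1: "continuous_on (sphere 0 1 \<times> sphere 0 1) (\<lambda>p. Y l \<mu> (fst p))"
    "continuous_on (sphere 0 1 \<times> sphere 0 1) (\<lambda>p. Y l \<mu> (snd p))" if "\<mu> \<in> {1..n l}" for l \<mu>
    by (rule continuous_on_compose2[OF Y_continuous[OF that] continuous_on_fst[OF continuous_on_id]]; auto)
       (rule continuous_on_compose2[OF Y_continuous[OF that] continuous_on_snd[OF continuous_on_id]]; auto)
  have "continuous_on (sphere 0 1 \<times> sphere 0 1) (\<lambda>p. \<Sum>l<L. \<Sum>\<mu>=1..n l. c l * Y l \<mu> (fst p) * Y l \<mu> (snd p))" for L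
    by (intro continuous_intros Y1)
  then show "\<forall>\<^sub>F L in sequentially. continuous_on (sphere 0 1 \<times> sphere 0 1)
      (\<lambda>(x, y). \<Sum>l<L. \<Sum>\<mu>=1..n l. c l * Y l \<mu> x * Y l \<mu> y)"
    by (simp add: case_prod_beta)
qed simp

lemma Phi_continuous_left:
  assumes y: "y \<in> sphere 0 1"
  shows "continuous_on (sphere 0 1) (\<lambda>x. \<Phi> x y)"
proof -
  have "continuous_on (sphere 0 1) (\<lambda>x. (x, y))" by (intro continuous_intros)
  moreover have "(\<lambda>x. (x, y)) ` sphere 0 1 \<subseteq> sphere 0 1 \<times> sphere 0 1" using y by blast
  ultimately show ?thesis using continuous_on_compose2[OF Phi_continuous] by force
qed

lemma sphere_inner_expansion:
  assumes "\<nu> \<in> {1..n l}"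
  shows "sphere_inner (\<lambda>z. \<Sum>k<L. \<Sum>\<mu>=1..n k. b k \<mu> * Y k \<mu> z) (Y l \<nu>) = (if l < L then b l \<nu> else 0)"
proof -
  have "sphere_inner (\<lambda>z. \<Sum>k<L. 1 * (\<Sum>\<mu>=1..n k. b k \<mu> * Y k \<mu> z)) (Y l \<nu>)
      = (\<Sum>k<L. 1 * sphere_inner (\<lambda>z. \<Sum>\<mu>=1..n k. b k \<mu> * Y k \<mu> z) (Y l \<nu>))"
    using assms by (intro sphere_inner_sum_left Y_sum_continuous Y_continuous)
  also have "\<dots> = (\<Sum>k<L. if k = l then b l \<nu> else 0)"
  proof (rule sum.cong[OF refl])
    fix k
    have "sphere_inner (\<lambda>z. \<Sum>\<mu>=1..n k. b k \<mu> * Y k \<mu> z) (Y l \<nu>) = (\<Sum>\<mu>=1..n k. b k \<mu> * sphere_inner (Y k \<mu>) (Y l \<nu>))"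
      using assms by (intro sphere_inner_sum_left Y_continuous)
    also have "\<dots> = (\<Sum>\<mu>=1..n k. if k = l \<and> \<mu> = \<nu> then b l \<nu> else 0)"
      using assms by (intro sum.cong) (auto simp: Y_inner)
    also have "\<dots> = (if k = l then b l \<nu> else 0)" using assms by auto
    finally show "1 * sphere_inner (\<lambda>z. \<Sum>\<mu>=1..n k. b k \<mu> * Y k \<mu> z) (Y l \<nu>) = (if k = l then b l \<nu> else 0)" by simp
  qed
  finally show ?thesis by simp
qed

text \<open>The harmonics are eigenfunctions of the integral operator with kernel
  \<open>\<Phi>\<close>. Once \<open>L > l\<close>, a partial sum has exactly this coefficient, and
  uniform convergence carries it over to \<open>\<Phi>\<close>.\<close>

lemma sphere_inner_Phi:
  assumes y: "y \<in> sphere 0 1" and \<nu>: "\<nu> \<in> {1..n l}"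
  shows "sphere_inner (\<lambda>z. \<Phi> z y) (Y l \<nu>) = c l * Y l \<nu> y"
proof -
  define B where "B = (LINT z|surface_measure. \<bar>Y l \<nu> z\<bar>)"
  have Yc: "continuous_on (sphere 0 1) (Y l \<nu>)" using \<nu> by (rule Y_continuous)
  have "\<bar>c l * Y l \<nu> y - sphere_inner (\<lambda>z. \<Phi> z y) (Y l \<nu>)\<bar> \<le> \<epsilon> * B" if \<epsilon>: "\<epsilon> > 0" for \<epsilon>
  proof -
    have "\<forall>\<^sub>F L in sequentially. \<forall>p\<in>sphere 0 1 \<times> sphere 0 1.
      dist (case p of (x, y) \<Rightarrow> \<Sum>l<L. \<Sum>\<mu>=1..n l. c l * Y l \<mu> x * Y l \<mu> y) (case p of (x, y) \<Rightarrow> \<Phi> x y) < \<epsilon>"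
      using uniform_limitD[OF Phi_uniform \<epsilon>] .
    moreover have "\<forall>\<^sub>F L in sequentially. L > l" by (rule eventually_gt_at_top)
    ultimately have "\<forall>\<^sub>F L in sequentially. L > l \<and> (\<forall>p\<in>sphere 0 1 \<times> sphere 0 1.
      dist (case p of (x, y) \<Rightarrow> \<Sum>l<L. \<Sum>\<mu>=1..n l. c l * Y l \<mu> x * Y l \<mu> y) (case p of (x, y) \<Rightarrow> \<Phi> x y) < \<epsilon>)"
      by eventually_elim blast
    then obtain L where L: "L > l" and close: "\<And>x. x \<in> sphere 0 1 \<Longrightarrow>
      \<bar>(\<Sum>k<L. \<Sum>\<mu>=1..n k. c k * Y k \<mu> x * Y k \<mu> y) - \<Phi> x y\<bar> < \<epsilon>"
      using y unfolding eventually_sequentially by (force simp: dist_real_def)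
    define s where "s z = (\<Sum>k<L. \<Sum>\<mu>=1..n k. (c k * Y k \<mu> y) * Y k \<mu> z)" for z
    have s_cont: "continuous_on (sphere 0 1) s" unfolding s_def by (intro continuous_intros Y_continuous)
    have "c l * Y l \<nu> y = sphere_inner s (Y l \<nu>)"
      unfolding s_def using sphere_inner_expansion[OF \<nu>, where L = L and b = "\<lambda>k \<mu>. c k * Y k \<mu> y"] L by simp
    then have "c l * Y l \<nu> y - sphere_inner (\<lambda>z. \<Phi> z y) (Y l \<nu>)
        = (LINT z|surface_measure. s z * Y l \<nu> z - \<Phi> z y * Y l \<nu> z)"
      unfolding sphere_inner_def using s_cont Phi_continuous_left[OF y] Yc
      by (subst Bochner_Integration.integral_diff) (auto intro!: integrable_surface continuous_intros)
    also have "\<bar>\<dots>\<bar> \<le> (LINT z|surface_measure. \<epsilon> * \<bar>Y l \<nu> z\<bar>)"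
    proof (rule order_trans[OF integral_abs_bound integral_mono])
      show "integrable surface_measure (\<lambda>z. \<bar>s z * Y l \<nu> z - \<Phi> z y * Y l \<nu> z\<bar>)"
        "integrable surface_measure (\<lambda>z. \<epsilon> * \<bar>Y l \<nu> z\<bar>)"
        by (intro integrable_surface continuous_intros s_cont Phi_continuous_left[OF y] Yc)+
      fix z :: 'a assume "z \<in> space surface_measure"
      then have "\<bar>s z - \<Phi> z y\<bar> \<le> \<epsilon>" using close[of z] by (simp add: s_def mult_ac)
      then have "\<bar>s z - \<Phi> z y\<bar> * \<bar>Y l \<nu> z\<bar> \<le> \<epsilon> * \<bar>Y l \<nu> z\<bar>" by (rule mult_right_mono) simp
      then show "\<bar>s z * Y l \<nu> z - \<Phi> z y * Y l \<nu> z\<bar> \<le> \<epsilon> * \<bar>Y l \<nu> z\<bar>"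
        by (simp add: abs_mult[symmetric] left_diff_distrib)
    qed
    finally show ?thesis by (simp add: B_def)
  qed
  note le = this
  have "B \<ge> 0" by (simp add: B_def)
  have "\<bar>c l * Y l \<nu> y - sphere_inner (\<lambda>z. \<Phi> z y) (Y l \<nu>)\<bar> \<le> 0"
  proof (rule field_le_epsilon)
    fix \<epsilon> :: real assume "\<epsilon> > 0"
    then have "\<bar>c l * Y l \<nu> y - sphere_inner (\<lambda>z. \<Phi> z y) (Y l \<nu>)\<bar> \<le> \<epsilon> / (B + 1) * B"
      using \<open>B \<ge> 0\<close> by (intro le) auto
    also have "\<dots> \<le> \<epsilon>" using \<open>\<epsilon> > 0\<close> \<open>B \<ge> 0\<close> by (simp add: field_simps)
    finally show "\<bar>c l * Y l \<nu> y - sphere_inner (\<lambda>z. \<Phi> z y) (Y l \<nu>)\<bar> \<le> 0 + \<epsilon>" by simp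
  qed
  then show ?thesis by simp
qed

text \<open>Points may coincide, so their weights are first collected at the distinct points.\<close>

lemma psd_family:
  assumes I: "finite I" and y: "\<And>i. i \<in> I \<Longrightarrow> y i \<in> sphere 0 1"
    and ann: "\<And>r. r \<in> harmonic_space n Y (m - 1) \<Longrightarrow> (\<Sum>i\<in>I. w i * r (y i)) = 0"
  shows "(\<Sum>i\<in>I. \<Sum>j\<in>I. w i * w j * \<Phi> (y i) (y j)) \<ge> 0"
proof -
  define \<alpha> where "\<alpha> z = (\<Sum>i\<in>{i \<in> I. y i = z}. w i)" for z
  have grp: "(\<Sum>i\<in>I. w i * g (y i)) = (\<Sum>z\<in>y ` I. \<alpha> z * g z)" for g :: "'a \<Rightarrow> real"
  proof -
    have "(\<Sum>i\<in>I. w i * g (y i)) = (\<Sum>z\<in>y ` I. \<Sum>i\<in>{i \<in> I. y i = z}. w i * g (y i))"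
      by (rule sum.image_gen[OF I])
    also have "\<dots> = (\<Sum>z\<in>y ` I. \<alpha> z * g z)"
      unfolding \<alpha>_def sum_distrib_right by (intro sum.cong) auto
    finally show ?thesis .
  qed
  define G where "G z = (\<Sum>z'\<in>y ` I. \<alpha> z' * \<Phi> z z')" for z
  have "(\<Sum>i\<in>I. \<Sum>j\<in>I. w i * w j * \<Phi> (y i) (y j)) = (\<Sum>i\<in>I. w i * (\<Sum>j\<in>I. w j * \<Phi> (y i) (y j)))"
    by (simp add: sum_distrib_left mult.assoc)
  also have "\<dots> = (\<Sum>i\<in>I. w i * G (y i))" unfolding grp G_def ..
  also have "\<dots> = (\<Sum>z\<in>y ` I. \<alpha> z * G z)" by (rule grp)
  also have "\<dots> = (\<Sum>z\<in>y ` I. \<Sum>z'\<in>y ` I. \<alpha> z * \<alpha> z' * \<Phi> z z')"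
    by (simp add: G_def sum_distrib_left mult.assoc)
  also have "\<dots> \<ge> 0"
  \<comment> \<open>The collected weights may all cancel; then the form is 0, which is why the
    conclusion is not strict.\<close>
  proof (cases "\<exists>z\<in>y ` I. \<alpha> z \<noteq> 0")
    case True
    have "(\<Sum>z\<in>y ` I. \<Sum>z'\<in>y ` I. \<alpha> z * \<alpha> z' * \<Phi> z z') > 0"
      using cpd unfolding cond_pos_def_def
      by (rule allE[of _ "y ` I"], elim allE[of _ \<alpha>] impE) (use I y True ann grp in auto)
    then show ?thesis by simp
  next
    case False
    then show ?thesis by (intro sum_nonneg) auto
  qed
  finally show ?thesis .
qed

end

section \<open>Nodes, moment conditions and the sign of the coefficients\<close>

locale nodes = zonal n Y d c \<Phi> m for n and Y :: "nat \<Rightarrow> nat \<Rightarrow> 'a::euclidean_space \<Rightarrow> real" and d c \<Phi> m +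
  fixes N :: nat and x :: "nat \<Rightarrow> 'a"
  assumes x_inj: "inj_on x {..<N}" and x_sphere: "x ` {..<N} \<subseteq> sphere 0 1"
    and unisolvent: "unisolvent n Y (m - 1) (x ` {..<N})"
begin

lemma x_in: "j < N \<Longrightarrow> x j \<in> sphere 0 1"
  using x_sphere by blast

text \<open>This is where \<open>m \<ge> 1\<close> matters: subtraction is truncated, so for
  \<open>m = 0\<close> the set \<open>{..m - 1}\<close> would still contain degree 0.\<close>

lemma harmonic_space_eq:
  "harmonic_space n Y (m - 1) = {(\<lambda>z. \<Sum>l<m. \<Sum>\<mu>=1..n l. b l \<mu> * Y l \<mu> z) | b. True}"
proof -
  have "{..m - 1} = {..<m}" using m by auto
  then show ?thesis by (simp add: harmonic_space_def)
qed

lemma low_degree_sum: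
  assumes e: "low_degree_enum n m M e"
  shows "(\<Sum>l<m. \<Sum>\<mu>=1..n l. g l \<mu>) = (\<Sum>i<M. g (fst (e i)) (snd (e i)))"
proof -
  have "(\<Sum>l<m. \<Sum>\<mu>=1..n l. g l \<mu>) = (\<Sum>p\<in>(SIGMA l:{..<m}. {1..n l}). g (fst p) (snd p))"
    by (subst sum.Sigma) (auto simp: case_prod_beta)
  also have "\<dots> = (\<Sum>i<M. g (fst (e i)) (snd (e i)))"
    using sum.reindex_bij_betw[of e "{..<M}" _ "\<lambda>p. g (fst p) (snd p)"] e by (simp add: low_degree_enum_def)
  finally show ?thesis .
qed

lemma low_degree_mem:
  assumes "low_degree_enum n m M e" "i < M"
  shows "fst (e i) < m" "snd (e i) \<in> {1..n (fst (e i))}"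
proof -
  have "e i \<in> (SIGMA l:{..<m}. {1..n l})" using assms by (auto simp: low_degree_enum_def bij_betw_def)
  then show "fst (e i) < m" "snd (e i) \<in> {1..n (fst (e i))}" by auto
qed

lemma low_degree_inv:
  assumes "low_degree_enum n m M e" "l < m" "\<mu> \<in> {1..n l}"
  obtains i where "i < M" "e i = (l, \<mu>)"
proof -
  have "(l, \<mu>) \<in> e ` {..<M}" using assms by (auto simp: low_degree_enum_def bij_betw_def)
  then show ?thesis using that by auto
qed

lemma low_degree_enum_ex: "\<exists>M e. low_degree_enum n m M e"
proof -
  have "finite (SIGMA l:{..<m}. {1..n l})" by auto
  then show ?thesis unfolding low_degree_enum_def atLeast0LessThan[symmetric]
    using ex_bij_betw_nat_finite by blast
qed

abbreviation "PM M e \<equiv> harmonic_mat Y M e N x"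

lemma PM_carrier: "PM M e \<in> carrier_mat N M" by (simp add: harmonic_mat_def)

lemma PM_vec: "b \<in> carrier_vec M \<Longrightarrow> j < N \<Longrightarrow> (PM M e *\<^sub>v b) $ j = (\<Sum>i<M. b $ i * Y (fst (e i)) (snd (e i)) (x j))"
  by (simp add: harmonic_mat_def scalar_prod_def atLeast0LessThan mult.commute)

lemma PM_transpose_vec:
  "\<alpha> \<in> carrier_vec N \<Longrightarrow> i < M \<Longrightarrow> ((PM M e)\<^sup>T *\<^sub>v \<alpha>) $ i = (\<Sum>j<N. \<alpha> $ j * Y (fst (e i)) (snd (e i)) (x j))"
  by (simp add: harmonic_mat_def scalar_prod_def atLeast0LessThan mult.commute)

text \<open>Unisolvence makes the function vanish on the whole sphere; orthonormality then makes its
  coefficients vanish.\<close>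

lemma PM_inj:
  assumes e: "low_degree_enum n m M e" and b: "b \<in> carrier_vec M" "PM M e *\<^sub>v b = 0\<^sub>v N"
  shows "b = 0\<^sub>v M"
proof -
  have inj: "inj_on e {..<M}" using e by (auto simp: low_degree_enum_def bij_betw_def)
  define \<beta> where "\<beta> l \<mu> = b $ (inv_into {..<M} e (l, \<mu>))" for l \<mu>
  have \<beta>: "\<beta> (fst (e i)) (snd (e i)) = b $ i" if "i < M" for i
    using that inj by (simp add: \<beta>_def)
  define q where "q z = (\<Sum>l<m. \<Sum>\<mu>=1..n l. \<beta> l \<mu> * Y l \<mu> z)" for z
  have q: "q z = (\<Sum>i<M. b $ i * Y (fst (e i)) (snd (e i)) z)" for z
    unfolding q_def low_degree_sum[OF e] using \<beta> by simp
  have "q \<in> harmonic_space n Y (m - 1)" unfolding harmonic_space_eq q_def by blast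
  moreover have "q z = 0" if zx: "z \<in> x ` {..<N}" for z
  proof -
    obtain j where "j < N" "z = x j" using zx by blast
    then show ?thesis using PM_vec[OF b(1), of j e] b(2) by (simp add: q)
  qed
  ultimately have "q z = 0" if "z \<in> sphere 0 1" for z using unisolvent that unfolding unisolvent_def by blast
  then have 0: "sphere_inner q (Y l \<nu>) = 0" for l \<nu>
    using sphere_inner_cong[of q "\<lambda>z. 0" "Y l \<nu>" "Y l \<nu>"] by (simp add: sphere_inner_def)
  have "b $ i = 0" if i: "i < M" for i
    using sphere_inner_expansion[OF low_degree_mem(2)[OF e i], where L = m and b = \<beta>] 0 \<beta>[OF i] low_degree_mem(1)[OF e i]
    unfolding q_def by simp
  then show ?thesis using b(1) by (intro eq_vecI) auto
qed

lemma annihilates: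
  assumes e: "low_degree_enum n m M e"
  shows "(\<forall>r\<in>harmonic_space n Y (m - 1). (\<Sum>j<N. a j * r (x j)) = 0) \<longleftrightarrow>
    (PM M e)\<^sup>T *\<^sub>v vec N a = 0\<^sub>v M"
proof
  assume ann: "\<forall>r\<in>harmonic_space n Y (m - 1). (\<Sum>j<N. a j * r (x j)) = 0"
  show "(PM M e)\<^sup>T *\<^sub>v vec N a = 0\<^sub>v M"
  proof (rule eq_vecI)
    fix i assume "i < dim_vec (0\<^sub>v M :: real Matrix.vec)"
    then have i: "i < M" by simp
    note mem = low_degree_mem[OF e i]
    have "Y (fst (e i)) (snd (e i)) \<in> harmonic_space n Y (m - 1)"
      unfolding harmonic_space_eq
    proof (intro CollectI exI[of _ "\<lambda>l \<mu>. if l = fst (e i) \<and> \<mu> = snd (e i) then 1 else 0"] conjI TrueI ext)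
      fix z
      have "(\<Sum>l<m. \<Sum>\<mu>=1..n l. (if l = fst (e i) \<and> \<mu> = snd (e i) then 1 else 0) * Y l \<mu> z)
          = (\<Sum>l<m. if l = fst (e i) then \<Sum>\<mu>=1..n l. if \<mu> = snd (e i) then Y (fst (e i)) (snd (e i)) z else 0 else 0)"
      proof (rule sum.cong[OF refl])
        fix l
        show "(\<Sum>\<mu>=1..n l. (if l = fst (e i) \<and> \<mu> = snd (e i) then 1 else 0) * Y l \<mu> z)
          = (if l = fst (e i) then \<Sum>\<mu>=1..n l. if \<mu> = snd (e i) then Y (fst (e i)) (snd (e i)) z else 0 else 0)"
        proof (cases "l = fst (e i)")
          case True
          show ?thesis unfolding if_P[OF True] by (rule sum.cong) (auto simp: True)
        qed auto
      qed
      also have "\<dots> = Y (fst (e i)) (snd (e i)) z" using mem by simp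
      finally show "Y (fst (e i)) (snd (e i)) z = (\<Sum>l<m. \<Sum>\<mu>=1..n l. (if l = fst (e i) \<and> \<mu> = snd (e i) then 1 else 0) * Y l \<mu> z)" ..
    qed
    then show "((PM M e)\<^sup>T *\<^sub>v vec N a) $ i = 0\<^sub>v M $ i"
      using ann i by (subst PM_transpose_vec) auto
  qed (simp add: harmonic_mat_def)
next
  assume P0: "(PM M e)\<^sup>T *\<^sub>v vec N a = 0\<^sub>v M"
  show "\<forall>r\<in>harmonic_space n Y (m - 1). (\<Sum>j<N. a j * r (x j)) = 0"
  proof
    fix r assume "r \<in> harmonic_space n Y (m - 1)"
    then obtain b where r: "r = (\<lambda>z. \<Sum>l<m. \<Sum>\<mu>=1..n l. b l \<mu> * Y l \<mu> z)" unfolding harmonic_space_eq by blast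
    have 0: "(\<Sum>j<N. a j * Y (fst (e i)) (snd (e i)) (x j)) = 0" if i: "i < M" for i
    proof -
      have "((PM M e)\<^sup>T *\<^sub>v vec N a) $ i = 0" unfolding P0 using i by simp
      then show ?thesis using PM_transpose_vec[of "vec N a" i M e] i by simp
    qed
    have "(\<Sum>j<N. a j * r (x j)) = (\<Sum>j<N. \<Sum>i<M. b (fst (e i)) (snd (e i)) * (a j * Y (fst (e i)) (snd (e i)) (x j)))"
      unfolding r low_degree_sum[OF e] by (simp add: sum_distrib_left mult_ac)
    also have "\<dots> = (\<Sum>i<M. b (fst (e i)) (snd (e i)) * (\<Sum>j<N. a j * Y (fst (e i)) (snd (e i)) (x j)))"
      by (subst sum.swap) (simp add: sum_distrib_left)
    also have "\<dots> = 0" using 0 by simp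
    finally show "(\<Sum>j<N. a j * r (x j)) = 0" .
  qed
qed

text \<open>Weights on the nodes with prescribed low-degree moments: these repair the moment conditions that a
  quadrature rule satisfies only approximately.\<close>

lemma moment_weights:
  assumes e: "low_degree_enum n m M e"
  obtains D :: "nat \<Rightarrow> nat \<Rightarrow> real" where
    "\<And>t i. i < M \<Longrightarrow> (\<Sum>k<N. (\<Sum>j<M. D j k * t j) * Y (fst (e i)) (snd (e i)) (x k)) = t i"
proof -
  \<comment> \<open>A left inverse of the matrix of low degree harmonics at the nodes; the weights
    in its row \<open>j\<close> have moment 1 against harmonic \<open>j\<close> and 0 against the
    others.\<close>
  define A where "A = inv_mat ((PM M e)\<^sup>T * PM M e) * (PM M e)\<^sup>T"
  note G = gram_inv[OF PM_carrier[of M e] PM_inj[OF e]]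
  have A: "A \<in> carrier_mat M N" using G(1) PM_carrier[of M e] by (auto simp: A_def)
  have AP: "A * PM M e = 1\<^sub>m M"
    unfolding A_def using G PM_carrier[of M e] by (simp add: mat_assoc)
  have key: "(\<Sum>k<N. A $$ (j, k) * Y (fst (e i)) (snd (e i)) (x k)) = (if j = i then 1 else 0)" if "j < M" "i < M" for i j
  proof -
    have "(A * PM M e) $$ (j, i) = (\<Sum>k<N. A $$ (j, k) * Y (fst (e i)) (snd (e i)) (x k))"
      using that A by (simp add: harmonic_mat_def scalar_prod_def atLeast0LessThan)
    then show ?thesis using AP that by simp
  qed
  show ?thesis
  proof (rule that[of "\<lambda>j k. A $$ (j, k)"])
    fix t and i assume i: "i < M"
    have "(\<Sum>k<N. (\<Sum>j<M. A $$ (j, k) * t j) * Y (fst (e i)) (snd (e i)) (x k))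
        = (\<Sum>k<N. \<Sum>j<M. t j * (A $$ (j, k) * Y (fst (e i)) (snd (e i)) (x k)))"
      unfolding sum_distrib_right by (intro sum.cong refl) (simp add: mult_ac)
    also have "\<dots> = (\<Sum>j<M. t j * (\<Sum>k<N. A $$ (j, k) * Y (fst (e i)) (snd (e i)) (x k)))"
      by (subst sum.swap) (simp add: sum_distrib_left)
    also have "\<dots> = (\<Sum>j<M. if j = i then t i else 0)" using key i by (intro sum.cong) auto
    finally show "(\<Sum>k<N. (\<Sum>j<M. A $$ (j, k) * t j) * Y (fst (e i)) (snd (e i)) (x k)) = t i" using i by simp
  qed
qed

text \<open>For \<open>f = Y l 1\<close> the double integral of \<open>\<Phi>\<close> against
  \<open>f\<close> is \<open>c l\<close>. The quadrature rule for \<open>f\<close> has low degree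
  moments of size at most \<open>\<epsilon> * B\<close>, since \<open>f\<close> is orthogonal to all
  harmonics of degree below \<open>m\<close>; subtracting weights on the nodes makes them 0. The
  corrected functional falls under \<open>psd_family\<close>, and its form exceeds
  \<open>c l\<close> by at most \<open>\<epsilon> * C\<close> with \<open>C\<close> independent of
  \<open>\<epsilon>\<close>.\<close>

lemma c_nonneg:
  assumes l: "l \<ge> m" and nl: "n l \<ge> 1"
  shows "c l \<ge> 0"
proof -
  obtain M e where e: "low_degree_enum n m M e" using low_degree_enum_ex by blast
  obtain D where D: "\<And>t i. i < M \<Longrightarrow> (\<Sum>k<N. (\<Sum>j<M. D j k * t j) * Y (fst (e i)) (snd (e i)) (x k)) = t i"
    using moment_weights[OF e] by blast
  define f where "f = Y l 1"
  have fin: "1 \<in> {1..n l}" using nl by simp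
  have f: "continuous_on (sphere 0 1) f" unfolding f_def by (rule Y_continuous[OF fin])
  have ff: "sphere_inner f f = 1" unfolding f_def using Y_inner[OF fin fin] by simp
  define B where "B = (LINT z|surface_measure. \<bar>f z\<bar>)"
  have B: "B \<ge> 0" by (simp add: B_def)
  have "bounded ((\<lambda>(x, y). \<Phi> x y) ` (sphere 0 1 \<times> sphere 0 1))"
    by (intro compact_imp_bounded compact_continuous_image Phi_continuous compact_Times compact_sphere)
  then obtain H where H0: "\<forall>v\<in>(\<lambda>(x, y). \<Phi> x y) ` (sphere 0 1 \<times> sphere 0 1). norm v \<le> H" unfolding bounded_iff by blast
  have H: "\<bar>\<Phi> z w\<bar> \<le> H" if "z \<in> sphere 0 1" "w \<in> sphere 0 1" for z w
    using H0 that by force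
  have H_nonneg: "H \<ge> 0"
  proof -
    obtain z :: 'a where "norm z = 1" using vector_choose_size[of 1] by auto
    then show ?thesis using H[of z z] by force
  qed
  \<comment> \<open>\<open>\<epsilon> * S\<close> will bound the total weight of the
    correction.\<close>
  define S where "S = (\<Sum>k<N. \<Sum>j<M. \<bar>D j k\<bar>) * B"
  have S: "S \<ge> 0" using B by (auto simp: S_def intro!: mult_nonneg_nonneg sum_nonneg)
  \<comment> \<open>The first two terms come from replacing integrals by quadrature, the third from
    the two mixed sums of rule and correction, the last from the correction paired with
    itself.\<close>
  define C where "C = B * B + \<bar>c l\<bar> * B + 2 * (B * S * H) + S * S * H"
  have C: "C \<ge> 0" using B S H_nonneg by (simp add: C_def)
  have main: "- c l \<le> \<epsilon> * C" if \<epsilon>: "0 < \<epsilon>" "\<epsilon> \<le> 1" for \<epsilon>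
  proof -
    obtain \<delta>1 where \<delta>1: "\<delta>1 > 0" "\<And>j z w. j \<in> {..<M} \<Longrightarrow> z \<in> sphere 0 1 \<Longrightarrow> w \<in> sphere 0 1 \<Longrightarrow> dist z w < \<delta>1 \<Longrightarrow>
        \<bar>Y (fst (e j)) (snd (e j)) z - Y (fst (e j)) (snd (e j)) w\<bar> \<le> \<epsilon>"
      using common_uniform_delta[of "{..<M}" "\<lambda>j. Y (fst (e j)) (snd (e j))" \<epsilon>] low_degree_mem[OF e] Y_continuous \<epsilon>
      by (metis (no_types, lifting) finite_lessThan lessThan_iff)
    obtain \<delta>2 where \<delta>2: "\<delta>2 > 0" "\<And>z w. z \<in> sphere 0 1 \<Longrightarrow> w \<in> sphere 0 1 \<Longrightarrow> dist z w < \<delta>2 \<Longrightarrow> \<bar>f z - f w\<bar> \<le> \<epsilon>"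
      using common_uniform_delta[of "{()}" "\<lambda>_. f" \<epsilon>] f \<epsilon> by auto
    have "uniformly_continuous_on (sphere 0 1 \<times> sphere 0 1) (\<lambda>(x, y). \<Phi> x y)"
      by (intro compact_uniformly_continuous Phi_continuous compact_Times compact_sphere)
    then obtain \<delta>3 where \<delta>3: "\<delta>3 > 0" "\<And>p p'. p \<in> sphere 0 1 \<times> sphere 0 1 \<Longrightarrow> p' \<in> sphere 0 1 \<times> sphere 0 1 \<Longrightarrow> dist p' p < \<delta>3 \<Longrightarrow>
        dist (case p' of (x, y) \<Rightarrow> \<Phi> x y) (case p of (x, y) \<Rightarrow> \<Phi> x y) < \<epsilon>"
      using \<epsilon>(1) unfolding uniformly_continuous_on_def by metis
    have osc3: "\<bar>\<Phi> z y - \<Phi> w y\<bar> \<le> \<epsilon>" if "z \<in> sphere 0 1" "w \<in> sphere 0 1" "y \<in> sphere 0 1" "dist z w < \<delta>3" for z w y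
      using \<delta>3(2)[of "(w, y)" "(z, y)"] that by (simp add: dist_Pair_Pair dist_real_def)
    define \<delta> where "\<delta> = min \<delta>1 (min \<delta>2 \<delta>3)"
    have \<delta>: "\<delta> > 0" using \<delta>1 \<delta>2 \<delta>3 by (simp add: \<delta>_def)
    obtain k \<xi> F where \<xi>: "\<And>i. i < (k::nat) \<Longrightarrow> \<xi> i \<in> sphere 0 1" and FB: "(\<Sum>i<k. \<bar>F i\<bar>) \<le> B"
      and quad: "\<And>h \<epsilon>. continuous_on (sphere 0 1) h \<Longrightarrow>
        (\<And>z w. z \<in> sphere 0 1 \<Longrightarrow> w \<in> sphere 0 1 \<Longrightarrow> dist z w < \<delta> \<Longrightarrow> \<bar>h z - h w\<bar> \<le> \<epsilon>) \<Longrightarrow>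
        \<bar>(\<Sum>i<k. F i * h (\<xi> i)) - sphere_inner f h\<bar> \<le> \<epsilon> * B"
      using quadrature[OF f \<delta>] unfolding B_def by blast
    define t where "t i = (\<Sum>a<k. F a * Y (fst (e i)) (snd (e i)) (\<xi> a))" for i
    have t: "\<bar>t i\<bar> \<le> \<epsilon> * B" if i: "i < M" for i
    proof -
      note mem = low_degree_mem[OF e i]
      have "\<bar>t i - sphere_inner f (Y (fst (e i)) (snd (e i)))\<bar> \<le> \<epsilon> * B"
        unfolding t_def by (rule quad[OF Y_continuous[OF mem(2)]]) (use \<delta>1(2) i in \<open>auto simp: \<delta>_def\<close>)
      moreover have "sphere_inner f (Y (fst (e i)) (snd (e i))) = 0"
        unfolding f_def using Y_inner[OF fin mem(2)] mem(1) l by auto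
      ultimately show ?thesis by simp
    qed
    define s where "s a = (\<Sum>j<M. D j a * t j)" for a
    have sS: "(\<Sum>a<N. \<bar>s a\<bar>) \<le> \<epsilon> * S"
    proof -
      have "(\<Sum>a<N. \<bar>s a\<bar>) \<le> (\<Sum>a<N. \<Sum>j<M. \<bar>D j a\<bar> * (\<epsilon> * B))"
      proof (rule sum_mono)
        fix a
        have "\<bar>s a\<bar> \<le> (\<Sum>j<M. \<bar>D j a * t j\<bar>)" unfolding s_def by (rule sum_abs)
        also have "\<dots> \<le> (\<Sum>j<M. \<bar>D j a\<bar> * (\<epsilon> * B))"
          using t by (intro sum_mono) (auto simp: abs_mult intro!: mult_left_mono)
        finally show "\<bar>s a\<bar> \<le> (\<Sum>j<M. \<bar>D j a\<bar> * (\<epsilon> * B))" .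
      qed
      also have "\<dots> = \<epsilon> * S" by (simp add: S_def sum_distrib_left sum_distrib_right mult_ac)
      finally show ?thesis .
    qed
    \<comment> \<open>The disjoint sum of index sets joins quadrature points and nodes even if some
      of them coincide as points.\<close>
    define y where "y = case_sum \<xi> x"
    define w where "w = case_sum F (\<lambda>a. - s a)"
    have "(\<Sum>i\<in>{..<k} <+> {..<N}. \<Sum>j\<in>{..<k} <+> {..<N}. w i * w j * \<Phi> (y i) (y j)) \<ge> 0"
    proof (rule psd_family)
      show "y i \<in> sphere 0 1" if "i \<in> {..<k} <+> {..<N}" for i
        using that \<xi> x_in by (auto simp: y_def)
      fix r assume "r \<in> harmonic_space n Y (m - 1)"
      then obtain b where r: "r = (\<lambda>z. \<Sum>l<m. \<Sum>\<mu>=1..n l. b l \<mu> * Y l \<mu> z)" unfolding harmonic_space_eq by blast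
      have r': "r z = (\<Sum>i<M. b (fst (e i)) (snd (e i)) * Y (fst (e i)) (snd (e i)) z)" for z
        unfolding r low_degree_sum[OF e] ..
      have mom: "(\<Sum>a\<in>I. g a * r (h a)) = (\<Sum>i<M. b (fst (e i)) (snd (e i)) * (\<Sum>a\<in>I. g a * Y (fst (e i)) (snd (e i)) (h a)))"
        for I :: "nat set" and g and h
        unfolding r' sum_distrib_left by (subst sum.swap) (simp add: mult_ac)
      have "(\<Sum>i\<in>{..<k} <+> {..<N}. w i * r (y i)) = (\<Sum>a<k. F a * r (\<xi> a)) - (\<Sum>a<N. s a * r (x a))"
        by (simp add: sum.Plus y_def w_def sum_negf)
      also have "\<dots> = (\<Sum>i<M. b (fst (e i)) (snd (e i)) * t i) - (\<Sum>i<M. b (fst (e i)) (snd (e i)) * t i)"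
        unfolding mom using D[of _ t] by (simp add: t_def[symmetric] s_def[symmetric])
      finally show "(\<Sum>i\<in>{..<k} <+> {..<N}. w i * r (y i)) = 0" by simp
    qed auto
    then have "0 \<le> (\<Sum>i<k. \<Sum>j<k. F i * F j * \<Phi> (\<xi> i) (\<xi> j)) - (\<Sum>i<k. \<Sum>a<N. F i * s a * \<Phi> (\<xi> i) (x a))
        - (\<Sum>a<N. \<Sum>i<k. s a * F i * \<Phi> (x a) (\<xi> i)) + (\<Sum>a<N. \<Sum>b<N. s a * s b * \<Phi> (x a) (x b))"
      by (simp add: sum.Plus y_def w_def sum_negf sum.distrib sum_subtractf)
    \<comment> \<open>Two uses of the same rule: the inner sum approximates the integral of a kernel
      section against \<open>f\<close>, which is \<open>c l * f (\<xi> i)\<close>; the remaining sum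
      approximates the integral of the square of \<open>f\<close>, which is 1.\<close>
    also have "(\<Sum>i<k. \<Sum>j<k. F i * F j * \<Phi> (\<xi> i) (\<xi> j)) \<le> c l + \<epsilon> * (B * B + \<bar>c l\<bar> * B)"
    proof -
      define g where "g i = (\<Sum>j<k. F j * \<Phi> (\<xi> j) (\<xi> i)) - c l * f (\<xi> i)" for i
      have g: "\<bar>g i\<bar> \<le> \<epsilon> * B" if i: "i < k" for i
      proof -
        have "\<bar>(\<Sum>j<k. F j * \<Phi> (\<xi> j) (\<xi> i)) - sphere_inner f (\<lambda>z. \<Phi> z (\<xi> i))\<bar> \<le> \<epsilon> * B"
          by (rule quad[OF Phi_continuous_left[OF \<xi>[OF i]]]) (use osc3 \<xi>[OF i] in \<open>auto simp: \<delta>_def\<close>)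
        moreover have "sphere_inner f (\<lambda>z. \<Phi> z (\<xi> i)) = c l * f (\<xi> i)"
          using sphere_inner_Phi[OF \<xi>[OF i] fin] by (simp add: sphere_inner_commute f_def)
        ultimately show ?thesis by (simp add: g_def)
      qed
      have f1: "\<bar>(\<Sum>i<k. F i * f (\<xi> i)) - 1\<bar> \<le> \<epsilon> * B"
        unfolding ff[symmetric] by (rule quad[OF f]) (use \<delta>2(2) in \<open>auto simp: \<delta>_def\<close>)
      have "(\<Sum>i<k. \<Sum>j<k. F i * F j * \<Phi> (\<xi> i) (\<xi> j)) = (\<Sum>i<k. F i * (\<Sum>j<k. F j * \<Phi> (\<xi> j) (\<xi> i)))"
        unfolding sum_distrib_left using Phi_sym \<xi> by (intro sum.cong refl) (auto simp: mult.assoc)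
      also have "\<dots> = (\<Sum>i<k. F i * g i) + c l * (\<Sum>i<k. F i * f (\<xi> i))"
        unfolding g_def by (simp add: right_diff_distrib sum_subtractf sum_distrib_left mult_ac)
      also have "\<dots> = c l + (\<Sum>i<k. F i * g i) + c l * ((\<Sum>i<k. F i * f (\<xi> i)) - 1)"
        by (simp add: right_diff_distrib)
      also have "\<dots> \<le> c l + B * (\<epsilon> * B) + \<bar>c l\<bar> * (\<epsilon> * B)"
      proof (intro add_mono order_refl)
        have "(\<Sum>i<k. F i * g i) \<le> (\<Sum>i<k. \<bar>F i\<bar> * (\<epsilon> * B))"
        proof (rule sum_mono)
          fix i assume "i \<in> {..<k}"
          then have "\<bar>F i\<bar> * \<bar>g i\<bar> \<le> \<bar>F i\<bar> * (\<epsilon> * B)" using g by (intro mult_left_mono) auto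
          then show "F i * g i \<le> \<bar>F i\<bar> * (\<epsilon> * B)" using abs_ge_self[of "F i * g i"] by (simp add: abs_mult)
        qed
        also have "\<dots> \<le> B * (\<epsilon> * B)"
          unfolding sum_distrib_right[symmetric] using FB \<epsilon> B by (intro mult_right_mono) auto
        finally show "(\<Sum>i<k. F i * g i) \<le> B * (\<epsilon> * B)" .
        have "\<bar>c l\<bar> * \<bar>(\<Sum>i<k. F i * f (\<xi> i)) - 1\<bar> \<le> \<bar>c l\<bar> * (\<epsilon> * B)" using f1 by (intro mult_left_mono) auto
        then show "c l * ((\<Sum>i<k. F i * f (\<xi> i)) - 1) \<le> \<bar>c l\<bar> * (\<epsilon> * B)"
          using abs_ge_self[of "c l * ((\<Sum>i<k. F i * f (\<xi> i)) - 1)"] by (simp add: abs_mult)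
      qed
      finally show ?thesis by (simp add: algebra_simps)
    qed
    finally have "0 \<le> c l + \<epsilon> * (B * B + \<bar>c l\<bar> * B) - (\<Sum>i<k. \<Sum>a<N. F i * s a * \<Phi> (\<xi> i) (x a))
        - (\<Sum>a<N. \<Sum>i<k. s a * F i * \<Phi> (x a) (\<xi> i)) + (\<Sum>a<N. \<Sum>b<N. s a * s b * \<Phi> (x a) (x b))"
      by simp
    moreover have bil: "\<bar>\<Sum>i\<in>I. \<Sum>j\<in>J. u i * v j * \<Phi> (p i) (q j)\<bar> \<le> (\<Sum>i\<in>I. \<bar>u i\<bar>) * (\<Sum>j\<in>J. \<bar>v j\<bar>) * H"
      if "\<And>i. i \<in> I \<Longrightarrow> p i \<in> sphere 0 1" "\<And>j. j \<in> J \<Longrightarrow> q j \<in> sphere 0 1" for I J :: "nat set" and u v p q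
    proof -
      have "\<bar>\<Sum>i\<in>I. \<Sum>j\<in>J. u i * v j * \<Phi> (p i) (q j)\<bar> \<le> (\<Sum>i\<in>I. \<Sum>j\<in>J. \<bar>u i\<bar> * \<bar>v j\<bar> * H)"
      proof (rule order_trans[OF sum_abs sum_mono], rule order_trans[OF sum_abs sum_mono])
        fix i j assume "i \<in> I" "j \<in> J"
        then show "\<bar>u i * v j * \<Phi> (p i) (q j)\<bar> \<le> \<bar>u i\<bar> * \<bar>v j\<bar> * H"
          using H that by (auto simp: abs_mult intro!: mult_left_mono)
      qed
      then show ?thesis by (subst sum_product) (simp add: sum_distrib_right)
    qed
    have "(\<Sum>i<k. \<bar>F i\<bar>) * (\<Sum>a<N. \<bar>s a\<bar>) * H \<le> B * (\<epsilon> * S) * H"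
      using FB sS B S \<epsilon> H_nonneg by (intro mult_right_mono mult_mono) (auto intro: sum_nonneg)
    then have "\<bar>\<Sum>i<k. \<Sum>a<N. F i * s a * \<Phi> (\<xi> i) (x a)\<bar> \<le> \<epsilon> * (B * S * H)"
      using bil[of "{..<k}" \<xi> "{..<N}" x F s] \<xi> x_in by (simp add: mult_ac)
    moreover have "(\<Sum>a<N. \<bar>s a\<bar>) * (\<Sum>i<k. \<bar>F i\<bar>) * H \<le> (\<epsilon> * S) * B * H"
      using FB sS B S \<epsilon> H_nonneg by (intro mult_right_mono mult_mono) (auto intro: sum_nonneg)
    then have "\<bar>\<Sum>a<N. \<Sum>i<k. s a * F i * \<Phi> (x a) (\<xi> i)\<bar> \<le> \<epsilon> * (B * S * H)"
      using bil[of "{..<N}" x "{..<k}" \<xi> s F] \<xi> x_in by (simp add: mult_ac)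
    \<comment> \<open>Here \<open>\<epsilon> \<le> 1\<close> reduces an error quadratic in
      \<open>\<epsilon>\<close> to a linear one.\<close>
    moreover have "(\<Sum>a<N. \<bar>s a\<bar>) * (\<Sum>a<N. \<bar>s a\<bar>) * H \<le> (\<epsilon> * S) * (1 * S) * H"
    proof (intro mult_right_mono mult_mono sS)
      show "(\<Sum>a<N. \<bar>s a\<bar>) \<le> 1 * S" using sS mult_right_mono[OF \<epsilon>(2) S] by simp
    qed (use S \<epsilon> H_nonneg in \<open>auto intro: sum_nonneg\<close>)
    then have "\<bar>\<Sum>a<N. \<Sum>b<N. s a * s b * \<Phi> (x a) (x b)\<bar> \<le> \<epsilon> * (S * S * H)"
      using bil[of "{..<N}" x "{..<N}" x s s] x_in by (simp add: mult_ac)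
    ultimately have "- c l \<le> \<epsilon> * (B * B + \<bar>c l\<bar> * B) + \<epsilon> * (B * S * H) + \<epsilon> * (B * S * H) + \<epsilon> * (S * S * H)"
      by linarith
    then show ?thesis by (simp add: C_def algebra_simps)
  qed
  have "- c l \<le> 0"
  proof (rule ccontr)
    assume neg: "\<not> - c l \<le> 0"
    \<comment> \<open>\<open>C + 1\<close> guards against \<open>C = 0\<close>; the choice makes the
      error at most half of \<open>- c l\<close>.\<close>
    define \<epsilon> where "\<epsilon> = min 1 (- c l / (2 * (C + 1)))"
    have pos: "- c l / (2 * (C + 1)) > 0" using neg C by (intro divide_pos_pos) auto
    then have "0 < \<epsilon>" "\<epsilon> \<le> 1" by (auto simp: \<epsilon>_def)
    then have "- c l \<le> \<epsilon> * C" by (rule main)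
    also have "\<dots> \<le> (- c l / (2 * (C + 1))) * (C + 1)"
      using pos C by (intro mult_mono) (auto simp: \<epsilon>_def)
    also have "\<dots> = - c l / 2" using C by (simp add: field_simps)
    finally show False using neg by simp
  qed
  then show ?thesis by simp
qed

lemma low_degree_moments_0:
  assumes e: "low_degree_enum n m M e" and \<alpha>: "\<alpha> \<in> carrier_vec N" "(PM M e)\<^sup>T *\<^sub>v \<alpha> = 0\<^sub>v M"
    and "l < m" "\<mu> \<in> {1..n l}"
  shows "(\<Sum>j<N. \<alpha> $ j * Y l \<mu> (x j)) = 0"
proof -
  obtain i where i: "i < M" "e i = (l, \<mu>)" using low_degree_inv[OF e assms(4,5)] .
  have "((PM M e)\<^sup>T *\<^sub>v \<alpha>) $ i = 0" unfolding \<alpha>(2) using i by simp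
  then show ?thesis using PM_transpose_vec[OF \<alpha>(1) i(1), of e] i(2) by simp
qed

lemma kernel_mat_carrier: "kernel_mat N x \<Psi> \<in> carrier_mat N N"
  by (simp add: kernel_mat_def)

lemma kernel_mat_vec: "\<alpha> \<in> carrier_vec N \<Longrightarrow> i < N \<Longrightarrow> (kernel_mat N x \<Psi> *\<^sub>v \<alpha>) $ i = (\<Sum>j<N. \<Psi> (x i) (x j) * \<alpha> $ j)"
  by (simp add: kernel_mat_def scalar_prod_def atLeast0LessThan)

lemma kernel_mat_quadratic:
  assumes "\<alpha> \<in> carrier_vec N"
  shows "scalar_prod \<alpha> (kernel_mat N x \<Psi> *\<^sub>v \<alpha>) = (\<Sum>i<N. \<Sum>j<N. \<alpha> $ i * \<alpha> $ j * \<Psi> (x i) (x j))"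
proof -
  have "scalar_prod \<alpha> (kernel_mat N x \<Psi> *\<^sub>v \<alpha>) = (\<Sum>i<N. \<alpha> $ i * (kernel_mat N x \<Psi> *\<^sub>v \<alpha>) $ i)"
    using assms kernel_mat_carrier[of \<Psi>] by (simp add: scalar_prod_def atLeast0LessThan)
  also have "\<dots> = (\<Sum>i<N. \<alpha> $ i * (\<Sum>j<N. \<Psi> (x i) (x j) * \<alpha> $ j))"
    using kernel_mat_vec[OF assms] by (intro sum.cong) auto
  finally show ?thesis by (simp add: sum_distrib_left mult_ac)
qed

text \<open>\<open>cond_pos_def\<close> takes weights as functions of the points, so
  \<open>\<alpha>\<close> is transported along the inverse of \<open>x\<close>; this is where the
  nodes have to be distinct.\<close>

lemma kernel_mat_pos:
  assumes e: "low_degree_enum n m M e" and \<alpha>: "\<alpha> \<in> carrier_vec N" "(PM M e)\<^sup>T *\<^sub>v \<alpha> = 0\<^sub>v M" "\<alpha> \<noteq> 0\<^sub>v N"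
  shows "scalar_prod \<alpha> (kernel_mat N x \<Phi> *\<^sub>v \<alpha>) > 0"
proof -
  define w where "w z = \<alpha> $ (inv_into {..<N} x z)" for z
  have w: "w (x j) = \<alpha> $ j" if "j < N" for j using that x_inj by (simp add: w_def)
  have re: "(\<Sum>z\<in>x ` {..<N}. g z) = (\<Sum>j<N. g (x j))" for g :: "'a \<Rightarrow> real"
    by (rule sum.reindex_cong[OF x_inj]) auto
  have vec_eq: "vec N (\<lambda>j. w (x j)) = \<alpha>" using \<alpha>(1) w by (intro eq_vecI) auto
  have ann: "\<forall>q\<in>harmonic_space n Y (m - 1). (\<Sum>z\<in>x ` {..<N}. w z * q z) = 0"
    unfolding re annihilates[OF e, of "\<lambda>j. w (x j)"] vec_eq by (rule \<alpha>(2))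
  have "\<exists>j<N. \<alpha> $ j \<noteq> 0"
  proof (rule ccontr)
    assume "\<not> ?thesis"
    then have "\<alpha> = 0\<^sub>v N" using \<alpha>(1) by (intro eq_vecI) auto
    then show False using \<alpha>(3) by blast
  qed
  then have "\<exists>z\<in>x ` {..<N}. w z \<noteq> 0" using w by force
  with ann have "(\<Sum>z\<in>x ` {..<N}. \<Sum>z'\<in>x ` {..<N}. w z * w z' * \<Phi> z z') > 0"
    using cpd x_sphere unfolding cond_pos_def_def by blast
  then show ?thesis unfolding kernel_mat_quadratic[OF \<alpha>(1)] re using w by simp
qed

end

section \<open>From the kernel expansions to the matrix system\<close>

locale diff_operator = nodes n Y d c \<Phi> m N x
  for n and Y :: "nat \<Rightarrow> nat \<Rightarrow> 'a::euclidean_space \<Rightarrow> real" and d c \<Phi> m N x +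
  fixes lam :: "nat \<Rightarrow> real" and \<kappa> \<gamma> :: real
  assumes lam_summable: "summable (\<lambda>l. \<bar>c l * \<bar>lam l\<bar> * real l ^ (d - 1)\<bar>)"
    and lam_ge: "\<And>l. l \<ge> m \<Longrightarrow> lam l \<ge> \<kappa>" and lam_le: "\<And>l. l < m \<Longrightarrow> lam l \<le> \<kappa> - \<gamma>" and gap: "\<gamma> > 0"
begin

abbreviation "\<Psi> \<equiv> op_kernel n Y lam c"

text \<open>The bound \<open>C * l ^ (d - 1)\<close> for the inner sums does not depend on the
  points and matches the weight in \<open>lam_summable\<close>.\<close>

lemma op_kernel_sums:
  assumes z: "z \<in> sphere 0 1" and w: "w \<in> sphere 0 1"
  shows "(\<lambda>l. \<Sum>\<mu>=1..n l. c l * lam l * Y l \<mu> z * Y l \<mu> w) sums \<Psi> z w"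
  unfolding op_kernel_def
proof (rule summable_sums)
  obtain C where "C \<ge> 0" and "\<And>l x y. x \<in> sphere 0 1 \<Longrightarrow> y \<in> sphere 0 1 \<Longrightarrow> l \<ge> 1 \<Longrightarrow>
    (\<Sum>\<mu>=1..n l. \<bar>Y l \<mu> x * Y l \<mu> y\<bar>) \<le> C * real l ^ (d - 1)" using abs_Y_le by blast
  then have C: "(\<Sum>\<mu>=1..n l. \<bar>Y l \<mu> z * Y l \<mu> w\<bar>) \<le> C * real l ^ (d - 1)" if "l \<ge> 1" for l
    using z w that by blast
  show "summable (\<lambda>l. \<Sum>\<mu>=1..n l. c l * lam l * Y l \<mu> z * Y l \<mu> w)"
  proof (rule summable_comparison_test')
    show "summable (\<lambda>l. C * \<bar>c l * \<bar>lam l\<bar> * real l ^ (d - 1)\<bar>)" using lam_summable by (rule summable_mult)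
    fix l :: nat assume "1 \<le> l"
    have "norm (\<Sum>\<mu>=1..n l. c l * lam l * Y l \<mu> z * Y l \<mu> w) \<le> (\<Sum>\<mu>=1..n l. \<bar>c l * lam l\<bar> * \<bar>Y l \<mu> z * Y l \<mu> w\<bar>)"
      by (rule order_trans[OF norm_sum]) (simp add: abs_mult mult.assoc)
    also have "\<dots> \<le> \<bar>c l * lam l\<bar> * (C * real l ^ (d - 1))"
      unfolding sum_distrib_left[symmetric] using C[OF \<open>1 \<le> l\<close>] by (intro mult_left_mono) auto
    finally show "norm (\<Sum>\<mu>=1..n l. c l * lam l * Y l \<mu> z * Y l \<mu> w) \<le> C * \<bar>c l * \<bar>lam l\<bar> * real l ^ (d - 1)\<bar>"
      by (simp add: abs_mult mult_ac)
  qed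
qed

lemma op_kernel_sym:
  assumes "z \<in> sphere 0 1" "w \<in> sphere 0 1"
  shows "\<Psi> z w = \<Psi> w z"
  unfolding op_kernel_def by (intro suminf_cong sum.cong refl) (simp add: mult_ac)

lemma kernel_mat_op_ge:
  assumes e: "low_degree_enum n m M e" and \<alpha>: "\<alpha> \<in> carrier_vec N" "(PM M e)\<^sup>T *\<^sub>v \<alpha> = 0\<^sub>v M"
  shows "scalar_prod \<alpha> (kernel_mat N x \<Psi> *\<^sub>v \<alpha>) \<ge> \<kappa> * scalar_prod \<alpha> (kernel_mat N x \<Phi> *\<^sub>v \<alpha>)"
proof -
  define q where "q l = (\<Sum>\<mu>=1..n l. (\<Sum>j<N. \<alpha> $ j * Y l \<mu> (x j))\<^sup>2)" for l
  have expand: "(\<Sum>i<N. \<Sum>j<N. \<alpha> $ i * \<alpha> $ j * (\<Sum>\<mu>=1..n l. g * Y l \<mu> (x i) * Y l \<mu> (x j))) = g * q l" for g l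
  proof -
    have "(\<Sum>i<N. \<Sum>j<N. \<alpha> $ i * \<alpha> $ j * (\<Sum>\<mu>=1..n l. g * Y l \<mu> (x i) * Y l \<mu> (x j)))
        = (\<Sum>i<N. \<Sum>j<N. \<Sum>\<mu>=1..n l. g * ((\<alpha> $ i * Y l \<mu> (x i)) * (\<alpha> $ j * Y l \<mu> (x j))))"
      unfolding sum_distrib_left by (intro sum.cong refl) (simp add: mult_ac)
    also have "\<dots> = (\<Sum>i<N. \<Sum>\<mu>=1..n l. \<Sum>j<N. g * ((\<alpha> $ i * Y l \<mu> (x i)) * (\<alpha> $ j * Y l \<mu> (x j))))"
      by (intro sum.cong refl sum.swap)
    also have "\<dots> = (\<Sum>\<mu>=1..n l. \<Sum>i<N. \<Sum>j<N. g * ((\<alpha> $ i * Y l \<mu> (x i)) * (\<alpha> $ j * Y l \<mu> (x j))))"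
      by (rule sum.swap)
    also have "\<dots> = g * q l" unfolding q_def power2_eq_square sum_product unfolding sum_distrib_left ..
    finally show ?thesis .
  qed
  have "(\<lambda>l. \<Sum>i<N. \<Sum>j<N. \<alpha> $ i * \<alpha> $ j * (\<Sum>\<mu>=1..n l. c l * Y l \<mu> (x i) * Y l \<mu> (x j)))
      sums (\<Sum>i<N. \<Sum>j<N. \<alpha> $ i * \<alpha> $ j * \<Phi> (x i) (x j))"
    by (intro sums_sum sums_mult Phi_sums x_in) auto
  then have F: "(\<lambda>l. c l * q l) sums scalar_prod \<alpha> (kernel_mat N x \<Phi> *\<^sub>v \<alpha>)"
    unfolding expand kernel_mat_quadratic[OF \<alpha>(1)] .
  have "(\<lambda>l. \<Sum>i<N. \<Sum>j<N. \<alpha> $ i * \<alpha> $ j * (\<Sum>\<mu>=1..n l. (c l * lam l) * Y l \<mu> (x i) * Y l \<mu> (x j)))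
      sums (\<Sum>i<N. \<Sum>j<N. \<alpha> $ i * \<alpha> $ j * \<Psi> (x i) (x j))"
    by (intro sums_sum sums_mult op_kernel_sums x_in) auto
  then have K: "(\<lambda>l. c l * lam l * q l) sums scalar_prod \<alpha> (kernel_mat N x \<Psi> *\<^sub>v \<alpha>)"
    unfolding expand kernel_mat_quadratic[OF \<alpha>(1)] .
  have "\<kappa> * (c l * q l) \<le> c l * lam l * q l" for l
  \<comment> \<open>For \<open>l < m\<close> the moment conditions give \<open>q l = 0\<close>.
    Without harmonics of degree \<open>l\<close> the sum \<open>q l\<close> is empty, and
    \<open>c_nonneg\<close> says nothing about \<open>c l\<close>.\<close>
  proof (cases "l < m \<or> n l = 0")
    case True
    then have "q l = 0" using low_degree_moments_0[OF e \<alpha>, of l] by (auto simp: q_def)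
    then show ?thesis by simp
  next
    case False
    then have "c l \<ge> 0" "lam l \<ge> \<kappa>" using c_nonneg[of l] lam_ge[of l] by auto
    moreover have "q l \<ge> 0" by (auto simp: q_def intro!: sum_nonneg)
    ultimately have "\<kappa> * (c l * q l) \<le> lam l * (c l * q l)" by (intro mult_right_mono) auto
    then show ?thesis by (simp add: mult_ac)
  qed
  then show ?thesis using sums_le[OF _ sums_mult[OF F] K] by blast
qed

lemma diff_system:
  assumes e: "low_degree_enum n m M e"
  shows "diff_system N M (kernel_mat N x \<Phi>) (kernel_mat N x \<Psi>) (PM M e) (low_degree_diag lam M e) \<kappa> \<gamma>"
proof
  show "low_degree_diag lam M e \<in> carrier_mat M M" "diagonal_mat (low_degree_diag lam M e)"
    by (auto simp: low_degree_diag_def diagonal_mat_def)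
  show "transpose_mat (kernel_mat N x \<Phi>) = kernel_mat N x \<Phi>"
    using Phi_sym x_in by (intro eq_matI) (auto simp: kernel_mat_def)
  show "transpose_mat (kernel_mat N x \<Psi>) = kernel_mat N x \<Psi>"
    using op_kernel_sym x_in by (intro eq_matI) (auto simp: kernel_mat_def)
  show "low_degree_diag lam M e $$ (i, i) \<le> \<kappa> - \<gamma>" if "i < M" for i
    using lam_le[OF low_degree_mem(1)[OF e that]] that by (simp add: low_degree_diag_def)
qed (use kernel_mat_carrier PM_carrier PM_inj[OF e] kernel_mat_pos[OF e] kernel_mat_op_ge[OF e] gap in auto)

text \<open>\<open>spectral_op\<close> sees a function only through its Fourier coefficients. Those
  of the section of \<open>\<Phi>\<close> at \<open>x j\<close> are
  \<open>c l * Y l \<mu> (x j)\<close>, so multiplication by \<open>lam l\<close> produces the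
  series of \<open>\<Psi>\<close>, while the low degree part contributes finitely many
  terms.\<close>

lemma spectral_op_trial:
  assumes e: "low_degree_enum n m M e" and \<alpha>: "\<alpha> \<in> carrier_vec N" and b: "b \<in> carrier_vec M"
    and u: "u = (\<lambda>z. (\<Sum>j<N. \<alpha> $ j * \<Phi> z (x j)) + (\<Sum>i<M. b $ i * Y (fst (e i)) (snd (e i)) z))"
    and z: "z \<in> sphere 0 1"
  shows "spectral_op n Y lam u z = (\<Sum>j<N. \<Psi> z (x j) * \<alpha> $ j) + (\<Sum>i<M. lam (fst (e i)) * b $ i * Y (fst (e i)) (snd (e i)) z)"
proof -
  have inj: "inj_on e {..<M}" using e by (auto simp: low_degree_enum_def bij_betw_def)
  define \<beta> where "\<beta> l \<mu> = b $ (inv_into {..<M} e (l, \<mu>))" for l \<mu>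
  have \<beta>: "\<beta> (fst (e i)) (snd (e i)) = b $ i" if "i < M" for i
    using that inj by (simp add: \<beta>_def)
  have u': "u = (\<lambda>z. (\<Sum>j<N. \<alpha> $ j * \<Phi> z (x j)) + (\<Sum>l<m. \<Sum>\<mu>=1..n l. \<beta> l \<mu> * Y l \<mu> z))"
    unfolding u low_degree_sum[OF e] using \<beta> by simp
  have coeff: "sphere_inner u (Y l \<mu>) = (\<Sum>j<N. \<alpha> $ j * (c l * Y l \<mu> (x j))) + (if l < m then \<beta> l \<mu> else 0)"
    if \<mu>: "\<mu> \<in> {1..n l}" for l \<mu>
  proof -
    have c1: "continuous_on (sphere 0 1) (\<lambda>z. \<Sum>j<N. \<alpha> $ j * \<Phi> z (x j))"
      by (intro continuous_intros Phi_continuous_left x_in) auto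
    have c2: "continuous_on (sphere 0 1) (\<lambda>z. \<Sum>l<m. \<Sum>\<mu>=1..n l. \<beta> l \<mu> * Y l \<mu> z)"
      by (intro continuous_intros Y_continuous)
    have "sphere_inner u (Y l \<mu>) = sphere_inner (\<lambda>z. \<Sum>j<N. \<alpha> $ j * \<Phi> z (x j)) (Y l \<mu>)
        + sphere_inner (\<lambda>z. \<Sum>l<m. \<Sum>\<mu>=1..n l. \<beta> l \<mu> * Y l \<mu> z) (Y l \<mu>)"
      unfolding u' sphere_inner_def distrib_right
      by (intro Bochner_Integration.integral_add integrable_surface continuous_on_mult c1 c2 Y_continuous[OF \<mu>])
    also have "sphere_inner (\<lambda>z. \<Sum>j<N. \<alpha> $ j * \<Phi> z (x j)) (Y l \<mu>) = (\<Sum>j<N. \<alpha> $ j * sphere_inner (\<lambda>z. \<Phi> z (x j)) (Y l \<mu>))"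
      by (intro sphere_inner_sum_left Phi_continuous_left x_in Y_continuous[OF \<mu>]) auto
    also have "\<dots> = (\<Sum>j<N. \<alpha> $ j * (c l * Y l \<mu> (x j)))"
      using sphere_inner_Phi[OF x_in \<mu>] by simp
    finally show ?thesis using sphere_inner_expansion[OF \<mu>, where L = m and b = \<beta>] by simp
  qed
  have trm: "(\<Sum>\<mu>=1..n l. lam l * sphere_inner u (Y l \<mu>) * Y l \<mu> z)
      = (\<Sum>j<N. \<alpha> $ j * (\<Sum>\<mu>=1..n l. c l * lam l * Y l \<mu> z * Y l \<mu> (x j)))
        + (if l \<in> {..<m} then \<Sum>\<mu>=1..n l. lam l * \<beta> l \<mu> * Y l \<mu> z else 0)" for l
  proof -
    have "(\<Sum>\<mu>=1..n l. lam l * sphere_inner u (Y l \<mu>) * Y l \<mu> z)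
        = (\<Sum>\<mu>=1..n l. (\<Sum>j<N. \<alpha> $ j * (c l * lam l * Y l \<mu> z * Y l \<mu> (x j))) + (if l < m then lam l * \<beta> l \<mu> * Y l \<mu> z else 0))"
    proof (rule sum.cong[OF refl])
      fix \<mu> assume \<mu>: "\<mu> \<in> {1..n l}"
      have "lam l * (\<Sum>j<N. \<alpha> $ j * (c l * Y l \<mu> (x j))) * Y l \<mu> z = (\<Sum>j<N. \<alpha> $ j * (c l * lam l * Y l \<mu> z * Y l \<mu> (x j)))"
        unfolding sum_distrib_left sum_distrib_right by (intro sum.cong refl) (simp add: mult_ac)
      then show "lam l * sphere_inner u (Y l \<mu>) * Y l \<mu> z = (\<Sum>j<N. \<alpha> $ j * (c l * lam l * Y l \<mu> z * Y l \<mu> (x j))) + (if l < m then lam l * \<beta> l \<mu> * Y l \<mu> z else 0)"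
        unfolding coeff[OF \<mu>] by (simp add: distrib_left distrib_right)
    qed
    also have "\<dots> = (\<Sum>j<N. \<Sum>\<mu>=1..n l. \<alpha> $ j * (c l * lam l * Y l \<mu> z * Y l \<mu> (x j)))
        + (\<Sum>\<mu>=1..n l. if l < m then lam l * \<beta> l \<mu> * Y l \<mu> z else 0)"
      unfolding sum.distrib by (subst sum.swap) simp
    finally show ?thesis by (simp add: sum_distrib_left)
  qed
  have "(\<lambda>l. \<Sum>\<mu>=1..n l. lam l * sphere_inner u (Y l \<mu>) * Y l \<mu> z) sums
      ((\<Sum>j<N. \<alpha> $ j * \<Psi> z (x j)) + (\<Sum>l<m. \<Sum>\<mu>=1..n l. lam l * \<beta> l \<mu> * Y l \<mu> z))"
    unfolding trm using z
    by (intro sums_add sums_sum sums_mult op_kernel_sums x_in sums_If_finite_set) auto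
  then have "spectral_op n Y lam u z = (\<Sum>j<N. \<alpha> $ j * \<Psi> z (x j)) + (\<Sum>l<m. \<Sum>\<mu>=1..n l. lam l * \<beta> l \<mu> * Y l \<mu> z)"
    unfolding spectral_op_def by (rule sums_unique[symmetric])
  then show ?thesis unfolding low_degree_sum[OF e] using \<beta> by (simp add: mult.commute)
qed

text \<open>Passes from trial functions to coefficient vectors, where the existence and uniqueness
  argument of \<open>diff_system\<close> applies.\<close>

lemma is_diff_mat_iff:
  assumes e: "low_degree_enum n m M e"
  shows "is_diff_mat n Y m \<Phi> lam N x A \<longleftrightarrow>
    diff_system.is_diff N M (kernel_mat N x \<Phi>) (kernel_mat N x \<Psi>) (PM M e) (low_degree_diag lam M e) A"
proof -
  interpret D: diff_system N M "kernel_mat N x \<Phi>" "kernel_mat N x \<Psi>" "PM M e" "low_degree_diag lam M e" \<kappa> \<gamma>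
    by (rule diff_system[OF e])
  define U where "U \<alpha> b = (\<lambda>z. (\<Sum>j<N. \<alpha> $ j * \<Phi> z (x j)) + (\<Sum>i<M. b $ i * Y (fst (e i)) (snd (e i)) z))"
    for \<alpha> b :: "real Matrix.vec"
  have inj: "inj_on e {..<M}" using e by (auto simp: low_degree_enum_def bij_betw_def)
  have val: "vec N (\<lambda>j. U \<alpha> b (x j)) = kernel_mat N x \<Phi> *\<^sub>v \<alpha> + PM M e *\<^sub>v b"
    if ab: "\<alpha> \<in> carrier_vec N" "b \<in> carrier_vec M" for \<alpha> b
  proof (rule eq_vecI)
    fix i assume "i < dim_vec (kernel_mat N x \<Phi> *\<^sub>v \<alpha> + PM M e *\<^sub>v b)"
    then have i: "i < N" using PM_carrier[of M e] by simp
    have "(kernel_mat N x \<Phi> *\<^sub>v \<alpha> + PM M e *\<^sub>v b) $ i = (kernel_mat N x \<Phi> *\<^sub>v \<alpha>) $ i + (PM M e *\<^sub>v b) $ i"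
      using i PM_carrier[of M e] by (intro index_add_vec) simp
    then show "vec N (\<lambda>j. U \<alpha> b (x j)) $ i = (kernel_mat N x \<Phi> *\<^sub>v \<alpha> + PM M e *\<^sub>v b) $ i"
      unfolding kernel_mat_vec[OF ab(1) i] PM_vec[OF ab(2) i] using i by (simp add: U_def mult.commute)
  qed (use PM_carrier[of M e] in simp)
  have op: "vec N (\<lambda>j. spectral_op n Y lam (U \<alpha> b) (x j)) = kernel_mat N x \<Psi> *\<^sub>v \<alpha> + PM M e *\<^sub>v (low_degree_diag lam M e *\<^sub>v b)"
    if ab: "\<alpha> \<in> carrier_vec N" "b \<in> carrier_vec M" for \<alpha> b
  proof (rule eq_vecI)
    fix i assume "i < dim_vec (kernel_mat N x \<Psi> *\<^sub>v \<alpha> + PM M e *\<^sub>v (low_degree_diag lam M e *\<^sub>v b))"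
    then have i: "i < N" using PM_carrier[of M e] by simp
    have Lb: "low_degree_diag lam M e *\<^sub>v b \<in> carrier_vec M" using D.L ab by simp
    have Lbi: "(low_degree_diag lam M e *\<^sub>v b) $ k = lam (fst (e k)) * b $ k" if "k < M" for k
      using diagonal_mat_vec_index[OF D.L ab(2) that] that by (simp add: low_degree_diag_def)
    have "(kernel_mat N x \<Psi> *\<^sub>v \<alpha> + PM M e *\<^sub>v (low_degree_diag lam M e *\<^sub>v b)) $ i
        = (kernel_mat N x \<Psi> *\<^sub>v \<alpha>) $ i + (PM M e *\<^sub>v (low_degree_diag lam M e *\<^sub>v b)) $ i"
      using i PM_carrier[of M e] by (intro index_add_vec) simp
    also have "\<dots> = (\<Sum>j<N. \<Psi> (x i) (x j) * \<alpha> $ j) + (\<Sum>k<M. lam (fst (e k)) * b $ k * Y (fst (e k)) (snd (e k)) (x i))"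
      unfolding kernel_mat_vec[OF ab(1) i] PM_vec[OF Lb i] using Lbi by simp
    also have "\<dots> = spectral_op n Y lam (U \<alpha> b) (x i)"
      using spectral_op_trial[OF e ab _ x_in[OF i]] U_def by metis
    finally show "vec N (\<lambda>j. spectral_op n Y lam (U \<alpha> b) (x j)) $ i
        = (kernel_mat N x \<Psi> *\<^sub>v \<alpha> + PM M e *\<^sub>v (low_degree_diag lam M e *\<^sub>v b)) $ i"
      using i by simp
  qed (use PM_carrier[of M e] in simp)
  have trial: "trial_space n Y m \<Phi> N x = {U \<alpha> b | \<alpha> b. \<alpha> \<in> carrier_vec N \<and> b \<in> carrier_vec M \<and> (PM M e)\<^sup>T *\<^sub>v \<alpha> = 0\<^sub>v M}"
  proof (intro equalityI subsetI)
    fix u assume "u \<in> trial_space n Y m \<Phi> N x"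
    then obtain a q where u: "u = (\<lambda>z. (\<Sum>j<N. a j * \<Phi> z (x j)) + q z)"
      and ann: "\<forall>r\<in>harmonic_space n Y (m - 1). (\<Sum>j<N. a j * r (x j)) = 0" and "q \<in> harmonic_space n Y (m - 1)"
      unfolding trial_space_def by blast
    then obtain \<beta> where q: "q = (\<lambda>z. \<Sum>l<m. \<Sum>\<mu>=1..n l. \<beta> l \<mu> * Y l \<mu> z)" unfolding harmonic_space_eq by blast
    have "u = U (vec N a) (vec M (\<lambda>i. \<beta> (fst (e i)) (snd (e i))))"
      unfolding u q U_def low_degree_sum[OF e] by simp
    then show "u \<in> {U \<alpha> b | \<alpha> b. \<alpha> \<in> carrier_vec N \<and> b \<in> carrier_vec M \<and> (PM M e)\<^sup>T *\<^sub>v \<alpha> = 0\<^sub>v M}"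
      using ann annihilates[OF e, of a] by (metis (mono_tags, lifting) mem_Collect_eq vec_carrier)
  next
    fix u assume "u \<in> {U \<alpha> b | \<alpha> b. \<alpha> \<in> carrier_vec N \<and> b \<in> carrier_vec M \<and> (PM M e)\<^sup>T *\<^sub>v \<alpha> = 0\<^sub>v M}"
    then obtain \<alpha> b where u: "u = U \<alpha> b" and ab: "\<alpha> \<in> carrier_vec N" "b \<in> carrier_vec M" "(PM M e)\<^sup>T *\<^sub>v \<alpha> = 0\<^sub>v M"
      by blast
    define \<beta> where "\<beta> l \<mu> = b $ (inv_into {..<M} e (l, \<mu>))" for l \<mu>
    define q where "q = (\<lambda>z. \<Sum>l<m. \<Sum>\<mu>=1..n l. \<beta> l \<mu> * Y l \<mu> z)"
    have "vec N (\<lambda>j. \<alpha> $ j) = \<alpha>" using ab(1) by (intro eq_vecI) auto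
    then have "\<forall>r\<in>harmonic_space n Y (m - 1). (\<Sum>j<N. \<alpha> $ j * r (x j)) = 0"
      using annihilates[OF e, of "\<lambda>j. \<alpha> $ j"] ab(3) by simp
    moreover have "q \<in> harmonic_space n Y (m - 1)" unfolding harmonic_space_eq q_def by blast
    moreover have "u = (\<lambda>z. (\<Sum>j<N. \<alpha> $ j * \<Phi> z (x j)) + q z)"
      unfolding u U_def q_def low_degree_sum[OF e] using inj by (simp add: \<beta>_def)
    ultimately show "u \<in> trial_space n Y m \<Phi> N x" unfolding trial_space_def by blast
  qed
  show ?thesis unfolding is_diff_mat_def D.is_diff_def trial using val op by fastforce
qed

text \<open>\<open>diff_mat\<close> is a definite description; \<open>is_diff_ex1\<close> gives it
  content.\<close>

lemma diff_mat_is_diff: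
  assumes e: "low_degree_enum n m M e"
  shows "diff_system.is_diff N M (kernel_mat N x \<Phi>) (kernel_mat N x \<Psi>) (PM M e) (low_degree_diag lam M e)
    (diff_mat n Y m \<Phi> lam N x)"
proof -
  interpret D: diff_system N M "kernel_mat N x \<Phi>" "kernel_mat N x \<Psi>" "PM M e" "low_degree_diag lam M e" \<kappa> \<gamma>
    by (rule diff_system[OF e])
  show ?thesis unfolding diff_mat_def is_diff_mat_iff[OF e] by (rule theI'[OF D.is_diff_ex1])
qed

end

theorem theorem4p5:
  fixes d m N :: nat
    and n :: "nat \<Rightarrow> nat"
    and Y :: "nat \<Rightarrow> nat \<Rightarrow> 'a::euclidean_space \<Rightarrow> real"
    and \<Phi> :: "'a \<Rightarrow> 'a \<Rightarrow> real"
    and c lam :: "nat \<Rightarrow> real"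
    and p :: "real \<Rightarrow> real"
    and \<gamma> :: real
    and x :: "nat \<Rightarrow> 'a"
  assumes "DIM('a) = d + 1" and "d \<ge> 2" and "m \<ge> 1"
    and "harmonic_basis n Y"
    and "zonal_kernel n Y c \<Phi>"
    and "cond_pos_def n Y m \<Phi>"
    and "\<And>l. lam l = p (beltrami_eigenvalue d l)"
    and "\<exists>k. lam \<in> O(\<lambda>l. real l ^ k)"
    and "summable (\<lambda>l. \<bar>c l * \<bar>lam l\<bar> * real l ^ (d - 1)\<bar>)"
    and "bdd_below (lam ` {m..})"
    and "\<gamma> = (INF l\<in>{m..}. lam l) - Max (lam ` {..<m})"
    and "\<gamma> > 0"
    and "inj_on x {..<N}" and "x ` {..<N} \<subseteq> sphere 0 1"
    and "unisolvent n Y (m - 1) (x ` {..<N})"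
  shows "diagonalizable (diff_mat n Y m \<Phi> lam N x) \<and>
    (\<forall>M e W S U \<Theta>.
       let MX = diff_mat n Y m \<Phi> lam N x;
           P = harmonic_mat Y M e N x;
           \<Lambda> = low_degree_diag lam M e;
           F = kernel_mat N x \<Phi>;
           K = kernel_mat N x (op_kernel n Y lam c);
           Z = block_Z W S U;
           V = block_V P Z;
           R = block_R P \<Lambda> F K W Z
       in low_degree_enum n m M e \<longrightarrow> block_choice N M P F K W S U \<Theta> \<longrightarrow>
          (\<forall>M\<epsilon> \<in> carrier_mat N N. \<forall>\<mu> \<in> complex_spectrum M\<epsilon>.
             spectral_dist \<mu> (complex_spectrum MX)
               \<le> (1 + op_norm R / \<gamma>)\<^sup>2 * op_norm V * op_norm (inv_mat V) * op_norm (MX - M\<epsilon>)))"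
proof -
  define \<kappa> where "\<kappa> = (INF l\<in>{m..}. lam l)"
  have \<gamma>: "\<kappa> - \<gamma> = Max (lam ` {..<m})" using assms(11) by (simp add: \<kappa>_def)
  interpret diff_operator n Y d c \<Phi> m N x lam \<kappa> \<gamma>
  proof
    \<comment> \<open>Boundedness from below makes the real-valued \<open>INF\<close> a true lower
      bound.\<close>
    show "\<kappa> \<le> lam l" if "m \<le> l" for l
      unfolding \<kappa>_def using assms(10) that by (intro cINF_lower) auto
    show "lam l \<le> \<kappa> - \<gamma>" if "l < m" for l
      unfolding \<gamma> using that by (intro Max_ge) auto
  qed (use assms in auto)
  show ?thesis
  proof (intro conjI allI)
    \<comment> \<open>The claim about diagonalizability mentions no enumeration of the low degrees;
      any one serves.\<close>
    obtain M e where e: "low_degree_enum n m M e" using low_degree_enum_ex by blast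
    show "diagonalizable (diff_mat n Y m \<Phi> lam N x)"
      by (rule diff_system.is_diff_diagonalizable[OF diff_system[OF e] diff_mat_is_diff[OF e]])
  next
    fix M e W S U \<Theta>
    show "let MX = diff_mat n Y m \<Phi> lam N x;
           P = harmonic_mat Y M e N x;
           \<Lambda> = low_degree_diag lam M e;
           F = kernel_mat N x \<Phi>;
           K = kernel_mat N x (op_kernel n Y lam c);
           Z = block_Z W S U;
           V = block_V P Z;
           R = block_R P \<Lambda> F K W Z
       in low_degree_enum n m M e \<longrightarrow> block_choice N M P F K W S U \<Theta> \<longrightarrow>
          (\<forall>M\<epsilon> \<in> carrier_mat N N. \<forall>\<mu> \<in> complex_spectrum M\<epsilon>.
             spectral_dist \<mu> (complex_spectrum MX)
               \<le> (1 + op_norm R / \<gamma>)\<^sup>2 * op_norm V * op_norm (inv_mat V) * op_norm (MX - M\<epsilon>))"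
      unfolding Let_def
    proof (intro impI ballI)
      assume e: "low_degree_enum n m M e"
        and bc: "block_choice N M (PM M e) (kernel_mat N x \<Phi>) (kernel_mat N x \<Psi>) W S U \<Theta>"
      fix M\<epsilon> \<mu> assume "M\<epsilon> \<in> carrier_mat N N" "\<mu> \<in> complex_spectrum M\<epsilon>"
      moreover have "block_decomposition N M (kernel_mat N x \<Phi>) (kernel_mat N x \<Psi>) (PM M e)
          (low_degree_diag lam M e) \<kappa> \<gamma> W S U \<Theta> (diff_mat n Y m \<Phi> lam N x)"
        by (intro block_decomposition.intro diff_system[OF e] block_decomposition_axioms.intro bc diff_mat_is_diff[OF e])
      ultimately show "spectral_dist \<mu> (complex_spectrum (diff_mat n Y m \<Phi> lam N x))
          \<le> (1 + op_norm (block_R (PM M e) (low_degree_diag lam M e) (kernel_mat N x \<Phi>) (kernel_mat N x \<Psi>) W (block_Z W S U)) / \<gamma>)\<^sup>2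
            * op_norm (block_V (PM M e) (block_Z W S U)) * op_norm (inv_mat (block_V (PM M e) (block_Z W S U)))
            * op_norm (diff_mat n Y m \<Phi> lam N x - M\<epsilon>)"
        by (intro block_decomposition.spectral_bound)
    qed
  qed
qed

end
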